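(* Let $n=3$, $m=1$, and let $E$, $F$, $\mathcal{R}(E)\subset\mathcal{R}(F)$ be as in the context. Let $U=\mathcal{R}(E)_{0,*}=\Bbbk[T_1,T_2,T_3]$. Then for all $-1\le i\le d_1-1$, there is an isomorphism (of graded $U$-modules) $\mathcal{R}(F)_{i,*}\cong U^{i+1}\oplus U^{d_1-i-1}(-1)$ under which $\mathcal{R}(E)_{i,*}\cong U^{i+1}$.
   Context: Let $\Bbbk$ be a field, $R=\Bbbk[x_0,x_1]$ with the standard grading. For a finitely generated $R$-module $E$, the Rees algebra $\mathcal{R}(E)$ is the symmetric algebra of $E$ modulo its $R$-torsion. Let $I\subset R$ be a height two ideal minimally generated by $3$ forms of degree $d$, with graded free (Hilbert-Burch) resolution $0\to R(-d_1)\oplus R(-d_2)\xrightarrow{\varphi}R^3\to I(d)\to0$, $1\le d_1\le d_2$. Let $S=R[T_1,T_2,T_3]$, bigraded by $\deg x_i=(1,0)$, $\deg T_i=(0,1)$, and $[g_1\ g_2]=[T_1\ T_2\ T_3]\varphi$. Let $\varphi_1$ be the first column of $\varphi$, $E=\operatorname{coker}\varphi_1$ (a torsionfree $R$-module of rank 2 generated in degree 0), $F=E^{**}$ where $-^*=\operatorname{Hom}_R(-,R)$. $F$ is graded free; fix $F\cong R(\sigma_1)\oplus R(\sigma_2)$ with $\sigma_1\ge\sigma_2\ge0$. Let $\xi:R^3\twoheadrightarrow E\hookrightarrow F$ be the composite, viewed as a $2\times3$ matrix. Then $\mathcal{R}(F)=R[w_1,w_2]$ is a polynomial ring with $w_i$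 corresponding to the $i$th basis element of $F$, bigraded by $\deg x_i=(1,0)$, $\deg w_i=(-\sigma_i,1)$; $E\subset F$ induces an inclusion of bigraded rings $\mathcal{R}(E)=S/(g_1)\subset\mathcal{R}(F)$ with $[T_1\ T_2\ T_3]=[w_1\ w_2]\xi$. For a bigraded ring $A$, $A_{i,*}=\bigoplus_jA_{i,j}$, graded by the second degree. *)

theory Defs
  imports
    "HOL-Analysis.Finite_Cartesian_Product"
    "HOL-Library.Poly_Mapping"
    "HOL-Library.Extended_Nat"
    "HOL-Library.Numeral_Type"
    "HOL-Algebra.Algebraic_Closure_Type"
    "HOL-Algebra.QuotRing"
    "HOL-Algebra.Generated_Groups"
    "HOL-Algebra.Module"
begin

section \<open>Polynomial rings\<close>

text \<open>Monomials are finitely supported exponent functions, polynomials are finitely supported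
  functions on monomials; the multiplication of \<^theory>\<open>HOL-Library.Poly_Mapping\<close> is
  convolution.\<close>

type_synonym ('v, 'r) mpoly = "('v \<Rightarrow>\<^sub>0 nat) \<Rightarrow>\<^sub>0 'r"

definition mconst :: "'r::zero \<Rightarrow> ('v, 'r) mpoly" where
  "mconst c = Poly_Mapping.single 0 c"

definition mvar :: "'v \<Rightarrow> ('v, 'r::zero_neq_one) mpoly" where
  "mvar v = Poly_Mapping.single (Poly_Mapping.single v 1) 1"

definition mdegree :: "('v \<Rightarrow>\<^sub>0 nat) \<Rightarrow> nat" where
  "mdegree m = (\<Sum>v\<in>Poly_Mapping.keys m. Poly_Mapping.lookup m v)"

text \<open>The homogeneous component of degree \<open>i\<close> for the standard grading; it contains \<open>0\<close>, and it is
  \<open>{0}\<close> for negative \<open>i\<close>.\<close>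

definition forms :: "int \<Rightarrow> ('v, 'r::zero) mpoly set" where
  "forms i = {p. \<forall>m\<in>Poly_Mapping.keys p. int (mdegree m) = i}"

text \<open>The substitution that applies \<open>f\<close> to the coefficients and sends the variable \<open>v\<close> to \<open>g v\<close>.\<close>

definition meval :: "('r::zero \<Rightarrow> 's::comm_ring_1) \<Rightarrow> ('v \<Rightarrow> 's) \<Rightarrow> ('v, 'r) mpoly \<Rightarrow> 's" where
  "meval f g p = (\<Sum>m\<in>Poly_Mapping.keys p.
     f (Poly_Mapping.lookup p m) * (\<Prod>v\<in>Poly_Mapping.keys m. g v ^ Poly_Mapping.lookup m v))"

definition mpoly_ring :: "'v set \<Rightarrow> ('v, 'r::comm_ring_1) mpoly ring" where
  "mpoly_ring V = ring_of_type_algebra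
     \<lparr>carrier := {p. \<forall>m\<in>Poly_Mapping.keys p. Poly_Mapping.keys m \<subseteq> V}\<rparr>"

section \<open>Ideals\<close>

definition prime_height :: "('a, 'b) ring_scheme \<Rightarrow> 'a set \<Rightarrow> enat" where
  "prime_height R P = Sup {enat n | n. \<exists>C :: nat \<Rightarrow> 'a set.
     (\<forall>i\<le>n. primeideal (C i) R) \<and> (\<forall>i<n. C i \<subset> C (Suc i)) \<and> C n = P}"

definition ideal_height :: "('a, 'b) ring_scheme \<Rightarrow> 'a set \<Rightarrow> enat" where
  "ideal_height R I = Inf {prime_height R P | P. primeideal P R \<and> I \<subseteq> P}"

definition minimally_generates :: "('a, 'b) ring_scheme \<Rightarrow> 'a set \<Rightarrow> 'a set \<Rightarrow> bool" where
  "minimally_generates R B I \<longleftrightarrow>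
     B \<subseteq> carrier R \<and> genideal R B = I \<and> (\<forall>B'. B' \<subset> B \<longrightarrow> genideal R B' \<noteq> I)"

section \<open>Modules\<close>

text \<open>The scalars are always all elements of a commutative ring type. The fields \<open>mult\<close> and \<open>one\<close>
  that \<^typ>\<open>('r, 'm) module\<close> inherits from rings play no role. A grading of a module is given by its
  family of homogeneous components.\<close>

definition regular_module :: "('r::comm_ring_1, 'r) module" where
  "regular_module = \<lparr>carrier = UNIV, monoid.mult = (*), monoid.one = 1, zero = 0, add = (+), module.smult = (*)\<rparr>"

definition vec_module :: "('r::comm_ring_1, 'r ^ 'n) module" where
  "vec_module = \<lparr>carrier = UNIV, monoid.mult = undefined, monoid.one = undefined,
     zero = 0, add = (+), module.smult = (*s)\<rparr>"

definition free_module :: "nat \<Rightarrow> ('r::comm_ring_1, nat \<Rightarrow> 'r) module" where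
  "free_module n = \<lparr>carrier = {..<n} \<rightarrow>\<^sub>E UNIV, monoid.mult = undefined, monoid.one = undefined,
     zero = (\<lambda>l\<in>{..<n}. 0), add = (\<lambda>a b. \<lambda>l\<in>{..<n}. a l + b l),
     module.smult = (\<lambda>r a. \<lambda>l\<in>{..<n}. r * a l)\<rparr>"

definition free_grading :: "nat \<Rightarrow> int \<Rightarrow> (nat \<Rightarrow> ('v, 'k::zero) mpoly) set" where
  "free_grading n j = {..<n} \<rightarrow>\<^sub>E forms j"

definition shift :: "int \<Rightarrow> (int \<Rightarrow> 'm set) \<Rightarrow> int \<Rightarrow> 'm set" where
  "shift a G j = G (a + j)"

definition module_sum :: "('r, 'm) module \<Rightarrow> ('r, 'n) module \<Rightarrow> ('r, 'm \<times> 'n) module" where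
  "module_sum M N = \<lparr>carrier = carrier M \<times> carrier N, monoid.mult = undefined, monoid.one = undefined,
     zero = (\<zero>\<^bsub>M\<^esub>, \<zero>\<^bsub>N\<^esub>),
     add = (\<lambda>x y. (fst x \<oplus>\<^bsub>M\<^esub> fst y, snd x \<oplus>\<^bsub>N\<^esub> snd y)),
     module.smult = (\<lambda>r x. (r \<odot>\<^bsub>M\<^esub> fst x, r \<odot>\<^bsub>N\<^esub> snd x))\<rparr>"

definition sum_grading :: "(int \<Rightarrow> 'm set) \<Rightarrow> (int \<Rightarrow> 'n set) \<Rightarrow> int \<Rightarrow> ('m \<times> 'n) set" where
  "sum_grading G H j = G j \<times> H j"

definition quot_module :: "('r, 'm) module \<Rightarrow> 'm set \<Rightarrow> ('r, 'm set) module" where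
  "quot_module M N = \<lparr>carrier = a_rcosets\<^bsub>M\<^esub> N, monoid.mult = undefined, monoid.one = undefined,
     zero = N, add = set_add M, module.smult = (\<lambda>r A. \<Union>x\<in>A. N +>\<^bsub>M\<^esub> (r \<odot>\<^bsub>M\<^esub> x))\<rparr>"

definition quot_grading ::
    "('r, 'm) module \<Rightarrow> 'm set \<Rightarrow> (int \<Rightarrow> 'm set) \<Rightarrow> int \<Rightarrow> 'm set set" where
  "quot_grading M N G j = (\<lambda>x. N +>\<^bsub>M\<^esub> x) ` G j"

definition module_homs :: "('r, 'm) module \<Rightarrow> ('r, 'n) module \<Rightarrow> ('m \<Rightarrow> 'n) set" where
  "module_homs M N = {h \<in> carrier M \<rightarrow>\<^sub>E carrier N.
     (\<forall>x\<in>carrier M. \<forall>y\<in>carrier M. h (x \<oplus>\<^bsub>M\<^esub> y) = h x \<oplus>\<^bsub>N\<^esub> h y) \<and>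
     (\<forall>r. \<forall>x\<in>carrier M. h (r \<odot>\<^bsub>M\<^esub> x) = r \<odot>\<^bsub>N\<^esub> h x)}"

definition graded_module_iso ::
    "('r, 'm) module \<Rightarrow> (int \<Rightarrow> 'm set) \<Rightarrow> ('r, 'n) module \<Rightarrow> (int \<Rightarrow> 'n set) \<Rightarrow> ('m \<Rightarrow> 'n) \<Rightarrow> bool"
  where
  "graded_module_iso M G N H h \<longleftrightarrow>
     h \<in> module_homs M N \<and> bij_betw h (carrier M) (carrier N) \<and> (\<forall>j. h ` G j = H j)"

definition dual :: "('r::comm_ring_1, 'm) module \<Rightarrow> ('r, 'm \<Rightarrow> 'r) module" where
  "dual M = \<lparr>carrier = module_homs M regular_module, monoid.mult = undefined, monoid.one = undefined,
     zero = (\<lambda>x\<in>carrier M. 0), add = (\<lambda>f g. \<lambda>x\<in>carrier M. f x + g x),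
     module.smult = (\<lambda>r f. \<lambda>x\<in>carrier M. r * f x)\<rparr>"

text \<open>A functional is homogeneous of degree \<open>j\<close> if it raises degrees by \<open>j\<close>.\<close>

definition dual_grading ::
    "(('v, 'k::comm_ring_1) mpoly, 'm) module \<Rightarrow> (int \<Rightarrow> 'm set) \<Rightarrow>
     int \<Rightarrow> ('m \<Rightarrow> ('v, 'k) mpoly) set" where
  "dual_grading M G j = {f \<in> carrier (dual M). \<forall>i. f ` G i \<subseteq> forms (i + j)}"

definition to_bidual :: "('r::comm_ring_1, 'm) module \<Rightarrow> 'm \<Rightarrow> ('m \<Rightarrow> 'r) \<Rightarrow> 'r" where
  "to_bidual M x = (\<lambda>f\<in>carrier (dual M). f x)"

definition coker_module :: "'r::comm_ring_1 ^ 'n \<Rightarrow> ('r, ('r ^ 'n) set) module" where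
  "coker_module c = quot_module vec_module (range (\<lambda>r. r *s c))"

definition coker_grading ::
    "('v, 'k::comm_ring_1) mpoly ^ 'n \<Rightarrow> int \<Rightarrow> (('v, 'k) mpoly ^ 'n) set set" where
  "coker_grading c =
     quot_grading vec_module (range (\<lambda>r. r *s c)) (\<lambda>j. {v. \<forall>l. v $ l \<in> forms j})"

definition coker_gen :: "'r::comm_ring_1 ^ 'n \<Rightarrow> 'n \<Rightarrow> ('r ^ 'n) set" where
  "coker_gen c l = range (\<lambda>r. r *s c) +>\<^bsub>vec_module\<^esub> axis l 1"

section \<open>Rees algebras of modules\<close>

text \<open>The symmetric algebra is presented with all elements of the module as variables, subject to
  the linear relations holding in the module.\<close>

definition sym_ideal :: "('r::comm_ring_1, 'm) module \<Rightarrow> ('m, 'r) mpoly set" where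
  "sym_ideal M = genideal (mpoly_ring (carrier M))
     ({mvar (x \<oplus>\<^bsub>M\<^esub> y) - (mvar x + mvar y) | x y. x \<in> carrier M \<and> y \<in> carrier M} \<union>
      {mvar (r \<odot>\<^bsub>M\<^esub> x) - mconst r * mvar x | r x. x \<in> carrier M})"

definition sym_alg :: "('r::comm_ring_1, 'm) module \<Rightarrow> ('m, 'r) mpoly set ring" where
  "sym_alg M = mpoly_ring (carrier M) Quot sym_ideal M"

definition sym_class :: "('r::comm_ring_1, 'm) module \<Rightarrow> ('m, 'r) mpoly \<Rightarrow> ('m, 'r) mpoly set" where
  "sym_class M p = sym_ideal M +>\<^bsub>mpoly_ring (carrier M)\<^esub> p"

definition sym_torsion :: "('r::comm_ring_1, 'm) module \<Rightarrow> ('m, 'r) mpoly set set" where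
  "sym_torsion M = {a \<in> carrier (sym_alg M).
     \<exists>r. (\<forall>s. r * s = 0 \<longrightarrow> s = 0) \<and>
         sym_class M (mconst r) \<otimes>\<^bsub>sym_alg M\<^esub> a = \<zero>\<^bsub>sym_alg M\<^esub>}"

definition rees :: "('r::comm_ring_1, 'm) module \<Rightarrow> ('m, 'r) mpoly set set ring" where
  "rees M = sym_alg M Quot sym_torsion M"

definition rees_class ::
    "('r::comm_ring_1, 'm) module \<Rightarrow> ('m, 'r) mpoly \<Rightarrow> ('m, 'r) mpoly set set" where
  "rees_class M p = sym_torsion M +>\<^bsub>sym_alg M\<^esub> sym_class M p"

text \<open>The ring homomorphism \<open>rees M \<rightarrow> rees N\<close> induced by a linear map \<open>h\<close> from \<open>M\<close> to \<open>N\<close>; its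
  value is read off from any polynomial representing the argument.\<close>

definition rees_map ::
    "('r::comm_ring_1, 'm) module \<Rightarrow> ('r, 'n) module \<Rightarrow> ('m \<Rightarrow> 'n) \<Rightarrow>
     ('m, 'r) mpoly set set \<Rightarrow> ('n, 'r) mpoly set set" where
  "rees_map M N h A = the_elem
     ((\<lambda>p. rees_class N (meval mconst (\<lambda>x. mvar (h x)) p)) `
      {p \<in> carrier (mpoly_ring (carrier M)). rees_class M p = A})"

text \<open>The bigrading of \<open>rees M\<close> for a graded module \<open>M\<close>: ring elements of degree \<open>a\<close> have bidegree
  \<open>(a, 0)\<close>, module elements of degree \<open>b\<close> have bidegree \<open>(b, 1)\<close>.\<close>

inductive rees_bihomogeneous ::
    "(('v, 'k::comm_ring_1) mpoly, 'm) module \<Rightarrow> (int \<Rightarrow> 'm set) \<Rightarrow> int \<Rightarrow> int \<Rightarrow>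
     ('m, ('v, 'k) mpoly) mpoly set set \<Rightarrow> bool"
  for M G where
  zero: "rees_bihomogeneous M G i j \<zero>\<^bsub>rees M\<^esub>"
| const: "r \<in> forms i \<Longrightarrow> rees_bihomogeneous M G i 0 (rees_class M (mconst r))"
| times_gen: "rees_bihomogeneous M G i j a \<Longrightarrow> x \<in> G b \<Longrightarrow>
     rees_bihomogeneous M G (i + b) (j + 1) (a \<otimes>\<^bsub>rees M\<^esub> rees_class M (mvar x))"
| add: "rees_bihomogeneous M G i j a \<Longrightarrow> rees_bihomogeneous M G i j b \<Longrightarrow>
     rees_bihomogeneous M G i j (a \<oplus>\<^bsub>rees M\<^esub> b)"

definition rees_part ::
    "(('v, 'k::comm_ring_1) mpoly, 'm) module \<Rightarrow> (int \<Rightarrow> 'm set) \<Rightarrow> int \<Rightarrow> int \<Rightarrow>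
     ('m, ('v, 'k) mpoly) mpoly set set set" where
  "rees_part M G i j = {a. rees_bihomogeneous M G i j a}"

text \<open>The component in all bidegrees \<open>(i, *)\<close>, as a set and as a module over a ring \<open>U\<close> mapping to
  \<open>rees M\<close> by \<open>\<rho>\<close>.\<close>

definition rees_row ::
    "(('v, 'k::comm_ring_1) mpoly, 'm) module \<Rightarrow> (int \<Rightarrow> 'm set) \<Rightarrow> int \<Rightarrow>
     ('m, ('v, 'k) mpoly) mpoly set set set" where
  "rees_row M G i = generate (add_monoid (rees M)) (\<Union>j. rees_part M G i j)"

definition rees_row_module ::
    "(('v, 'k::comm_ring_1) mpoly, 'm) module \<Rightarrow> (int \<Rightarrow> 'm set) \<Rightarrow> int \<Rightarrow>
     ('u \<Rightarrow> ('m, ('v, 'k) mpoly) mpoly set set) \<Rightarrow> ('u, ('m, ('v, 'k) mpoly) mpoly set set) module"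
  where
  "rees_row_module M G i \<rho> = \<lparr>carrier = rees_row M G i, monoid.mult = undefined, monoid.one = undefined,
     zero = \<zero>\<^bsub>rees M\<^esub>, add = (\<oplus>\<^bsub>rees M\<^esub>), module.smult = (\<lambda>u a. \<rho> u \<otimes>\<^bsub>rees M\<^esub> a)\<rparr>"

text \<open>The map \<open>k[T_1, ..., T_n] \<rightarrow> rees (coker_module c)\<close> sending the variable \<open>T_l\<close> to the class of
  the \<open>l\<close>th basis vector.\<close>

definition coker_rees_eval ::
    "('v, 'k::comm_ring_1) mpoly ^ 'n \<Rightarrow> ('n, 'k) mpoly \<Rightarrow>
     ((('v, 'k) mpoly ^ 'n) set, ('v, 'k) mpoly) mpoly set set" where
  "coker_rees_eval c u = rees_class (coker_module c)
     (meval (\<lambda>a. mconst (mconst a)) (\<lambda>l. mvar (coker_gen c l)) u)"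

end

theory Submission
  imports Defs "HOL-Analysis.Cartesian_Space"
begin

text \<open>Let \<open>R = k[x_1, x_2]\<close>, let \<open>c\<close> be the first column of \<open>\<phi>\<close> and \<open>d\<close> its degree, and let
  \<open>A = R[w_1, w_2]\<close>. The composite \<open>\<xi> : R\<^sup>3 \<rightarrow> E \<rightarrow> F\<close> sends the \<open>l\<close>th basis vector to
  \<open>T_l = \<xi>_1l w_1 + \<xi>_2l w_2\<close>, so that \<open>rees F\<close> becomes \<open>A\<close> and \<open>rees E\<close> becomes the image of the
  substitution \<open>\<theta> : U[x_1, x_2] \<rightarrow> A\<close>, where \<open>U = k[T_1, T_2, T_3]\<close>. Three facts about \<open>\<xi>\<close> are used: a
  vector orthogonal to both of its rows is a multiple of \<open>c\<close>, the rows are orthogonal to \<open>c\<close>, and their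
  degrees \<open>\<sigma>_1, \<sigma>_2\<close> add up to \<open>d\<close>. The last one holds because the rows generate all syzygies of
  \<open>c\<close> (evaluating an element of the bidual at a syzygy is a linear functional on \<open>F\<close>) and \<open>E\<close> is
  torsion-free (the Hilbert-Burch sequence is exact): together these force the cross product of the rows to
  be a unit times \<open>c\<close>; see \<open>syzygy_basis_degrees\<close>.

  The heart of the proof is the row of degree \<open>d - 1\<close>. The map \<open>v \<mapsto> \<Sum> v_l T_l\<close> is injective on triples of
  forms of degree \<open>d - 1\<close>, since its kernel consists of multiples of \<open>c\<close>, which has degree \<open>d\<close>; source and
  target both have dimension \<open>3d\<close>, so it is onto. Splitting monomials then shows that \<open>\<theta>\<close> is onto in row
  \<open>d - 1\<close> and every degree in \<open>w\<close>, and comparing dimensions once more it is also injective there. Multiplying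
  by powers of \<open>x_1\<close>, it is injective in all rows \<open>i \<le> d - 1\<close>. Hence the row of \<open>rees E\<close> is free on the
  \<open>i + 1\<close> monomials of degree \<open>i\<close>.

  For \<open>rees F\<close> put \<open>e = d - 1 - i\<close>. The quotient of the two rows is the piece of degree \<open>i\<close>
  of the first local cohomology of \<open>U[x_1, x_2]/(g)\<close> with \<open>g = \<Sum> c_l T_l\<close>, hence \<open>U(-1)\<^sup>e\<close>. Concretely, for a monomial \<open>h\<close> of degree
  \<open>e - 1\<close> write \<open>h c_l = x_2\<^sup>e s_l - x_1\<^sup>e t_l\<close>. As \<open>g\<close> vanishes in \<open>A\<close>, the fractions \<open>(\<Sum> s_l T_l) / x_1\<^sup>e\<close> and
  \<open>(\<Sum> t_l T_l) / x_2\<^sup>e\<close> agree and define an element \<open>\<beta>\<close> of \<open>A\<close> (\<open>cech_element\<close>). Given a relation between the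
  monomials of degree \<open>i\<close> and these \<open>\<beta>\<close>, its products with \<open>x_1\<^sup>e\<close> and \<open>x_2\<^sup>e\<close> live in row \<open>d - 1\<close>, where \<open>\<theta>\<close> is
  injective; eliminating between the two leaves \<open>g\<close> times a combination of the monomials \<open>h\<close>, so the
  relation is trivial. A last comparison of dimensions shows that the elements also span (\<open>row_basis\<close>).

  The Rees algebras are defined as symmetric algebras modulo torsion. The link to \<open>A\<close> is
  \<open>rees_class_eq_iff\<close>: after multiplication by a nonzero element of \<open>R\<close>, everything can be rewritten in two
  elements of the module that correspond to multiples of \<open>w_1\<close> and \<open>w_2\<close>, which are algebraically
  independent, so that the kernel of the map from the symmetric algebra to \<open>A\<close> is exactly the torsion.\<close>

section \<open>Polynomials and their gradings\<close>

abbreviation "lookup \<equiv> Poly_Mapping.lookup"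
abbreviation "single \<equiv> Poly_Mapping.single"
abbreviation "keys \<equiv> Poly_Mapping.keys"

lemma sum_single_lookup: "(\<Sum>m\<in>keys p. single m (lookup p m)) = p"
proof (rule poly_mapping_eqI)
  fix k
  have "lookup (\<Sum>m\<in>keys p. single m (lookup p m)) k
      = (\<Sum>m\<in>keys p. if m = k then lookup p k else 0)"
    unfolding lookup_sum by (rule sum.cong) (auto simp: lookup_single when_def)
  also have "\<dots> = lookup p k"
    by (simp add: in_keys_iff)
  finally show "lookup (\<Sum>m\<in>keys p. single m (lookup p m)) k
      = lookup p k" .
qed

lemma poly_mapping_single_add_induct:
  assumes "P 0" "\<And>m c. P (single m c)" "\<And>p q. P p \<Longrightarrow> P q \<Longrightarrow> P (p + q)"
  shows "P (p :: 'a \<Rightarrow>\<^sub>0 'b::comm_monoid_add)"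
proof -
  have "P (\<Sum>m\<in>M. single m (lookup p m))" if "finite M" for M
    using that by (induction) (auto intro: assms)
  then show ?thesis using sum_single_lookup[of p] finite_keys[of p] by metis
qed

lemma mult_as_sum_of_singles:
  fixes p q :: "'a::comm_monoid_add \<Rightarrow>\<^sub>0 'b::comm_semiring_1"
  shows "p * q = (\<Sum>m\<in>keys p. \<Sum>n\<in>keys q.
     single (m + n) (lookup p m * lookup q n))"
proof -
  have "p * q = (\<Sum>m\<in>keys p. single m (lookup p m)) *
      (\<Sum>n\<in>keys q. single n (lookup q n))"
    by (simp only: sum_single_lookup)
  then show ?thesis by (simp add: sum_product mult_single)
qed

lemma mconst_0 [simp]: "mconst 0 = 0"
  and mconst_1 [simp]: "mconst 1 = 1"
  and mconst_add: "mconst (a + b) = mconst a + mconst b"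
  by (simp_all add: mconst_def single_add)

lemma mconst_mult: "mconst (a * b) = (mconst a * mconst b :: ('v, 'r::comm_ring_1) mpoly)"
  by (simp add: mconst_def mult_single)

lemma mconst_diff: "mconst (a - b) = (mconst a - mconst b :: ('v, 'r::comm_ring_1) mpoly)"
  by (simp add: mconst_def single_diff)

lemma mconst_sum: "mconst (sum g B) = (\<Sum>x\<in>B. mconst (g x) :: ('v, 'r::comm_ring_1) mpoly)"
  by (induction B rule: infinite_finite_induct) (auto simp: mconst_add)

lemma mconst_power: "mconst (a ^ n) = (mconst a ^ n :: ('v, 'r::comm_ring_1) mpoly)"
  by (induction n) (auto simp: mconst_mult)

lemma mconst_eq_iff [simp]: "mconst a = mconst b \<longleftrightarrow> a = b"
  by (metis mconst_def lookup_single_eq)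

lemma mconst_eq_0_iff [simp]: "mconst a = 0 \<longleftrightarrow> a = 0"
  by (metis mconst_eq_iff mconst_0)

lemma lookup_mconst_mult [simp]:
  "lookup (mconst c * p) m = c * lookup (p :: ('v, 'r::comm_ring_1) mpoly) m"
proof (induction p rule: poly_mapping_single_add_induct)
  case (2 m' c')
  then show ?case by (simp add: mconst_def mult_single lookup_single when_def)
next
  case (3 p q)
  then show ?case by (simp add: distrib_left lookup_add)
qed simp

subsection \<open>Degrees\<close>

lemma mdegree_superset:
  assumes "finite K" "keys m \<subseteq> K"
  shows "mdegree m = (\<Sum>v\<in>K. lookup m v)"
  unfolding mdegree_def by (rule sum.mono_neutral_left) (use assms in \<open>auto simp: in_keys_iff\<close>)

lemma mdegree_0 [simp]: "mdegree 0 = 0"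
  by (simp add: mdegree_def)

lemma mdegree_single [simp]: "mdegree (single v n) = n"
  by (simp add: mdegree_superset[of "{v}"])

lemma mdegree_add [simp]: "mdegree (m + n) = mdegree m + mdegree n"
proof -
  let ?K = "keys m \<union> keys n"
  have "mdegree (m + n) = (\<Sum>v\<in>?K. lookup (m + n) v)"
    by (rule mdegree_superset) (use keys_add[of m n] in auto)
  then show ?thesis
    by (simp add: mdegree_superset[of ?K m] mdegree_superset[of ?K n] lookup_add sum.distrib)
qed

lemma forms_lookup_iff:
  "p \<in> forms i \<longleftrightarrow> (\<forall>m. lookup p m \<noteq> 0 \<longrightarrow> int (mdegree m) = i)"
  by (auto simp: forms_def in_keys_iff)

lemma zero_forms [simp]: "0 \<in> forms i"
  by (simp add: forms_def)

lemma forms_neg: "i < 0 \<Longrightarrow> p \<in> forms i \<longleftrightarrow> p = 0"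
  by (auto simp: forms_lookup_iff intro!: poly_mapping_eqI)

lemma single_forms: "c = 0 \<or> int (mdegree m) = i \<Longrightarrow> single m c \<in> forms i"
  by (auto simp: forms_lookup_iff lookup_single when_def)

lemma mconst_forms [simp]: "mconst c \<in> forms 0"
  by (auto simp: mconst_def intro: single_forms)

lemma mvar_forms [simp]: "mvar v \<in> forms 1"
  by (auto simp: mvar_def intro: single_forms)

lemma one_forms [simp]: "(1 :: ('v, 'r::comm_ring_1) mpoly) \<in> forms 0"
  using mconst_forms[of "1 :: 'r"] by simp

lemma add_forms: "p \<in> forms i \<Longrightarrow> q \<in> forms i \<Longrightarrow> (p::('v,'r::comm_monoid_add) mpoly) + q \<in> forms i"
  unfolding forms_lookup_iff lookup_add by (metis add_0)

lemma uminus_forms: "p \<in> forms i \<Longrightarrow> - (p::('v,'r::ab_group_add) mpoly) \<in> forms i"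
  by (auto simp: forms_lookup_iff)

lemma diff_forms: "p \<in> forms i \<Longrightarrow> q \<in> forms i \<Longrightarrow> (p::('v,'r::ab_group_add) mpoly) - q \<in> forms i"
  using add_forms[of p i "- q"] uminus_forms[of q i] by simp

lemma sum_forms: "(\<And>x. x \<in> B \<Longrightarrow> f x \<in> forms i) \<Longrightarrow> (\<Sum>x\<in>B. f x :: ('v,'r::comm_monoid_add) mpoly) \<in> forms i"
  by (induction B rule: infinite_finite_induct) (auto intro: add_forms)

lemma mult_forms:
  assumes "p \<in> forms i" "q \<in> forms j"
  shows "(p::('v,'r::comm_ring_1) mpoly) * q \<in> forms (i + j)"
  unfolding mult_as_sum_of_singles[of p q]
  by (intro sum_forms single_forms) (use assms in \<open>auto simp: forms_def\<close>)

lemma mult_forms':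
  "p \<in> forms i \<Longrightarrow> q \<in> forms j \<Longrightarrow> k = i + j \<Longrightarrow> (p::('v,'r::comm_ring_1) mpoly) * q \<in> forms k"
  using mult_forms by blast

lemma mconst_mult_forms: "p \<in> forms i \<Longrightarrow> mconst c * (p::('v,'r::comm_ring_1) mpoly) \<in> forms i"
  using mult_forms[OF mconst_forms[of c], of p i] by simp

lemma power_forms: "p \<in> forms i \<Longrightarrow> (p::('v,'r::comm_ring_1) mpoly) ^ n \<in> forms (int n * i)"
proof (induction n)
  case (Suc n)
  then show ?case by (auto intro!: mult_forms' simp: algebra_simps)
qed simp

lemma mvar_power_forms [simp]: "(mvar v :: ('v,'r::comm_ring_1) mpoly) ^ n \<in> forms (int n)"
  using power_forms[OF mvar_forms, of v n] by simp

definition hom_component :: "int \<Rightarrow> ('v, 'r::zero) mpoly \<Rightarrow> ('v, 'r) mpoly" where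
  "hom_component j = Poly_Mapping.mapp (\<lambda>m c. c when int (mdegree m) = j)"

lemma lookup_hom_component:
  "lookup (hom_component j p) m = (lookup p m when int (mdegree m) = j)"
  by (auto simp: hom_component_def lookup_mapp when_def in_keys_iff)

lemma hom_component_forms [simp]: "hom_component j p \<in> forms j"
  by (auto simp: forms_lookup_iff lookup_hom_component)

lemma hom_component_0 [simp]: "hom_component j 0 = 0"
  by (rule poly_mapping_eqI) (simp add: lookup_hom_component)

lemma hom_component_add: "hom_component j (p + q :: ('v,'r::comm_monoid_add) mpoly) = hom_component j p + hom_component j q"
  by (rule poly_mapping_eqI) (auto simp: lookup_hom_component lookup_add when_def)

lemma hom_component_sum:
  "hom_component j (\<Sum>x\<in>B. f x :: ('v,'r::comm_monoid_add) mpoly) = (\<Sum>x\<in>B. hom_component j (f x))"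
  by (induction B rule: infinite_finite_induct) (auto simp: hom_component_add)

lemma hom_component_of_form:
  "p \<in> forms i \<Longrightarrow> hom_component j p = (if i = j then p else 0)"
  by (rule poly_mapping_eqI) (auto simp: lookup_hom_component when_def forms_lookup_iff)

lemma hom_component_mult_form:
  assumes "p \<in> forms i"
  shows "hom_component j (p * q) = (p::('v,'r::comm_ring_1) mpoly) * hom_component (j - i) q"
proof (induction q rule: poly_mapping_single_add_induct)
  case (2 m c)
  let ?s = "single m c"
  have s: "?s \<in> forms (int (mdegree m))" by (simp add: single_forms)
  show ?case
    using hom_component_of_form[OF s] hom_component_of_form[OF mult_forms[OF assms s]]
    by auto
next
  case (3 p q)
  then show ?case by (simp add: hom_component_add distrib_left)
qed simp

lemma sum_hom_components:
  assumes "\<And>m. lookup p m \<noteq> 0 \<Longrightarrow> mdegree m \<le> J"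
  shows "(\<Sum>j\<le>J. hom_component (int j) p) = (p :: ('v,'r::comm_monoid_add) mpoly)"
proof (rule poly_mapping_eqI)
  fix m
  have "(\<Sum>j\<le>J. lookup (hom_component (int j) p) m)
     = (\<Sum>j\<le>J. if mdegree m = j then lookup p m else 0)"
    by (rule sum.cong) (auto simp: lookup_hom_component when_def)
  then show "lookup (\<Sum>j\<le>J. hom_component (int j) p) m = lookup p m"
    using assms[of m] by (auto simp: lookup_sum)
qed

lemma degree_bound_exists:
  "\<exists>J. \<forall>m. lookup (p::('v,'r::zero) mpoly) m \<noteq> 0 \<longrightarrow> mdegree m \<le> J"
proof -
  have "\<forall>m\<in>keys p. mdegree m \<le> Max (mdegree ` keys p)" by auto
  then show ?thesis by (meson in_keys_iff)
qed

lemma form_eqI: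
  assumes "\<And>j. hom_component j p = hom_component j (q::('v,'r::comm_monoid_add) mpoly)"
  shows "p = q"
proof (rule poly_mapping_eqI)
  fix m show "lookup p m = lookup q m"
    using arg_cong[OF assms[of "int (mdegree m)"], of "\<lambda>p. lookup p m"]
    by (simp add: lookup_hom_component)
qed

subsection \<open>Twisted gradings on the coefficients\<close>

text \<open>The row grading of a polynomial ring over a polynomial ring: a monomial of weight \<open>wt\<close> in the outer
  variables counts \<open>- wt\<close>, so the elements of degree \<open>i\<close> have coefficients of degree \<open>i + wt\<close>. With weight
  \<open>0\<close> this is the degree of the coefficients.\<close>

definition twisted :: "(('w \<Rightarrow>\<^sub>0 nat) \<Rightarrow> int) \<Rightarrow> int \<Rightarrow> ('w, ('v, 'k::zero) mpoly) mpoly set" where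
  "twisted wt i = {p. \<forall>\<mu>. lookup p \<mu> \<in> forms (i + wt \<mu>)}"

lemma zero_twisted [simp]: "0 \<in> twisted wt i"
  by (simp add: twisted_def)

lemma single_twisted: "c \<in> forms (i + wt \<mu>) \<Longrightarrow> single \<mu> c \<in> twisted wt i"
  by (auto simp: twisted_def lookup_single when_def)

lemma add_twisted:
  "p \<in> twisted wt i \<Longrightarrow> q \<in> twisted wt i \<Longrightarrow> (p::('w,('v,'k::comm_monoid_add) mpoly) mpoly) + q \<in> twisted wt i"
  by (auto simp: twisted_def lookup_add intro: add_forms)

lemma sum_twisted:
  "(\<And>x. x \<in> B \<Longrightarrow> f x \<in> twisted wt i) \<Longrightarrow> (\<Sum>x\<in>B. f x::('w,('v,'k::comm_monoid_add) mpoly) mpoly) \<in> twisted wt i"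
  by (induction B rule: infinite_finite_induct) (auto intro: add_twisted)

lemma mult_twisted:
  assumes wt: "\<And>\<mu> \<nu>. wt (\<mu> + \<nu>) = wt \<mu> + wt \<nu>"
    and "p \<in> twisted wt i" "q \<in> twisted wt j"
  shows "(p::('w,('v,'k::comm_ring_1) mpoly) mpoly) * q \<in> twisted wt (i + j)"
  unfolding mult_as_sum_of_singles[of p q]
proof (intro sum_twisted single_twisted)
  fix \<mu> \<nu>
  have "lookup p \<mu> \<in> forms (i + wt \<mu>)" "lookup q \<nu> \<in> forms (j + wt \<nu>)"
    using assms by (auto simp: twisted_def)
  then show "lookup p \<mu> * lookup q \<nu> \<in> forms (i + j + wt (\<mu> + \<nu>))"
    by (rule mult_forms') (simp add: wt)
qed

lemma hom_component_twisted: "p \<in> twisted wt i \<Longrightarrow> hom_component j p \<in> twisted wt i"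
  by (auto simp: twisted_def lookup_hom_component when_def)

subsection \<open>Substitution\<close>

definition monom_eval :: "('v \<Rightarrow> 's::comm_ring_1) \<Rightarrow> ('v \<Rightarrow>\<^sub>0 nat) \<Rightarrow> 's" where
  "monom_eval g m = (\<Prod>v\<in>keys m. g v ^ lookup m v)"

lemma monom_eval_superset:
  assumes "finite K" "keys m \<subseteq> K"
  shows "monom_eval g m = (\<Prod>v\<in>K. g v ^ lookup m v)"
  unfolding monom_eval_def by (rule prod.mono_neutral_left) (use assms in \<open>auto simp: in_keys_iff\<close>)

lemma monom_eval_0 [simp]: "monom_eval g 0 = 1"
  by (simp add: monom_eval_def)

lemma monom_eval_single [simp]: "monom_eval g (single v n) = g v ^ n"
  by (simp add: monom_eval_superset[of "{v}"])

lemma monom_eval_add: "monom_eval g (m + n) = monom_eval g m * monom_eval g n"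
proof -
  let ?K = "keys m \<union> keys n"
  have "monom_eval g (m + n) = (\<Prod>v\<in>?K. g v ^ lookup (m + n) v)"
    by (rule monom_eval_superset) (use keys_add[of m n] in auto)
  then show ?thesis
    by (simp add: monom_eval_superset[of ?K m] monom_eval_superset[of ?K n] lookup_add power_add prod.distrib)
qed

lemma monom_eval_mvar: "monom_eval mvar m = (single m 1 :: ('v, 'r::comm_ring_1) mpoly)"
proof -
  have pow: "(mvar v :: ('v, 'r) mpoly) ^ n = single (single v n) 1" for v n
    by (induction n) (simp_all add: mvar_def mult_single flip: single_add)
  have "(\<Prod>v\<in>K. (mvar v :: ('v, 'r) mpoly) ^ lookup m v)
      = single (\<Sum>v\<in>K. single v (lookup m v)) 1" if "finite K" for K
    using that by induction (auto simp: pow mult_single)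
  from this[of "keys m"] show ?thesis
    by (simp add: monom_eval_def sum_single_lookup)
qed

locale coefficient_hom =
  fixes f :: "'r::comm_ring_1 \<Rightarrow> 's::comm_ring_1"
  assumes hom_add: "f (a + b) = f a + f b"
    and hom_mult: "f (a * b) = f a * f b"
    and hom_one: "f 1 = 1"
begin

lemma hom_zero: "f 0 = 0"
  using hom_add[of 0 0] by simp

lemma meval_superset:
  assumes "finite M" "keys p \<subseteq> M"
  shows "meval f g p = (\<Sum>m\<in>M. f (lookup p m) * monom_eval g m)"
  unfolding meval_def monom_eval_def[symmetric]
  by (rule sum.mono_neutral_left) (use assms in \<open>auto simp: in_keys_iff hom_zero\<close>)

lemma meval_0 [simp]: "meval f g 0 = 0"
  by (simp add: meval_def)

lemma meval_single: "meval f g (single m c) = f c * monom_eval g m"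
  by (simp add: meval_superset[of "{m}"])

lemma meval_mconst: "meval f g (mconst c) = f c"
  by (simp add: mconst_def meval_single)

lemma meval_mvar: "meval f g (mvar v) = g v"
  by (simp add: mvar_def meval_single hom_one)

lemma meval_1: "meval f g 1 = 1"
  using meval_mconst[of g 1] by (simp add: hom_one)

lemma meval_add: "meval f g (p + q) = meval f g p + meval f g q"
proof -
  let ?K = "keys p \<union> keys q"
  have "meval f g (p + q) = (\<Sum>m\<in>?K. f (lookup (p + q) m) * monom_eval g m)"
    by (rule meval_superset) (use keys_add[of p q] in auto)
  then show ?thesis
    by (simp add: meval_superset[of ?K p] meval_superset[of ?K q] lookup_add hom_add distrib_right sum.distrib)
qed

lemma meval_sum: "meval f g (\<Sum>x\<in>B. h x) = (\<Sum>x\<in>B. meval f g (h x))"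
  by (induction B rule: infinite_finite_induct) (auto simp: meval_add)

lemma meval_uminus: "meval f g (- p) = - meval f g p"
  using meval_add[of g p "- p"] by (simp add: eq_neg_iff_add_eq_0 add.commute)

lemma meval_diff: "meval f g (p - q) = meval f g p - meval f g q"
  using meval_add[of g p "- q"] by (simp add: meval_uminus)

lemma meval_mult: "meval f g (p * q) = meval f g p * meval f g q"
proof (induction p rule: poly_mapping_single_add_induct)
  case (2 m c)
  show ?case
    by (induction q rule: poly_mapping_single_add_induct)
      (simp_all add: mult_single meval_single meval_add monom_eval_add hom_mult algebra_simps)
qed (simp_all add: distrib_right meval_add)

lemma coefficient_hom_meval: "coefficient_hom (meval f g)"
  by unfold_locales (simp_all add: meval_add meval_mult meval_1)

end

lemma coefficient_hom_mconst: "coefficient_hom mconst"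
  by unfold_locales (simp_all add: mconst_add mconst_mult)

lemma coefficient_hom_mconst_mconst: "coefficient_hom (\<lambda>a. mconst (mconst a))"
  by unfold_locales (simp_all add: mconst_add mconst_mult)

global_interpretation mconst: coefficient_hom mconst
  by (rule coefficient_hom_mconst)

global_interpretation mconst_mconst: coefficient_hom "\<lambda>a. mconst (mconst a)"
  by (rule coefficient_hom_mconst_mconst)

lemma mconst_mult_single: "mconst c * single m d = (single m (c * d) :: ('v, 'r::comm_ring_1) mpoly)"
  by (simp add: mconst_def mult_single)

lemma meval_comp:
  assumes "coefficient_hom f" "coefficient_hom h"
  shows "h (meval f g p) = meval (\<lambda>a. h (f a)) (\<lambda>v. h (g v)) p"
proof -
  interpret f: coefficient_hom f by fact
  interpret h: coefficient_hom h by fact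
  interpret hf: coefficient_hom "\<lambda>a. h (f a)"
    by unfold_locales (simp_all add: f.hom_add f.hom_mult f.hom_one h.hom_add h.hom_mult h.hom_one)
  have p: "h (a ^ n) = h a ^ n" for a n
    by (induction n) (simp_all add: h.hom_one h.hom_mult)
  have "h (\<Prod>v\<in>K. g v ^ e v) = (\<Prod>v\<in>K. h (g v) ^ e v)" for K e
    by (induction K rule: infinite_finite_induct) (simp_all add: h.hom_one h.hom_mult p)
  then have m: "h (monom_eval g m) = monom_eval (\<lambda>v. h (g v)) m" for m
    by (simp add: monom_eval_def)
  show ?thesis
    by (induction p rule: poly_mapping_single_add_induct)
      (simp_all add: f.meval_single f.meval_add hf.meval_single hf.meval_add h.hom_zero h.hom_add h.hom_mult m)
qed

subsection \<open>Monomials in two and three variables\<close>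

definition monom2 :: "nat \<Rightarrow> nat \<Rightarrow> 2 \<Rightarrow>\<^sub>0 nat" where
  "monom2 a b = single 1 a + single 2 b"

lemma lookup_monom2 [simp]: "lookup (monom2 a b) 1 = a" "lookup (monom2 a b) 2 = b"
  by (simp_all add: monom2_def lookup_add lookup_single)

lemma monom2_eqI: "lookup m 1 = lookup n 1 \<Longrightarrow>
    lookup m 2 = lookup n 2 \<Longrightarrow> m = (n :: 2 \<Rightarrow>\<^sub>0 nat)"
  using forall_2[of "\<lambda>k. lookup m k = lookup n k"] by (blast intro: poly_mapping_eqI)

lemma monom2_lookup: "monom2 (lookup m 1) (lookup m 2) = m"
  by (rule monom2_eqI) simp_all

lemma mdegree2: "mdegree (m :: 2 \<Rightarrow>\<^sub>0 nat) = lookup m 1 + lookup m 2"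
  by (simp add: mdegree_superset[of UNIV] sum_2)

lemma mdegree_monom2 [simp]: "mdegree (monom2 a b) = a + b"
  by (simp add: mdegree2)

lemma monom2_add: "monom2 a b + monom2 c d = monom2 (a + c) (b + d)"
  by (rule monom2_eqI) (simp_all add: lookup_add)

lemma monom_eval2: "monom_eval g (m :: 2 \<Rightarrow>\<^sub>0 nat) = g 1 ^ lookup m 1 * g 2 ^ lookup m 2"
proof -
  have "monom_eval g m = (\<Prod>v\<in>UNIV. g v ^ lookup m v)"
    by (rule monom_eval_superset) auto
  then show ?thesis by (simp add: UNIV_2)
qed

lemma bij_monom2: "bij_betw (\<lambda>a. monom2 a (n - a)) {..n} {m. mdegree m = n}"
  by (rule bij_betw_byWitness[where f' = "\<lambda>m. lookup m 1"])
    (auto simp: mdegree2 intro: monom2_eqI)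

lemma card_monoms2: "card {m :: 2 \<Rightarrow>\<^sub>0 nat. mdegree m = n} = n + 1"
  using bij_betw_same_card[OF bij_monom2[of n]] by simp

lemma finite_monoms2: "finite {m :: 2 \<Rightarrow>\<^sub>0 nat. mdegree m = n}"
  using bij_betw_finite[OF bij_monom2[of n]] by simp

lemma mdegree3: "mdegree (m :: 3 \<Rightarrow>\<^sub>0 nat) =
    lookup m 1 + lookup m 2 + lookup m 3"
  by (simp add: mdegree_superset[of UNIV] sum_3)

definition monom3 :: "nat \<Rightarrow> nat \<Rightarrow> nat \<Rightarrow> 3 \<Rightarrow>\<^sub>0 nat" where
  "monom3 a b c = single 1 a + single 2 b + single 3 c"

lemma lookup_monom3 [simp]: "lookup (monom3 a b c) 1 = a"
    "lookup (monom3 a b c) 2 = b" "lookup (monom3 a b c) 3 = c"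
  by (simp_all add: monom3_def lookup_add lookup_single)

lemma monom3_eqI: "lookup m 1 = lookup n 1 \<Longrightarrow>
    lookup m 2 = lookup n 2 \<Longrightarrow>
    lookup m 3 = lookup n 3 \<Longrightarrow> m = (n :: 3 \<Rightarrow>\<^sub>0 nat)"
  using forall_3[of "\<lambda>k. lookup m k = lookup n k"] by (blast intro: poly_mapping_eqI)

lemma bij_monom3:
  "bij_betw (\<lambda>(a, b). monom3 a b (n - a - b)) (SIGMA a:{..n}. {..n - a}) {m. mdegree m = n}"
proof (rule bij_betw_byWitness[where f' = "\<lambda>m. (lookup m 1, lookup m 2)"])
  show "\<forall>m\<in>{m. mdegree m = n}. (case (lookup m 1, lookup m 2) of
      (a, b) \<Rightarrow> monom3 a b (n - a - b)) = m"
    by (simp add: monom3_eqI mdegree3)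
qed (auto simp: mdegree3 image_subset_iff)

lemma finite_monoms3: "finite {m :: 3 \<Rightarrow>\<^sub>0 nat. mdegree m = n}"
  using bij_betw_finite[OF bij_monom3, of n] by simp

lemma card_monoms3: "2 * card {m :: 3 \<Rightarrow>\<^sub>0 nat. mdegree m = n} = (n + 1) * (n + 2)"
proof -
  have "card {m :: 3 \<Rightarrow>\<^sub>0 nat. mdegree m = n} = (\<Sum>a\<le>n. n - a + 1)"
    using bij_betw_same_card[OF bij_monom3, of n] by simp
  also have "\<dots> = (\<Sum>a\<le>n. a + 1)"
    by (rule sum.reindex_bij_witness[where i = "\<lambda>a. n - a" and j = "\<lambda>a. n - a"]) auto
  also have "2 * \<dots> = (n + 1) * (n + 2)"
    by (induction n) auto
  finally show ?thesis .
qed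

lemma form2_expand:
  assumes "p \<in> forms (int n)"
  shows "(\<Sum>a\<le>n. single (monom2 a (n - a)) (lookup p (monom2 a (n - a)))) = (p :: (2, 'r::comm_monoid_add) mpoly)"
proof -
  have "(\<Sum>a\<le>n. single (monom2 a (n - a)) (lookup p (monom2 a (n - a))))
     = (\<Sum>m | mdegree m = n. single m (lookup p m))"
    by (rule sum.reindex_bij_betw[OF bij_monom2])
  also have "\<dots> = (\<Sum>m\<in>keys p. single m (lookup p m))"
    by (rule sum.mono_neutral_right) (use assms in \<open>auto simp: finite_monoms2 forms_def in_keys_iff\<close>)
  finally show ?thesis by (simp add: sum_single_lookup)
qed

lemma form2_expand_less:
  assumes "p \<in> forms (int n - 1)"
  shows "(\<Sum>a<n. single (monom2 a (n - 1 - a)) (lookup p (monom2 a (n - 1 - a)))) = (p :: (2, 'r::comm_monoid_add) mpoly)"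
proof (cases n)
  case 0
  then show ?thesis using assms by (simp add: forms_neg)
next
  case (Suc n')
  then show ?thesis using form2_expand[of p n'] assms by (simp add: lessThan_Suc_atMost)
qed

text \<open>Take as much of the first variable into the first factor as fits.\<close>

lemma monom2_split:
  assumes "mdegree m = a + b"
  obtains m1 m2 where "m = m1 + (m2 :: 2 \<Rightarrow>\<^sub>0 nat)" "mdegree m1 = a" "mdegree m2 = b"
proof
  define x where "x = min (lookup m 1) a"
  show "m = monom2 x (a - x) + monom2 (lookup m 1 - x) (lookup m 2 - (a - x))"
    by (rule monom2_eqI) (use assms in \<open>auto simp: x_def mdegree2 monom2_add\<close>)
  show "mdegree (monom2 x (a - x)) = a"
    by (simp add: x_def)
  show "mdegree (monom2 (lookup m 1 - x) (lookup m 2 - (a - x))) = b"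
    using assms by (auto simp: x_def mdegree2)
qed

lemma form_induct [consumes 1, case_names zero single add]:
  assumes "p \<in> forms i" "P 0" "\<And>m c. int (mdegree m) = i \<Longrightarrow> P (single m c)"
    "\<And>p q. P p \<Longrightarrow> P q \<Longrightarrow> P (p + q)"
  shows "P (p :: ('v, 'r::comm_monoid_add) mpoly)"
proof -
  have "P (\<Sum>m\<in>M. single m (lookup p m))"
    if "finite M" "M \<subseteq> keys p" for M
    using that
  proof induction
    case (insert m M)
    then have "int (mdegree m) = i" using assms(1) by (auto simp: forms_def)
    then show ?case using insert assms(3,4) by simp
  qed (simp add: assms(2))
  from this[of "keys p"] show ?thesis by (simp add: sum_single_lookup)
qed

lemma twisted_form_induct [consumes 2, case_names zero single add]:
  assumes "p \<in> twisted wt i" "p \<in> forms j" "P 0"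
    "\<And>\<mu> m c. int (mdegree \<mu>) = j \<Longrightarrow> int (mdegree m) = i + wt \<mu> \<Longrightarrow> P (single \<mu> (single m c))"
    "\<And>p q. P p \<Longrightarrow> P q \<Longrightarrow> P (p + q)"
  shows "P (p :: ('w, ('v, 'r::comm_monoid_add) mpoly) mpoly)"
proof -
  have s: "P (single \<mu> c)" if "int (mdegree \<mu>) = j" "c \<in> forms (i + wt \<mu>)" for \<mu> c
    using that(2) by (induction c rule: form_induct) (use that(1) assms(3-5) in \<open>auto simp: single_add\<close>)
  have "P (\<Sum>\<mu>\<in>M. single \<mu> (lookup p \<mu>))"
    if "finite M" "M \<subseteq> keys p" for M
    using that
  proof induction
    case (insert \<mu> M)
    then have "int (mdegree \<mu>) = j" "lookup p \<mu> \<in> forms (i + wt \<mu>)"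
      using assms(1,2) by (auto simp: forms_def twisted_def)
    then show ?case using insert s assms(5) by simp
  qed (simp add: assms(3))
  from this[of "keys p"] show ?thesis by (simp add: sum_single_lookup)
qed

lemma lookup_single_mult_add:
  fixes n :: "'a::cancel_comm_monoid_add" and p :: "'a \<Rightarrow>\<^sub>0 'r::comm_ring_1"
  shows "lookup (single n c * p) (n + m) = c * lookup p m"
  by (induction p rule: poly_mapping_single_add_induct)
    (auto simp: mult_single lookup_single when_def lookup_add distrib_left)

lemma lookup_single_mult_eq_0:
  fixes p :: "'a::comm_monoid_add \<Rightarrow>\<^sub>0 'r::comm_ring_1"
  assumes "\<And>m. k \<noteq> n + m"
  shows "lookup (single n c * p) k = 0"
  using assms by (induction p rule: poly_mapping_single_add_induct)
    (auto simp: mult_single lookup_single when_def lookup_add distrib_left)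

lemma mvar_power: "(mvar v :: ('v, 'r::comm_ring_1) mpoly) ^ n = single (single v n) 1"
  using monom_eval_mvar[of "single v n"] by (metis monom_eval_single)

lemma mvar_power_neq_0: "(mvar v :: ('v, 'r::comm_ring_1) mpoly) ^ n \<noteq> 0"
  unfolding mvar_power by (metis lookup_single_eq lookup_zero zero_neq_one)

lemma mvar_power_mult_single:
  "(mvar v :: ('v, 'r::comm_ring_1) mpoly) ^ n * single m c = single (single v n + m) c"
  by (simp add: mvar_power mult_single)

text \<open>The two variables are coprime.\<close>

lemma mvar_power_dvd:
  fixes p q :: "(2, 'r::comm_ring_1) mpoly"
  assumes "mvar 2 ^ e * p = mvar 1 ^ e * q"
  obtains b where "p = mvar 1 ^ e * b"
proof -
  have ex: "\<exists>b. single m (lookup p m) = mvar 1 ^ e * b" for m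
  proof (cases "e \<le> lookup m 1")
    case True
    have m: "m = single 1 e + monom2 (lookup m 1 - e) (lookup m 2)"
      by (rule monom2_eqI) (use True in \<open>simp_all add: lookup_add lookup_single\<close>)
    show ?thesis
      by (intro exI, subst mvar_power_mult_single, subst m[symmetric], rule refl)
  next
    case False
    let ?k = "single 2 e + m"
    have "lookup p m = lookup (mvar 1 ^ e * q) ?k"
      using lookup_single_mult_add[of "single 2 e" 1 p m] assms by (simp add: mvar_power)
    also have "\<dots> = 0"
      unfolding mvar_power
    proof (rule lookup_single_mult_eq_0)
      fix m' show "?k \<noteq> single 1 e + m'"
      proof
        assume "?k = single 1 e + m'"
        then have "lookup ?k 1 = e + lookup m' 1"
          by (simp add: lookup_add)
        then show False using False by (simp add: lookup_add lookup_single)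
      qed
    qed
    finally show ?thesis by (metis mult_zero_right single_zero)
  qed
  then obtain b where b: "\<And>m. single m (lookup p m) = mvar 1 ^ e * b m"
    by metis
  have "p = mvar 1 ^ e * (\<Sum>m\<in>keys p. b m)"
    by (subst sum_single_lookup[symmetric]) (simp add: b sum_distrib_left)
  then show thesis by (rule that)
qed

text \<open>A monomial of degree at least \<open>2 * e - 1\<close> is divisible by the \<open>e\<close>th power of one of the two variables.
  The sign makes the two parts the components of a Cech cochain.\<close>

lemma form_power_split:
  fixes f :: "(2, 'r::comm_ring_1) mpoly"
  assumes "f \<in> forms (int N + int e)" "e \<le> N + 1"
  shows "\<exists>s t. s \<in> forms (int N) \<and> t \<in> forms (int N) \<and> f = mvar 2 ^ e * s - mvar 1 ^ e * t"
  using assms(1)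
proof (induction f rule: form_induct)
  case zero
  show ?case by (rule exI[of _ 0], rule exI[of _ 0]) simp
next
  case (single m c)
  let ?a = "lookup m 1" and ?b = "lookup m 2"
  have deg: "?a + ?b = N + e"
    using single by (simp add: mdegree2 flip: of_nat_add)
  show ?case
  proof (cases "e \<le> ?b")
    case True
    have m: "m = single 2 e + monom2 ?a (?b - e)"
      by (rule monom2_eqI) (use True in \<open>simp_all add: lookup_add lookup_single\<close>)
    have "single m c = mvar 2 ^ e * single (monom2 ?a (?b - e)) c"
      by (subst mvar_power_mult_single, subst m[symmetric], rule refl)
    moreover have "single (monom2 ?a (?b - e)) c \<in> forms (int N)"
      by (rule single_forms) (use deg True in auto)
    ultimately show ?thesis
      by (intro exI[of _ "single (monom2 ?a (?b - e)) c"] exI[of _ 0]) simp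
  next
    case False
    then have le: "e \<le> ?a" using deg assms(2) by linarith
    have m: "m = single 1 e + monom2 (?a - e) ?b"
      by (rule monom2_eqI) (use le in \<open>simp_all add: lookup_add lookup_single\<close>)
    have "single m c = mvar 1 ^ e * single (monom2 (?a - e) ?b) c"
      by (subst mvar_power_mult_single, subst m[symmetric], rule refl)
    moreover have "- single (monom2 (?a - e) ?b) c \<in> forms (int N)"
      by (rule uminus_forms, rule single_forms) (use deg le in auto)
    ultimately show ?thesis
      by (intro exI[of _ 0] exI[of _ "- single (monom2 (?a - e) ?b) c"]) simp
  qed
next
  case (add p q)
  then obtain s t s' t' where "s \<in> forms (int N)" "t \<in> forms (int N)" "p = mvar 2 ^ e * s - mvar 1 ^ e * t"
    "s' \<in> forms (int N)" "t' \<in> forms (int N)" "q = mvar 2 ^ e * s' - mvar 1 ^ e * t'" by metis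
  then show ?case
    by (intro exI[of _ "s + s'"] exI[of _ "t + t'"]) (auto simp: ring_distribs intro: add_forms)
qed

subsection \<open>Square linear systems\<close>

text \<open>The exchange lemma compares the family with the basis in both directions.\<close>

lemma square_family_independent_iff_spanning:
  fixes scale :: "'a::field \<Rightarrow> 'b::ab_group_add \<Rightarrow> 'b"
  assumes V: "vector_space scale"
    and J: "finite J" and B: "finite B" "\<not> module.dependent scale B" "card B = card J"
    and b: "\<And>x. x \<in> J \<Longrightarrow> b x \<in> module.span scale B"
  shows "(\<forall>c. (\<Sum>x\<in>J. scale (c x) (b x)) = 0 \<longrightarrow> (\<forall>x\<in>J. c x = 0)) \<longleftrightarrow>
     (\<forall>w\<in>module.span scale B. \<exists>c. w = (\<Sum>x\<in>J. scale (c x) (b x)))" (is "?I \<longleftrightarrow> ?S")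
proof -
  interpret V: vector_space scale by fact
  show ?thesis
  proof
    assume I: ?I
    have inj: "inj_on b J"
    proof (rule inj_onI, rule ccontr)
      fix x y assume xy: "x \<in> J" "y \<in> J" "b x = b y" "x \<noteq> y"
      let ?c = "\<lambda>z. if z = x then 1 else if z = y then - 1 else (0::'a)"
      have "(\<Sum>z\<in>J. scale (?c z) (b z)) = (\<Sum>z\<in>{x, y}. scale (?c z) (b z))"
        by (rule sum.mono_neutral_right) (use xy J in auto)
      also have "\<dots> = 0" using xy by simp
      finally show False using I[rule_format, of ?c x] xy(1) by simp
    qed
    have "V.independent (b ` J)"
    proof (rule V.independent_if_scalars_zero)
      fix f y assume "(\<Sum>y\<in>b ` J. scale (f y) y) = 0" "y \<in> b ` J"
      then show "f y = 0" using I[rule_format, of "f \<circ> b"] inj by (auto simp: sum.reindex)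
    qed (use J in simp)
    show ?S
    proof
      fix w assume w: "w \<in> V.span B"
      have "w \<in> V.span (b ` J)"
      proof (rule ccontr)
        assume nw: "w \<notin> V.span (b ` J)"
        then have "V.independent (insert w (b ` J))"
          using \<open>V.independent (b ` J)\<close> by (rule V.independent_insertI)
        moreover have "insert w (b ` J) \<subseteq> V.span B" using w b by auto
        ultimately have "card (insert w (b ` J)) \<le> card B"
          using V.independent_span_bound[OF B(1)] by blast
        moreover have "w \<notin> b ` J" using nw V.span_base by blast
        ultimately show False using J B(3) inj by (simp add: card_image)
      qed
      then obtain u where "w = (\<Sum>v\<in>b ` J. scale (u v) v)"
        using J by (auto simp: V.span_finite)
      then show "\<exists>c. w = (\<Sum>x\<in>J. scale (c x) (b x))"
        using inj by (intro exI[of _ "u \<circ> b"]) (simp add: sum.reindex)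
    qed
  next
    assume S: ?S
    have sp: "B \<subseteq> V.span (b ` J)"
    proof
      fix w assume "w \<in> B"
      then obtain c where "w = (\<Sum>x\<in>J. scale (c x) (b x))" using S V.span_base by blast
      then show "w \<in> V.span (b ` J)" by (simp add: V.span_sum V.span_scale V.span_base)
    qed
    have "card B \<le> card (b ` J)"
      using V.independent_span_bound[OF _ B(2) sp] J by simp
    then have card: "card (b ` J) = card J"
      using card_image_le[OF J, of b] B(3) by simp
    then have inj: "inj_on b J" by (rule eq_card_imp_inj_on[OF J])
    have ind: "V.independent (b ` J)"
    proof
      assume "V.dependent (b ` J)"
      then obtain y where y: "y \<in> b ` J" "y \<in> V.span (b ` J - {y})"
        by (auto simp: V.dependent_def)
      then have "V.span (b ` J) = V.span (b ` J - {y})"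
        by (metis insert_Diff V.span_redundant)
      then have "B \<subseteq> V.span (b ` J - {y})" using sp by simp
      then have "card B \<le> card (b ` J - {y})"
        using V.independent_span_bound[OF _ B(2)] J by simp
      moreover have "card (b ` J - {y}) < card (b ` J)"
        using y J by (intro psubset_card_mono) auto
      ultimately show False using card B(3) by simp
    qed
    show ?I
    proof (intro allI impI ballI)
      fix c x assume c: "(\<Sum>x\<in>J. scale (c x) (b x)) = 0" and x: "x \<in> J"
      have "(\<Sum>v\<in>b ` J. scale (c (inv_into J b v)) v) = 0"
        using c inj by (simp add: sum.reindex inv_into_f_f)
      then have "c (inv_into J b (b x)) = 0"
        using V.independentD[OF ind, of "b ` J" "\<lambda>v. c (inv_into J b v)" "b x"] J x by auto
      then show "c x = 0" using inj x by simp
    qed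
  qed
qed

abbreviation kscale :: "'k::field \<Rightarrow> ('w, ('v, 'k) mpoly) mpoly \<Rightarrow> ('w, ('v, 'k) mpoly) mpoly" where
  "kscale c p \<equiv> mconst (mconst c) * p"

global_interpretation kspace: vector_space kscale
  by unfold_locales (simp_all add: mconst_add mconst_mult algebra_simps)

text \<open>The polynomials supported on a finite set \<open>Y\<close> of pairs of monomials form a space of dimension
  \<open>card Y\<close>; this form of the dimension principle mentions only coefficients.\<close>

lemma square_family_of_polynomials:
  fixes b :: "'x \<Rightarrow> ('w, ('v, 'k::field) mpoly) mpoly"
  assumes J: "finite J" and Y: "finite Y" "card Y = card J"
    and V: "V = {p. \<forall>\<mu> m. lookup (lookup p \<mu>) m \<noteq> 0 \<longrightarrow> (\<mu>, m) \<in> Y}"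
    and b: "\<And>x. x \<in> J \<Longrightarrow> b x \<in> V"
  shows "(\<forall>c. (\<Sum>x\<in>J. kscale (c x) (b x)) = 0 \<longrightarrow> (\<forall>x\<in>J. c x = 0)) \<longleftrightarrow>
     (\<forall>w\<in>V. \<exists>c. w = (\<Sum>x\<in>J. kscale (c x) (b x)))"
proof -
  define e :: "_ \<Rightarrow> ('w, ('v, 'k::field) mpoly) mpoly"
    where "e y = (case y of (\<mu>, m) \<Rightarrow> single \<mu> (single m 1))" for y
  have e: "lookup (lookup (e y) \<mu>) m = (if y = (\<mu>, m) then 1 else 0)" for y \<mu> m
    by (cases y) (auto simp: e_def lookup_single when_def)
  have le: "lookup (lookup (\<Sum>y\<in>Y. kscale (u y) (e y)) \<mu>) m
      = (if (\<mu>, m) \<in> Y then u (\<mu>, m) else 0)" for u \<mu> m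
    using Y(1) by (simp add: lookup_sum e if_distrib cong: if_cong)
  have inj: "inj_on e Y"
    by (rule inj_onI) (metis e surj_pair zero_neq_one)
  have span: "kspace.span (e ` Y) = V"
  proof (intro equalityI subsetI)
    fix w assume "w \<in> kspace.span (e ` Y)"
    then obtain u where "w = (\<Sum>v\<in>e ` Y. kscale (u v) v)"
      using Y by (auto simp: kspace.span_finite)
    then have "w = (\<Sum>y\<in>Y. kscale (u (e y)) (e y))"
      by (simp add: sum.reindex[OF inj])
    then show "w \<in> V" by (auto simp: V le)
  next
    fix w assume w: "w \<in> V"
    have w': "w = (\<Sum>y\<in>Y. kscale (case y of (\<mu>, m) \<Rightarrow> lookup (lookup w \<mu>) m) (e y))"
      by (intro poly_mapping_eqI, subst le) (use w in \<open>auto simp: V\<close>)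
    then show "w \<in> kspace.span (e ` Y)"
      by (subst w') (intro kspace.span_sum kspace.span_scale kspace.span_base imageI)
  qed
  have "kspace.independent (e ` Y)"
  proof (rule kspace.independent_if_scalars_zero)
    fix f v assume f: "(\<Sum>v\<in>e ` Y. kscale (f v) v) = 0" and v: "v \<in> e ` Y"
    from v obtain \<mu> m where m: "(\<mu>, m) \<in> Y" "v = e (\<mu>, m)" by auto
    have "(\<Sum>y\<in>Y. kscale (f (e y)) (e y)) = 0" using f by (simp add: sum.reindex[OF inj])
    from arg_cong[OF this, of "\<lambda>p. lookup (lookup p \<mu>) m"]
    show "f v = 0" using m by (simp add: le)
  qed (use Y in simp)
  from square_family_independent_iff_spanning[OF kspace.vector_space_axioms J _ this, of b]
  show ?thesis using Y b by (simp add: span card_image[OF inj])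
qed

section \<open>The two blow-up algebras in coordinates\<close>

lemma mvar_combination_eq_0:
  assumes "(\<Sum>i\<in>UNIV. mconst (c i) * mvar i) = (0 :: ('v::finite, 'r::comm_ring_1) mpoly)"
  shows "c i = 0"
proof -
  have single_eq_iff: "single j 1 = (single i 1 :: 'v \<Rightarrow>\<^sub>0 nat) \<longleftrightarrow> j = i" for j
    by (metis lookup_single_eq lookup_single_not_eq zero_neq_one)
  have "lookup (\<Sum>j\<in>UNIV. mconst (c j) * mvar j :: ('v, 'r) mpoly) (single i 1)
      = (\<Sum>j\<in>UNIV. if j = i then c i else 0)"
    unfolding lookup_sum mvar_def lookup_mconst_mult
    by (rule sum.cong) (simp_all only: lookup_single when_def single_eq_iff, simp)
  then show ?thesis using assms by simp
qed

lemma hom_component_neg: "j < 0 \<Longrightarrow> hom_component j p = 0"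
  using hom_component_forms[of j p] forms_neg[of j "hom_component j p"] by blast

lemma mvar_neq_0: "(mvar v :: ('v, 'r::comm_ring_1) mpoly) \<noteq> 0"
  using mvar_power_neq_0[of v 1] by simp

text \<open>The situation after all modules have been replaced by coordinates: \<open>a\<close> is the column, and the rows
  \<open>\<xi> i\<close> describe the map from the cokernel of \<open>a\<close> to its bidual.\<close>

locale syzygy_basis =
  fixes a :: "3 \<Rightarrow> (2, 'k::field) mpoly" and \<xi> :: "2 \<Rightarrow> 3 \<Rightarrow> (2, 'k) mpoly" and d :: nat and \<sigma> :: "2 \<Rightarrow> nat"
  assumes d_pos: "0 < d"
    and a_forms: "a l \<in> forms (int d)"
    and a_nonzero: "\<exists>l. a l \<noteq> 0"
    and \<xi>_forms: "\<xi> i l \<in> forms (int (\<sigma> i))"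
    and sum_\<sigma>: "\<sigma> 1 + \<sigma> 2 = d"
    and orthogonal: "(\<Sum>l\<in>UNIV. a l * \<xi> i l) = 0"
    and kernel: "(\<And>i. (\<Sum>l\<in>UNIV. v l * \<xi> i l) = 0) \<Longrightarrow> \<exists>r. \<forall>l. v l = r * a l"
begin

text \<open>The variable \<open>w_i\<close> has degree \<open>- \<sigma> i\<close> in the row grading of \<open>rees F\<close>.\<close>

definition weight :: "(2 \<Rightarrow>\<^sub>0 nat) \<Rightarrow> int" where
  "weight \<mu> = int (lookup \<mu> 1 * \<sigma> 1 + lookup \<mu> 2 * \<sigma> 2)"

lemma weight_add: "weight (\<mu> + \<nu>) = weight \<mu> + weight \<nu>"
  by (simp add: weight_def lookup_add algebra_simps)

lemma weight_0 [simp]: "weight 0 = 0"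
  by (simp add: weight_def)

lemma weight_single [simp]: "weight (single i n) = int (n * \<sigma> i)"
  using exhaust_2[of i] by (auto simp: weight_def lookup_single)

lemma weight_nonneg: "0 \<le> weight \<mu>"
  by (simp add: weight_def)

lemmas mult_row = mult_twisted[where wt = weight, OF weight_add]

lemma mult_row': "p \<in> twisted weight i \<Longrightarrow> q \<in> twisted weight j \<Longrightarrow> k = i + j \<Longrightarrow>
    (p :: (2, (2, 'k) mpoly) mpoly) * q \<in> twisted weight k"
  using mult_row by blast

lemma one_row: "(1 :: (2, (2, 'k) mpoly) mpoly) \<in> twisted weight 0"
  unfolding single_one[symmetric] by (rule single_twisted) simp

lemma power_row: "(p :: (2, (2, 'k) mpoly) mpoly) \<in> twisted weight 0 \<Longrightarrow> p ^ n \<in> twisted weight 0"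
  by (induction n) (auto intro: one_row mult_row')

lemma prod_row: "(\<And>x. x \<in> B \<Longrightarrow> (f x :: (2, (2, 'k) mpoly) mpoly) \<in> twisted weight 0) \<Longrightarrow> (\<Prod>x\<in>B. f x) \<in> twisted weight 0"
  by (induction B rule: infinite_finite_induct) (auto intro!: one_row mult_row'[where i = 0 and j = 0])

lemma mconst_row: "r \<in> forms i \<Longrightarrow> mconst r \<in> twisted weight i"
  unfolding mconst_def by (rule single_twisted) simp

lemma mvar_row: "(mvar i :: (2, (2, 'k) mpoly) mpoly) \<in> twisted weight (- int (\<sigma> i))"
  unfolding mvar_def by (rule single_twisted) simp

definition T :: "3 \<Rightarrow> (2, (2, 'k) mpoly) mpoly" where
  "T l = (\<Sum>i\<in>UNIV. mconst (\<xi> i l) * mvar i)"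

lemma T_row: "T l \<in> twisted weight 0"
  unfolding T_def by (intro sum_twisted) (rule mult_row'[OF mconst_row[OF \<xi>_forms] mvar_row], simp)

lemma T_forms: "T l \<in> forms 1"
  unfolding T_def by (intro sum_forms mconst_mult_forms mvar_forms)

lemma sum_T_eq: "(\<Sum>l\<in>UNIV. mconst (v l) * T l) = (\<Sum>i\<in>UNIV. mconst (\<Sum>l\<in>UNIV. v l * \<xi> i l) * mvar i)"
  unfolding T_def sum_distrib_left mconst_sum sum_distrib_right mconst_mult mult.assoc
  by (rule sum.swap)

text \<open>The kernel of \<open>R\<^sup>3 \<rightarrow> F\<close> in terms of the elements \<open>T l\<close>.\<close>

lemma linear_relation:
  assumes "(\<Sum>l\<in>UNIV. mconst (v l) * T l) = 0"
  obtains r where "\<And>l. v l = r * a l"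
  using kernel[of v] mvar_combination_eq_0[of "\<lambda>i. \<Sum>l\<in>UNIV. v l * \<xi> i l"] assms
  unfolding sum_T_eq by metis

subsection \<open>Substituting for the variables of the presentation\<close>

definition \<rho> :: "(3, 'k) mpoly \<Rightarrow> (2, (2, 'k) mpoly) mpoly" where
  "\<rho> = meval (\<lambda>c. mconst (mconst c)) T"

sublocale \<rho>: coefficient_hom \<rho>
  unfolding \<rho>_def by (rule mconst_mconst.coefficient_hom_meval)

text \<open>The source is \<open>R[T_1, T_2, T_3]\<close> written as a polynomial ring in \<open>x_1, x_2\<close> over
  \<open>k[T_1, T_2, T_3]\<close>, so that \<open>forms i\<close> is its row \<open>i\<close> and \<open>twisted (\<lambda>_. 0) j\<close> its part of degree \<open>j\<close> in
  the \<open>T_l\<close>.\<close>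

definition \<theta> :: "(2, (3, 'k) mpoly) mpoly \<Rightarrow> (2, (2, 'k) mpoly) mpoly" where
  "\<theta> = meval \<rho> (\<lambda>v. mconst (mvar v))"

sublocale \<theta>: coefficient_hom \<theta>
  unfolding \<theta>_def by (rule \<rho>.coefficient_hom_meval)

lemma \<rho>_mconst: "\<rho> (mconst c) = mconst (mconst c)"
  by (simp add: \<rho>_def mconst_mconst.meval_mconst)

lemma \<rho>_mvar: "\<rho> (mvar l) = T l"
  by (simp add: \<rho>_def mconst_mconst.meval_mvar)

lemma monom_eval_T_row: "monom_eval T n \<in> twisted weight 0"
  unfolding monom_eval_def by (intro prod_row power_row T_row)

lemma monom_eval_T_forms: "monom_eval T n \<in> forms (int (mdegree n))"
proof -
  have "(\<Prod>v\<in>K. T v ^ e v) \<in> forms (int (\<Sum>v\<in>K. e v))" for K e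
    by (induction K rule: infinite_finite_induct)
      (use power_forms[OF T_forms] in \<open>auto intro!: mult_forms'\<close>)
  then show ?thesis by (simp add: monom_eval_def mdegree_def)
qed

lemma kscale_row: "p \<in> twisted weight i \<Longrightarrow> kscale (c::'k) (p :: (2, (2, 'k) mpoly) mpoly) \<in> twisted weight i"
  by (rule mult_row'[OF mconst_row[OF mconst_forms]]) auto

lemma \<rho>_row: "\<rho> u \<in> twisted weight 0"
proof (induction u rule: poly_mapping_single_add_induct)
  case (2 m c)
  show ?case using kscale_row[OF monom_eval_T_row] by (simp add: \<rho>_def mconst_mconst.meval_single)
qed (auto simp: \<rho>.hom_zero \<rho>.hom_add intro: add_twisted)

lemma \<rho>_forms: "u \<in> forms j \<Longrightarrow> \<rho> u \<in> forms j"
proof (induction u rule: form_induct)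
  case (single m c)
  then show ?case
    using mconst_mult_forms[OF monom_eval_T_forms[of m]] by (simp add: \<rho>_def mconst_mconst.meval_single)
qed (auto simp: \<rho>.hom_zero \<rho>.hom_add intro: add_forms)

lemma hom_component_\<rho>: "hom_component j (\<rho> u) = \<rho> (hom_component j u)"
proof (induction u rule: poly_mapping_single_add_induct)
  case (2 m c)
  have s: "single m c \<in> forms (int (mdegree m))" by (rule single_forms) simp
  show ?case
    using hom_component_of_form[OF s] hom_component_of_form[OF \<rho>_forms[OF s]] by (auto simp: \<rho>.hom_zero)
qed (simp_all add: \<rho>.hom_zero \<rho>.hom_add hom_component_add)

lemma \<theta>_mconst: "\<theta> (mconst u) = \<rho> u"
  by (simp add: \<theta>_def \<rho>.meval_mconst)

lemma \<theta>_single: "\<theta> (single m u) = mconst (single m 1) * \<rho> u"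
proof -
  have "monom_eval (\<lambda>v. mconst (mvar v)) m = (mconst (single m 1) :: (2, (2, 'k) mpoly) mpoly)"
    by (simp add: monom_eval2 mvar_power mult_single monom2_lookup[unfolded monom2_def] flip: mconst_mult mconst_power)
  then show ?thesis by (simp add: \<theta>_def \<rho>.meval_single mult.commute)
qed

lemma \<theta>_diff: "\<theta> (p - q) = \<theta> p - \<theta> q"
  by (simp add: \<theta>_def \<rho>.meval_diff)

lemma \<theta>_sum: "\<theta> (\<Sum>x\<in>B. f x) = (\<Sum>x\<in>B. \<theta> (f x))"
  by (simp add: \<theta>_def \<rho>.meval_sum)

lemma \<theta>_row: "s \<in> forms i \<Longrightarrow> \<theta> s \<in> twisted weight i"
proof (induction s rule: form_induct)
  case (single m c)
  show ?case unfolding \<theta>_single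
    by (rule mult_row'[OF mconst_row \<rho>_row]) (use single in \<open>auto intro: single_forms\<close>)
qed (auto simp: \<theta>.hom_zero \<theta>.hom_add intro: add_twisted)

lemma \<theta>_forms: "s \<in> twisted (\<lambda>_. 0) j \<Longrightarrow> \<theta> s \<in> forms j"
proof -
  assume s: "s \<in> twisted (\<lambda>_. 0) j"
  have "\<theta> (\<Sum>m\<in>keys s. single m (lookup s m)) \<in> forms j"
    unfolding \<theta>_sum \<theta>_single
    by (intro sum_forms mult_forms'[OF mconst_forms \<rho>_forms]) (use s in \<open>auto simp: twisted_def\<close>)
  then show ?thesis by (simp add: sum_single_lookup)
qed

text \<open>The inclusion of \<open>k[x_1, x_2]\<close> into \<open>k[T_1, T_2, T_3][x_1, x_2]\<close>.\<close>

definition lift :: "(2, 'k) mpoly \<Rightarrow> (2, (3, 'k) mpoly) mpoly" where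
  "lift = meval (\<lambda>c. mconst (mconst c)) mvar"

sublocale lift: coefficient_hom lift
  unfolding lift_def by (rule mconst_mconst.coefficient_hom_meval)

lemma lift_single: "lift (single m c) = single m (mconst c)"
  by (simp add: lift_def mconst_mconst.meval_single monom_eval_mvar mconst_mult_single)

lemma lift_diff: "lift (p - q) = lift p - lift q"
  by (simp add: lift_def mconst_mconst.meval_diff)

lemma lift_lookup: "lookup (lift p) m = mconst (lookup p m)"
  by (induction p rule: poly_mapping_single_add_induct)
    (auto simp: lift_single lift.hom_zero lift.hom_add lookup_add mconst_add lookup_single when_def)

lemma lift_forms: "p \<in> forms i \<Longrightarrow> lift p \<in> forms i"
  by (auto simp: forms_lookup_iff lift_lookup)

lemma lift_twisted: "lift p \<in> twisted (\<lambda>_. 0) 0"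
  by (auto simp: twisted_def lift_lookup)

lemma \<theta>_lift: "\<theta> (lift p) = mconst p"
proof (induction p rule: poly_mapping_single_add_induct)
  case (2 m c)
  have "mconst (single m 1) * mconst (mconst c) = (mconst (single m c) :: (2, (2, 'k) mpoly) mpoly)"
    by (simp add: mult.commute mconst_mult_single flip: mconst_mult)
  then show ?case by (simp add: lift_single \<theta>_single \<rho>_mconst)
qed (simp_all add: lift.hom_zero \<theta>.hom_zero lift.hom_add \<theta>.hom_add mconst_add)

subsection \<open>Dimensions\<close>

definition monoms3 :: "int \<Rightarrow> (3 \<Rightarrow>\<^sub>0 nat) set" where
  "monoms3 j = {n. int (mdegree n) = j}"

lemma finite_monoms3_of: "finite (monoms3 j)"
proof -
  have "monoms3 j \<subseteq> {n. mdegree n = nat j}" by (auto simp: monoms3_def)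
  then show ?thesis using finite_monoms3 finite_subset by blast
qed

lemma card_monoms3_of: "- 2 \<le> j \<Longrightarrow> 2 * int (card (monoms3 j)) = (j + 1) * (j + 2)"
proof -
  assume j: "- 2 \<le> j"
  show ?thesis
  proof (cases "0 \<le> j")
    case True
    then have "monoms3 j = {n. mdegree n = nat j}" by (auto simp: monoms3_def)
    then have "2 * card (monoms3 j) = (nat j + 1) * (nat j + 2)" using card_monoms3 by simp
    then have "int (2 * card (monoms3 j)) = int ((nat j + 1) * (nat j + 2))" by simp
    then show ?thesis using True by (simp add: algebra_simps)
  next
    case False
    then have "monoms3 j = {}" by (auto simp: monoms3_def)
    moreover have "j = - 1 \<or> j = - 2" using j False by auto
    ultimately show ?thesis by auto
  qed
qed

definition bidegree_monoms :: "int \<Rightarrow> nat \<Rightarrow> ((2 \<Rightarrow>\<^sub>0 nat) \<times> (2 \<Rightarrow>\<^sub>0 nat)) set" where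
  "bidegree_monoms i j = {(\<mu>, m). mdegree \<mu> = j \<and> int (mdegree m) = i + weight \<mu>}"

lemma bidegree_monoms_iff:
  "p \<in> twisted weight i \<and> p \<in> forms (int j) \<longleftrightarrow>
    (\<forall>\<mu> m. lookup (lookup p \<mu>) m \<noteq> 0 \<longrightarrow> (\<mu>, m) \<in> bidegree_monoms i j)"
proof -
  have "lookup p \<mu> \<noteq> 0 \<longleftrightarrow> (\<exists>m. lookup (lookup p \<mu>) m \<noteq> 0)" for \<mu>
    by (metis lookup_zero poly_mapping_eqI)
  then show ?thesis
    unfolding twisted_def forms_lookup_iff bidegree_monoms_def by auto
qed

text \<open>In row \<open>i \<ge> - 1\<close> every coefficient degree is at least \<open>- 1\<close>, so a coefficient of degree \<open>n\<close> always
  contributes exactly \<open>n + 1\<close> monomials, also for \<open>n = - 1\<close>.\<close>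

lemma finite_card_bidegree_monoms:
  assumes "- 1 \<le> i"
  shows "finite (bidegree_monoms i j)"
    and "2 * int (card (bidegree_monoms i j)) = (int j + 1) * (2 * (i + 1) + int d * int j)"
proof -
  let ?w = "\<lambda>x. i + int (x * \<sigma> 1 + (j - x) * \<sigma> 2)"
  let ?M = "\<lambda>x. {m :: 2 \<Rightarrow>\<^sub>0 nat. int (mdegree m) = ?w x}"
  have M: "finite (?M x) \<and> int (card (?M x)) = ?w x + 1" for x
  proof (cases "0 \<le> ?w x")
    case True
    then have "?M x = {m. mdegree m = nat (?w x)}" by auto
    then show ?thesis using True finite_monoms2 card_monoms2 by simp
  next
    case False
    have "0 \<le> int (x * \<sigma> 1 + (j - x) * \<sigma> 2)" by (rule of_nat_0_le_iff)
    then have "?w x = - 1" using False assms by linarith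
    moreover have "?M x = {}" using False by auto
    ultimately show ?thesis by simp
  qed
  have eq: "bidegree_monoms i j = (\<lambda>(x, m). (monom2 x (j - x), m)) ` (SIGMA x:{..j}. ?M x)"
  proof (intro equalityI subsetI)
    fix z assume "z \<in> bidegree_monoms i j"
    then obtain \<mu> m where z: "z = (\<mu>, m)" "mdegree \<mu> = j" "int (mdegree m) = i + weight \<mu>"
      by (auto simp: bidegree_monoms_def)
    let ?x = "lookup \<mu> 1"
    have "\<mu> = monom2 ?x (j - ?x)"
      by (rule monom2_eqI) (use z(2) in \<open>auto simp: mdegree2\<close>)
    moreover have "(?x, m) \<in> (SIGMA x:{..j}. ?M x)"
      using z by (auto simp: mdegree2 weight_def)
    ultimately show "z \<in> (\<lambda>(x, m). (monom2 x (j - x), m)) ` (SIGMA x:{..j}. ?M x)"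
      using z(1) by (intro image_eqI[where x = "(?x, m)"]) auto
  qed (auto simp: bidegree_monoms_def weight_def)
  have inj: "inj_on (\<lambda>(x, m :: 2 \<Rightarrow>\<^sub>0 nat). (monom2 x (j - x), m)) (SIGMA x:{..j}. ?M x)"
    by (auto simp: inj_on_def) (metis lookup_monom2(1))
  show "finite (bidegree_monoms i j)"
    unfolding eq by (intro finite_imageI finite_SigmaI finite_atMost conjunct1[OF M])
  have "int (card (bidegree_monoms i j)) = (\<Sum>x\<le>j. int (card (?M x)))"
    unfolding eq card_image[OF inj] of_nat_sum[symmetric] of_nat_eq_iff
    by (intro card_SigmaI finite_atMost ballI conjunct1[OF M])
  also have "\<dots> = (\<Sum>x\<le>j. ?w x + 1)" by (simp only: conjunct2[OF M])
  finally have c: "int (card (bidegree_monoms i j)) = (\<Sum>x\<le>j. ?w x + 1)" .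
  \<comment> \<open>Adding the sum to its reversal makes all summands equal, because \<open>\<sigma> 1 + \<sigma> 2 = d\<close>.\<close>
  have flip: "(\<Sum>x\<le>j. ?w x + 1) = (\<Sum>x\<le>j. i + int ((j - x) * \<sigma> 1 + x * \<sigma> 2) + 1)"
    by (rule sum.reindex_bij_witness[where i = "\<lambda>x. j - x" and j = "\<lambda>x. j - x"]) auto
  have regroup: "y + z = t \<Longrightarrow> i + y + 1 + (i + z + 1) = 2 * (i + 1) + t" for y z t :: int
    by simp
  have "2 * (\<Sum>x\<le>j. ?w x + 1) = (\<Sum>x\<le>j. ?w x + 1) + (\<Sum>x\<le>j. i + int ((j - x) * \<sigma> 1 + x * \<sigma> 2) + 1)"
    using flip by simp
  also have "\<dots> = (\<Sum>x\<le>j. 2 * (i + 1) + int d * int j)"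
    unfolding sum.distrib[symmetric]
  proof (rule sum.cong)
    fix x assume "x \<in> {..j}"
    then have "(x * \<sigma> 1 + (j - x) * \<sigma> 2) + ((j - x) * \<sigma> 1 + x * \<sigma> 2) = (x + (j - x)) * (\<sigma> 1 + \<sigma> 2)"
      by (simp only: ring_distribs ac_simps)
    also have "\<dots> = j * d" using \<open>x \<in> {..j}\<close> sum_\<sigma> by simp
    finally have "int (x * \<sigma> 1 + (j - x) * \<sigma> 2) + int ((j - x) * \<sigma> 1 + x * \<sigma> 2) = int d * int j"
      by (metis mult.commute of_nat_add of_nat_mult)
    then show "?w x + 1 + (i + int ((j - x) * \<sigma> 1 + x * \<sigma> 2) + 1) = 2 * (i + 1) + int d * int j"
      by (rule regroup)
  qed simp
  finally show "2 * int (card (bidegree_monoms i j)) = (int j + 1) * (2 * (i + 1) + int d * int j)"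
    by (simp add: c)
qed

text \<open>All dimension comparisons below are instances of this lemma.\<close>

lemma square_family_in_bidegree:
  fixes b :: "'x \<Rightarrow> (2, (2, 'k) mpoly) mpoly"
  assumes "- 1 \<le> i" "finite J" "2 * int (card J) = (int j + 1) * (2 * (i + 1) + int d * int j)"
    and "\<And>x. x \<in> J \<Longrightarrow> b x \<in> twisted weight i \<and> b x \<in> forms (int j)"
  shows "(\<forall>c. (\<Sum>x\<in>J. kscale (c x) (b x)) = 0 \<longrightarrow> (\<forall>x\<in>J. c x = 0)) \<longleftrightarrow>
     (\<forall>w. w \<in> twisted weight i \<and> w \<in> forms (int j) \<longrightarrow> (\<exists>c. w = (\<Sum>x\<in>J. kscale (c x) (b x))))"
proof -
  have "card (bidegree_monoms i j) = card J"
    using finite_card_bidegree_monoms(2)[OF assms(1), of j] assms(3) by simp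
  from square_family_of_polynomials[OF assms(2) finite_card_bidegree_monoms(1)[OF assms(1)] this
      refl, of b] show ?thesis
    using assms(4) by (simp flip: bidegree_monoms_iff)
qed


subsection \<open>Rows below the degree of the relation\<close>

lemma sum_monom_eq_0:
  assumes "(\<Sum>p<n. single (monom2 p (n - 1 - p)) (c p)) = 0" "p < n"
  shows "c p = 0"
proof -
  have inj: "monom2 q (n - 1 - q) = monom2 p (n - 1 - p) \<longleftrightarrow> q = p" for q
    by (metis lookup_monom2(1))
  have "lookup (\<Sum>q<n. single (monom2 q (n - 1 - q)) (c q)) (monom2 p (n - 1 - p)) = c p"
    using assms(2) by (simp add: lookup_sum lookup_single when_def inj[simplified])
  then show ?thesis using assms(1) by simp
qed

lemma single_monom2_forms: "p < n \<Longrightarrow> single (monom2 p (n - 1 - p)) c \<in> forms (int n - 1)"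
  by (rule single_forms) auto

text \<open>The element of row \<open>n - 1\<close> with coordinates \<open>u\<close> in the basis of monomials; for \<open>n = 0\<close> the row is zero.\<close>

definition row_sum :: "nat \<Rightarrow> (nat \<Rightarrow> (3, 'k) mpoly) \<Rightarrow> (2, (3, 'k) mpoly) mpoly" where
  "row_sum n u = (\<Sum>p<n. single (monom2 p (n - 1 - p)) (u p))"

lemma row_sum_forms: "row_sum n u \<in> forms (int n - 1)"
  unfolding row_sum_def by (intro sum_forms single_monom2_forms) simp

lemma row_sum_twisted: "(\<And>p. p < n \<Longrightarrow> u p \<in> forms j) \<Longrightarrow> row_sum n u \<in> twisted (\<lambda>_. 0) j"
  unfolding row_sum_def by (intro sum_twisted single_twisted) auto

lemma form_is_row_sum:
  "s \<in> forms (int n - 1) \<Longrightarrow> row_sum n (\<lambda>p. lookup s (monom2 p (n - 1 - p))) = s"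
  unfolding row_sum_def by (rule form2_expand_less)

lemma row_sum_eq_0: "row_sum n u = 0 \<Longrightarrow> p < n \<Longrightarrow> u p = 0"
  unfolding row_sum_def by (rule sum_monom_eq_0)

lemma \<theta>_row_sum: "\<theta> (row_sum n u) = (\<Sum>p<n. mconst (single (monom2 p (n - 1 - p)) 1) * \<rho> (u p))"
  by (simp add: row_sum_def \<theta>_sum \<theta>_single)

lemma \<rho>_sum_singles: "\<rho> (\<Sum>n\<in>N. single n (c n)) = (\<Sum>n\<in>N. kscale (c n) (monom_eval T n))"
  by (simp add: \<rho>_def mconst_mconst.meval_sum mconst_mconst.meval_single)

lemma form3_expand: "u \<in> forms j \<Longrightarrow> (\<Sum>n\<in>monoms3 j. single n (lookup u n)) = u"
proof -
  assume u: "u \<in> forms j"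
  have "(\<Sum>n\<in>monoms3 j. single n (lookup u n))
      = (\<Sum>n\<in>keys u. single n (lookup u n))"
    by (rule sum.mono_neutral_right) (use u finite_monoms3_of[of j] in \<open>auto simp: monoms3_def forms_def in_keys_iff\<close>)
  then show ?thesis by (simp add: sum_single_lookup)
qed

lemma sum_monoms3_forms: "(\<Sum>n\<in>monoms3 j. single n (c n)) \<in> forms j"
  by (intro sum_forms single_forms) (simp add: monoms3_def)

lemma lookup_sum_monoms3:
  assumes "n \<in> monoms3 j"
  shows "lookup (\<Sum>n\<in>monoms3 j. single n (c n)) n = c n"
proof -
  have "lookup (\<Sum>n\<in>monoms3 j. single n (c n)) n = (\<Sum>m\<in>monoms3 j. if m = n then c n else 0)"
    unfolding lookup_sum by (rule sum.cong) (auto simp: lookup_single when_def)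
  then show ?thesis using assms finite_monoms3_of[of j] by simp
qed

text \<open>In degree \<open>d - 1\<close> the module \<open>E\<close> fills its bidual: no nonzero multiple of \<open>a\<close> has degree
  \<open>d - 1\<close>, so the map is injective, and both sides have dimension \<open>3 * d\<close>.\<close>

lemma linear_row_spanned:
  assumes "w \<in> twisted weight (int d - 1)" "w \<in> forms 1"
  obtains v where "\<And>l. v l \<in> forms (int d - 1)" "w = (\<Sum>l\<in>UNIV. mconst (v l) * T l)"
proof -
  let ?J = "{..<d} \<times> (UNIV :: 3 set)"
  let ?b = "\<lambda>(p, l). mconst (single (monom2 p (d - 1 - p)) 1) * T l"
  let ?v = "\<lambda>c l. \<Sum>p<d. single (monom2 p (d - 1 - p)) (c (p, l))"
  have v: "?v c l \<in> forms (int d - 1)" for c :: "_ \<Rightarrow> 'k" and l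
    by (intro sum_forms single_monom2_forms) simp
  have eq: "(\<Sum>x\<in>?J. kscale (c x) (?b x)) = (\<Sum>l\<in>UNIV. mconst (?v c l) * T l)" for c
  proof -
    have "(\<Sum>x\<in>?J. kscale (c x) (?b x)) = (\<Sum>p<d. \<Sum>l\<in>UNIV. kscale (c (p, l)) (?b (p, l)))"
      by (simp add: sum.cartesian_product case_prod_unfold)
    also have "\<dots> = (\<Sum>l\<in>UNIV. \<Sum>p<d. mconst (single (monom2 p (d - 1 - p)) (c (p, l))) * T l)"
      by (subst sum.swap) (simp add: mconst_mult_single flip: mconst_mult mult.assoc)
    finally show ?thesis by (simp add: mconst_sum sum_distrib_right)
  qed
  have "(\<forall>c. (\<Sum>x\<in>?J. kscale (c x) (?b x)) = 0 \<longrightarrow> (\<forall>x\<in>?J. c x = 0)) \<longleftrightarrow>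
     (\<forall>w. w \<in> twisted weight (int d - 1) \<and> w \<in> forms (int 1) \<longrightarrow> (\<exists>c. w = (\<Sum>x\<in>?J. kscale (c x) (?b x))))"
  proof (rule square_family_in_bidegree)
    fix x assume "x \<in> ?J"
    then obtain p l where x: "x = (p, l)" "p < d" by auto
    show "?b x \<in> twisted weight (int d - 1) \<and> ?b x \<in> forms (int 1)"
      using mult_row[OF mconst_row[OF single_monom2_forms[OF x(2), of 1]] T_row[of l]]
        mconst_mult_forms[OF T_forms[of l]] by (simp add: x)
  qed (use d_pos in \<open>auto simp: card_cartesian_product algebra_simps\<close>)
  moreover have "\<forall>c. (\<Sum>x\<in>?J. kscale (c x) (?b x)) = 0 \<longrightarrow> (\<forall>x\<in>?J. c x = 0)"
  proof (intro allI impI ballI)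
    fix c x assume "(\<Sum>x\<in>?J. kscale (c x) (?b x)) = 0" and x: "x \<in> ?J"
    then have "(\<Sum>l\<in>UNIV. mconst (?v c l) * T l) = 0" by (simp only: eq)
    then obtain r where r: "\<And>l. ?v c l = r * a l"
      using linear_relation[of "?v c"] by blast
    obtain p l where pl: "x = (p, l)" "p < d" using x by auto
    have "?v c l = hom_component (int d - 1) (a l * r)"
      using r[of l] hom_component_of_form[OF v[of c l]] by (simp add: mult.commute)
    also have "\<dots> = a l * hom_component (- 1) r"
      using hom_component_mult_form[OF a_forms[of l]] by simp
    also have "hom_component (- 1) r = 0"
      by (rule hom_component_neg) simp
    finally have "?v c l = 0" by simp
    then show "c x = 0" using sum_monom_eq_0[of d "\<lambda>p. c (p, l)" p] pl by simp
  qed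
  ultimately obtain c where "w = (\<Sum>x\<in>?J. kscale (c x) (?b x))"
    using assms by fastforce
  then have "w = (\<Sum>l\<in>UNIV. mconst (?v c l) * T l)" by (simp only: eq)
  then show thesis by (rule that[of "?v c", OF v])
qed

text \<open>Induction on the degree in \<open>w\<close>: from a monomial split off one variable \<open>w_i\<close> with just enough of the
  coefficient to land in degree \<open>d - 1\<close>, and rewrite this factor in the \<open>T l\<close>. The other factor, of
  row degree \<open>0\<close>, takes over the coefficients of degree \<open>d - 1\<close> and so stays in row \<open>d - 1\<close>.\<close>

lemma top_row_spanned:
  assumes "w \<in> twisted weight (int d - 1)" "w \<in> forms (int j)"
  shows "\<exists>s. s \<in> forms (int d - 1) \<and> s \<in> twisted (\<lambda>_. 0) (int j) \<and> w = \<theta> s"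
  using assms
proof (induction j arbitrary: w)
  case 0
  define r where "r = lookup w 0"
  have "w = mconst r"
  proof (rule poly_mapping_eqI)
    fix \<mu> show "lookup w \<mu> = lookup (mconst r) \<mu>"
    proof (cases "\<mu> = 0")
      case False
      then have "mdegree \<mu> \<noteq> 0"
        by (metis add_is_0 lookup_zero mdegree2 monom2_eqI)
      then have "lookup w \<mu> = 0" using 0(2) by (auto simp: forms_lookup_iff)
      then show ?thesis using False by (simp add: mconst_def lookup_single when_def)
    qed (simp add: r_def mconst_def)
  qed
  moreover have "r \<in> forms (int d - 1)"
    using 0(1) by (auto simp: twisted_def r_def dest: spec[of _ 0])
  ultimately show ?case
    using lift_forms lift_twisted \<theta>_lift by (intro exI[of _ "lift r"]) auto
next
  case (Suc j)
  from Suc.prems show ?case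
  proof (induction w rule: twisted_form_induct)
    case zero
    then show ?case by (intro exI[of _ 0]) (simp add: \<theta>.hom_zero)
  next
    case (single \<mu> m c)
    have "lookup \<mu> 1 \<noteq> 0 \<or> lookup \<mu> 2 \<noteq> 0"
      using single(1) by (auto simp: mdegree2)
    then obtain i where i: "lookup \<mu> i \<noteq> 0" by blast
    define \<nu> where "\<nu> = \<mu> - single i 1"
    have \<mu>: "\<mu> = single i 1 + \<nu>"
      by (rule poly_mapping_eqI) (use i in \<open>auto simp: \<nu>_def lookup_add lookup_minus lookup_single when_def\<close>)
    have \<nu>: "mdegree \<nu> = j" using single(1) by (simp add: \<mu>)
    have "int (mdegree m) = int ((d - 1 + \<sigma> i) + nat (weight \<nu>))"
      using single(2) d_pos weight_nonneg[of \<nu>] by (simp add: \<mu> weight_add)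
    then have "mdegree m = (d - 1 + \<sigma> i) + nat (weight \<nu>)" by (simp only: of_nat_eq_iff)
    then obtain m1 m2 where m: "m = m1 + m2" "mdegree m1 = d - 1 + \<sigma> i" "mdegree m2 = nat (weight \<nu>)"
      by (rule monom2_split)
    let ?w1 = "single (single i 1) (single m1 1) :: (2, (2, 'k) mpoly) mpoly"
    have "?w1 \<in> twisted weight (int d - 1)" "?w1 \<in> forms 1"
      using m(2) d_pos by (auto intro!: single_twisted single_forms)
    then obtain v where v: "\<And>l. v l \<in> forms (int d - 1)" "?w1 = (\<Sum>l\<in>UNIV. mconst (v l) * T l)"
      by (rule linear_row_spanned) blast
    let ?w2 = "single \<nu> (single m2 c)"
    have w2: "?w2 \<in> twisted weight 0" "?w2 \<in> forms (int j)"
      using m(3) \<nu> weight_nonneg[of \<nu>] by (auto intro!: single_twisted single_forms)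
    have "mconst (v l) * ?w2 \<in> twisted weight (int d - 1)" "mconst (v l) * ?w2 \<in> forms (int j)" for l
      using mult_row[OF mconst_row[OF v(1)] w2(1)] mconst_mult_forms[OF w2(2)] by auto
    then have "\<exists>s. s \<in> forms (int d - 1) \<and> s \<in> twisted (\<lambda>_. 0) (int j) \<and> mconst (v l) * ?w2 = \<theta> s" for l
      by (intro Suc.IH)
    then obtain s where s: "\<And>l. s l \<in> forms (int d - 1)" "\<And>l. s l \<in> twisted (\<lambda>_. 0) (int j)"
      "\<And>l. mconst (v l) * ?w2 = \<theta> (s l)" by metis
    let ?s = "\<Sum>l\<in>UNIV. mconst (mvar l) * s l"
    have "\<theta> ?s = (\<Sum>l\<in>UNIV. T l * \<theta> (s l))"
      by (simp add: \<theta>_sum \<theta>.hom_mult \<theta>_mconst \<rho>_mvar)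
    also have "\<dots> = (\<Sum>l\<in>UNIV. mconst (v l) * T l) * ?w2"
      unfolding s(3)[symmetric] sum_distrib_right by (intro sum.cong refl) (simp only: mult_ac)
    also have "\<dots> = ?w1 * ?w2" by (simp only: v(2))
    also have "\<dots> = single \<mu> (single m c)"
      by (simp add: mult_single \<mu> m(1))
    finally have "single \<mu> (single m c) = \<theta> ?s" by simp
    moreover have "?s \<in> forms (int d - 1)"
      by (intro sum_forms mconst_mult_forms s)
    moreover have "?s \<in> twisted (\<lambda>_. 0) (int (Suc j))"
    proof (intro sum_twisted)
      fix l
      have "mconst (mvar l :: (3, 'k) mpoly) \<in> twisted (\<lambda>_. 0) 1"
        unfolding mconst_def by (rule single_twisted) simp
      from mult_twisted[OF _ this s(2)[of l]]
      show "mconst (mvar l) * s l \<in> twisted (\<lambda>_. 0) (int (Suc j))" by (simp add: add.commute)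
    qed
    ultimately show ?case by blast
  next
    case (add p q)
    then obtain s t where "s \<in> forms (int d - 1)" "s \<in> twisted (\<lambda>_. 0) (int (Suc j))" "p = \<theta> s"
      "t \<in> forms (int d - 1)" "t \<in> twisted (\<lambda>_. 0) (int (Suc j))" "q = \<theta> t" by blast
    then show ?case
      by (intro exI[of _ "s + t"]) (auto intro: add_forms add_twisted simp: \<theta>.hom_add)
  qed
qed

text \<open>A surjection between spaces of equal dimension.\<close>

lemma top_row_injective_in_degree:
  assumes "\<And>p. p < d \<Longrightarrow> u p \<in> forms (int j)" "\<theta> (row_sum d u) = 0" "p < d"
  shows "u p = 0"
proof -
  let ?J = "{..<d} \<times> monoms3 (int j)"
  let ?b = "\<lambda>(p, n). mconst (single (monom2 p (d - 1 - p)) 1) * monom_eval T n"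
  have eq: "(\<Sum>x\<in>?J. kscale (c x) (?b x)) = \<theta> (row_sum d (\<lambda>p. \<Sum>n\<in>monoms3 (int j). single n (c (p, n))))" for c
  proof -
    have "(\<Sum>x\<in>?J. kscale (c x) (?b x)) = (\<Sum>p<d. \<Sum>n\<in>monoms3 (int j). kscale (c (p, n)) (?b (p, n)))"
      by (simp add: sum.cartesian_product case_prod_unfold)
    then show ?thesis
      by (simp add: \<theta>_row_sum \<rho>_sum_singles sum_distrib_left mult_ac)
  qed
  have expand: "\<theta> (row_sum d u) = (\<Sum>x\<in>?J. kscale (case x of (p, n) \<Rightarrow> lookup (u p) n) (?b x))"
    if "\<And>p. p < d \<Longrightarrow> u p \<in> forms (int j)" for u
    unfolding eq row_sum_def using that by (simp add: form3_expand)
  have "(\<forall>c. (\<Sum>x\<in>?J. kscale (c x) (?b x)) = 0 \<longrightarrow> (\<forall>x\<in>?J. c x = 0)) \<longleftrightarrow>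
     (\<forall>w. w \<in> twisted weight (int d - 1) \<and> w \<in> forms (int j) \<longrightarrow> (\<exists>c. w = (\<Sum>x\<in>?J. kscale (c x) (?b x))))"
  proof (rule square_family_in_bidegree)
    have "2 * int (card ?J) = int d * (2 * int (card (monoms3 (int j))))"
      by (simp add: card_cartesian_product)
    then show "2 * int (card ?J) = (int j + 1) * (2 * (int d - 1 + 1) + int d * int j)"
      by (simp add: card_monoms3_of algebra_simps)
    fix x assume "x \<in> ?J"
    then obtain p n where x: "x = (p, n)" "p < d" "int (mdegree n) = int j" by (auto simp: monoms3_def)
    show "?b x \<in> twisted weight (int d - 1) \<and> ?b x \<in> forms (int j)"
      using mult_row[OF mconst_row[OF single_monom2_forms[OF x(2), of 1]] monom_eval_T_row[of n]]
        mconst_mult_forms[OF monom_eval_T_forms[of n]] x(3) by (simp add: x)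
  qed (use d_pos in \<open>auto simp: finite_monoms3_of\<close>)
  moreover have "\<forall>w. w \<in> twisted weight (int d - 1) \<and> w \<in> forms (int j) \<longrightarrow> (\<exists>c. w = (\<Sum>x\<in>?J. kscale (c x) (?b x)))"
  proof (intro allI impI)
    fix w :: "(2, (2, 'k) mpoly) mpoly"
    assume "w \<in> twisted weight (int d - 1) \<and> w \<in> forms (int j)"
    then obtain s where s: "s \<in> forms (int d - 1)" "s \<in> twisted (\<lambda>_. 0) (int j)" "w = \<theta> s"
      using top_row_spanned by blast
    have "lookup s m \<in> forms (int j)" for m
      using s(2) by (simp add: twisted_def)
    from expand[OF this, of "\<lambda>p. monom2 p (d - 1 - p)"]
    have "w = (\<Sum>x\<in>?J. kscale (case x of (p, n) \<Rightarrow> lookup (lookup s (monom2 p (d - 1 - p))) n) (?b x))"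
      unfolding form_is_row_sum[OF s(1)] s(3) .
    then show "\<exists>c. w = (\<Sum>x\<in>?J. kscale (c x) (?b x))"
      by (intro exI[of _ "\<lambda>x. case x of (p, n) \<Rightarrow> lookup (lookup s (monom2 p (d - 1 - p))) n"])
  qed
  ultimately have ind: "\<forall>c. (\<Sum>x\<in>?J. kscale (c x) (?b x)) = 0 \<longrightarrow> (\<forall>x\<in>?J. c x = 0)" by blast
  have "(\<Sum>x\<in>?J. kscale (case x of (p, n) \<Rightarrow> lookup (u p) n) (?b x)) = 0"
    using expand[of u] assms by simp
  with ind have "\<forall>x\<in>?J. (case x of (p, n) \<Rightarrow> lookup (u p) n) = 0" by blast
  then have "lookup (u p) n = 0" if "n \<in> monoms3 (int j)" for n
    using that assms(3) by auto
  then show ?thesis using form3_expand[OF assms(1)[OF assms(3)]] by simp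
qed

lemma top_row_injective:
  assumes "s \<in> forms (int d - 1)" "\<theta> s = 0"
  shows "s = 0"
proof -
  define u where "u p = lookup s (monom2 p (d - 1 - p))" for p
  have s: "s = row_sum d u" unfolding u_def using form_is_row_sum[OF assms(1)] by simp
  have "hom_component j (u p) = 0" if p: "p < d" for p j
  proof (cases "0 \<le> j")
    case True
    have "\<theta> (row_sum d (\<lambda>p. hom_component j (u p))) = hom_component j (\<theta> s)"
    proof -
      have "hom_component j (mconst r * w) = mconst r * hom_component j w" for r and w :: "(2, (2, 'k) mpoly) mpoly"
        using hom_component_mult_form[OF mconst_forms[of r], of j w] by simp
      then show ?thesis
        by (simp add: s \<theta>_row_sum hom_component_sum flip: hom_component_\<rho>)
    qed
    also have "\<dots> = 0" using assms(2) by simp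
    finally show ?thesis
      using top_row_injective_in_degree[of "\<lambda>p. hom_component j (u p)" "nat j" p] True p by simp
  next
    case False
    then show ?thesis by (simp add: hom_component_neg)
  qed
  then have comp: "hom_component j (u p) = hom_component j 0" if "p < d" for p j
    using that by simp
  have "u p = 0" if "p < d" for p
    by (rule form_eqI) (rule comp[OF that])
  then show ?thesis unfolding s row_sum_def by (intro sum.neutral ballI) simp
qed

text \<open>Multiplication by a power of \<open>x_1\<close> moves the row up to row \<open>d - 1\<close>.\<close>

lemma low_row_injective:
  assumes "s \<in> forms i" "i \<le> int d - 1" "\<theta> s = 0"
  shows "s = 0"
proof -
  define e where "e = nat (int d - 1 - i)"
  have "mvar 1 ^ e * s \<in> forms (int d - 1)"
    by (rule mult_forms'[OF mvar_power_forms assms(1)]) (use assms(2) in \<open>simp add: e_def\<close>)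
  moreover have "\<theta> (mvar 1 ^ e * s) = 0" using assms(3) by (simp add: \<theta>.hom_mult)
  ultimately have "mvar 1 ^ e * s = 0" by (rule top_row_injective)
  then show ?thesis by (simp add: mvar_neq_0)
qed


subsection \<open>A basis of a row of the larger algebra\<close>

text \<open>The lift of the local cohomology class \<open>h / (x_1 x_2)\<^sup>e\<close>, for the monomial
  \<open>h = x_1\<^sup>q x_2\<^bsup>e-1-q\<^esup>\<close> and \<open>e = d - n\<close>: the Cech cochain with entries \<open>(\<Sum> s_l T_l) / x_1\<^sup>e\<close> and \<open>(\<Sum> t_l T_l) / x_2\<^sup>e\<close> is a
  cocycle in the larger algebra, where such fractions are honest elements because \<open>x_1\<close> and \<open>x_2\<close> are
  coprime.\<close>

lemma cech_element:
  assumes n: "n \<le> d" and q: "q < d - n"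
  shows "\<exists>\<beta> s t. \<beta> \<in> twisted weight (int n - 1) \<and> \<beta> \<in> forms 1 \<and>
    (\<forall>l. s l \<in> forms (int d - 1) \<and> t l \<in> forms (int d - 1) \<and>
      a l * single (monom2 q (d - n - 1 - q)) 1 = mvar 2 ^ (d - n) * s l - mvar 1 ^ (d - n) * t l) \<and>
    mconst (mvar 1 ^ (d - n)) * \<beta> = (\<Sum>l\<in>UNIV. mconst (s l) * T l) \<and>
    mconst (mvar 2 ^ (d - n)) * \<beta> = (\<Sum>l\<in>UNIV. mconst (t l) * T l)"
proof -
  define e where "e = d - n"
  define h :: "(2, 'k) mpoly" where "h = single (monom2 q (e - 1 - q)) 1"
  have "h \<in> forms (int e - 1)"
    unfolding h_def by (rule single_monom2_forms) (use q in \<open>simp add: e_def\<close>)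
  then have "a l * h \<in> forms (int (d - 1) + int e)" for l
    by (intro mult_forms'[OF a_forms]) (use d_pos in auto)
  then have "\<exists>s t. s \<in> forms (int (d - 1)) \<and> t \<in> forms (int (d - 1)) \<and> a l * h = mvar 2 ^ e * s - mvar 1 ^ e * t" for l
    by (rule form_power_split) (use d_pos in \<open>auto simp: e_def\<close>)
  then obtain s t where st: "\<And>l. s l \<in> forms (int (d - 1))" "\<And>l. t l \<in> forms (int (d - 1))"
    "\<And>l. a l * h = mvar 2 ^ e * s l - mvar 1 ^ e * t l" by metis
  define S where "S i = (\<Sum>l\<in>UNIV. s l * \<xi> i l)" for i
  define S' where "S' i = (\<Sum>l\<in>UNIV. t l * \<xi> i l)" for i
  have rel: "mvar 2 ^ e * S i = mvar 1 ^ e * S' i" for i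
  proof -
    have "mvar 2 ^ e * S i - mvar 1 ^ e * S' i = (\<Sum>l\<in>UNIV. (mvar 2 ^ e * s l - mvar 1 ^ e * t l) * \<xi> i l)"
      by (simp add: S_def S'_def sum_distrib_left sum_subtractf left_diff_distrib mult.assoc)
    also have "\<dots> = h * (\<Sum>l\<in>UNIV. a l * \<xi> i l)"
      unfolding st(3)[symmetric] by (simp add: sum_distrib_left mult_ac)
    finally show ?thesis by (simp add: orthogonal)
  qed
  have "\<exists>b. S i = mvar 1 ^ e * b" for i
    using mvar_power_dvd[OF rel[of i]] by blast
  then obtain b0 where b0: "\<And>i. S i = mvar 1 ^ e * b0 i" by metis
  \<comment> \<open>The quotient may be replaced by its component of the expected degree.\<close>
  define b where "b i = hom_component (int n - 1 + int (\<sigma> i)) (b0 i)" for i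
  have b: "S i = mvar 1 ^ e * b i" for i
  proof -
    have "S i \<in> forms (int (d - 1) + int (\<sigma> i))"
      unfolding S_def by (intro sum_forms mult_forms st \<xi>_forms)
    then have "S i = hom_component (int (d - 1) + int (\<sigma> i)) (S i)"
      by (simp add: hom_component_of_form)
    also have "\<dots> = mvar 1 ^ e * hom_component (int (d - 1) + int (\<sigma> i) - int e) (b0 i)"
      unfolding b0 by (rule hom_component_mult_form) simp
    also have "int (d - 1) + int (\<sigma> i) - int e = int n - 1 + int (\<sigma> i)"
      using n d_pos by (simp add: e_def)
    finally show ?thesis by (simp add: b_def)
  qed
  have b': "S' i = mvar 2 ^ e * b i" for i
  proof -
    have "mvar 1 ^ e * S' i = mvar 1 ^ e * (mvar 2 ^ e * b i)"
      unfolding rel[of i, symmetric] b[of i] by (simp only: mult_ac)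
    then show ?thesis by (simp add: mvar_neq_0)
  qed
  define \<beta> where "\<beta> = (\<Sum>i\<in>UNIV. mconst (b i) * mvar i :: (2, (2, 'k) mpoly) mpoly)"
  have "\<beta> \<in> twisted weight (int n - 1)" unfolding \<beta>_def
    by (intro sum_twisted) (rule mult_row'[OF mconst_row mvar_row], unfold b_def, rule hom_component_forms, simp)
  moreover have "\<beta> \<in> forms 1"
    unfolding \<beta>_def by (intro sum_forms mconst_mult_forms mvar_forms)
  moreover have "mconst (mvar 1 ^ e) * \<beta> = (\<Sum>l\<in>UNIV. mconst (s l) * T l)"
    unfolding sum_T_eq S_def[symmetric] b \<beta>_def by (simp add: sum_distrib_left mconst_mult mult.assoc)
  moreover have "mconst (mvar 2 ^ e) * \<beta> = (\<Sum>l\<in>UNIV. mconst (t l) * T l)"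
    unfolding sum_T_eq S'_def[symmetric] b' \<beta>_def by (simp add: sum_distrib_left mconst_mult mult.assoc)
  ultimately have "\<beta> \<in> twisted weight (int n - 1) \<and> \<beta> \<in> forms 1 \<and>
    (\<forall>l. s l \<in> forms (int d - 1) \<and> t l \<in> forms (int d - 1) \<and>
      a l * single (monom2 q (e - 1 - q)) 1 = mvar 2 ^ e * s l - mvar 1 ^ e * t l) \<and>
    mconst (mvar 1 ^ e) * \<beta> = (\<Sum>l\<in>UNIV. mconst (s l) * T l) \<and>
    mconst (mvar 2 ^ e) * \<beta> = (\<Sum>l\<in>UNIV. mconst (t l) * T l)"
    using st d_pos by (simp add: h_def of_nat_diff)
  then show ?thesis unfolding e_def by blast
qed

text \<open>The equation \<open>g = \<Sum> a_l T_l\<close> of \<open>rees E\<close>, as an element of the domain \<open>R[T_1, T_2, T_3]\<close>.\<close>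

lemma relation_nonzero: "(\<Sum>l\<in>UNIV. lift (a l) * mconst (mvar l)) \<noteq> 0"
proof
  assume g: "(\<Sum>l\<in>UNIV. lift (a l) * mconst (mvar l)) = 0"
  have "lookup (a l) m = 0" for l m
  proof (rule mvar_combination_eq_0)
    have "(\<Sum>l\<in>UNIV. mconst (lookup (a l) m) * mvar l)
        = lookup (\<Sum>l\<in>UNIV. mconst (mvar l) * lift (a l)) m"
      by (simp add: lookup_sum lift_lookup mult.commute)
    then show "(\<Sum>l\<in>UNIV. mconst (lookup (a l) m) * mvar l) = 0"
      using g by (simp add: mult.commute)
  qed
  then have "a l = 0" for l by (intro poly_mapping_eqI) simp
  then show False using a_nonzero by simp
qed

text \<open>The monomials of degree \<open>n - 1\<close> and the elements of \<open>cech_element\<close> form a basis of row \<open>n - 1\<close> over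
  \<open>k[T_1, T_2, T_3]\<close>. Independence is proved first; as the numbers of elements match the dimension in every
  degree, spanning follows.\<close>

theorem row_basis:
  assumes n: "n \<le> d"
  obtains \<beta> where "\<And>q. q < d - n \<Longrightarrow> \<beta> q \<in> twisted weight (int n - 1) \<and> \<beta> q \<in> forms 1"
    and "\<And>u v. \<theta> (row_sum n u) + (\<Sum>q<d - n. \<beta> q * \<rho> (v q)) = 0 \<Longrightarrow> (\<forall>p<n. u p = 0) \<and> (\<forall>q<d - n. v q = 0)"
    and "\<And>j w. w \<in> twisted weight (int n - 1) \<Longrightarrow> w \<in> forms j \<Longrightarrow>
      \<exists>u v. (\<forall>p. u p \<in> forms j) \<and> (\<forall>q. v q \<in> forms (j - 1)) \<and>
        w = \<theta> (row_sum n u) + (\<Sum>q<d - n. \<beta> q * \<rho> (v q))"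
proof -
  define e where "e = d - n"
  let ?h = "\<lambda>q. single (monom2 q (e - 1 - q)) 1 :: (2, 'k) mpoly"
  have "\<forall>q. \<exists>\<beta> s t. q < e \<longrightarrow> \<beta> \<in> twisted weight (int n - 1) \<and> \<beta> \<in> forms 1 \<and>
    (\<forall>l. s l \<in> forms (int d - 1) \<and> t l \<in> forms (int d - 1) \<and>
      a l * ?h q = mvar 2 ^ e * s l - mvar 1 ^ e * t l) \<and>
    mconst (mvar 1 ^ e) * \<beta> = (\<Sum>l\<in>UNIV. mconst (s l) * T l) \<and>
    mconst (mvar 2 ^ e) * \<beta> = (\<Sum>l\<in>UNIV. mconst (t l) * T l)"
    using cech_element[OF n] unfolding e_def by blast
  then obtain \<beta> s t where B: "\<forall>q. q < e \<longrightarrow> \<beta> q \<in> twisted weight (int n - 1) \<and> \<beta> q \<in> forms 1 \<and>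
    (\<forall>l. s q l \<in> forms (int d - 1) \<and> t q l \<in> forms (int d - 1) \<and>
      a l * ?h q = mvar 2 ^ e * s q l - mvar 1 ^ e * t q l) \<and>
    mconst (mvar 1 ^ e) * \<beta> q = (\<Sum>l\<in>UNIV. mconst (s q l) * T l) \<and>
    mconst (mvar 2 ^ e) * \<beta> q = (\<Sum>l\<in>UNIV. mconst (t q l) * T l)"
    unfolding choice_iff by blast
  have \<beta>: "\<beta> q \<in> twisted weight (int n - 1)" "\<beta> q \<in> forms 1" if "q < e" for q
    using B that by auto
  have st: "s q l \<in> forms (int d - 1)" "t q l \<in> forms (int d - 1)" if "q < e" for q l
    using B that by auto
  have h: "a l * ?h q = mvar 2 ^ e * s q l - mvar 1 ^ e * t q l" if "q < e" for q l
    using B that by auto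
  have x\<beta>: "mconst (mvar 1 ^ e) * \<beta> q = (\<Sum>l\<in>UNIV. mconst (s q l) * T l)"
    and y\<beta>: "mconst (mvar 2 ^ e) * \<beta> q = (\<Sum>l\<in>UNIV. mconst (t q l) * T l)" if "q < e" for q
    using B that by auto
  have independent: "(\<forall>p<n. u p = 0) \<and> (\<forall>q<e. v q = 0)"
    if zero: "\<theta> (row_sum n u) + (\<Sum>q<e. \<beta> q * \<rho> (v q)) = 0" for u v
  proof -
    \<comment> \<open>For \<open>x = x_1\<close> and \<open>r = s\<close>, or \<open>x = x_2\<close> and \<open>r = t\<close>, this is \<open>x\<^sup>e\<close> times the relation, lifted to row \<open>d - 1\<close>.\<close>
    define multiple where "multiple x r = lift (x ^ e) * row_sum n u + (\<Sum>q<e. \<Sum>l\<in>UNIV. lift (r q l) * (mconst (mvar l) * mconst (v q)))"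
      for x :: "(2, 'k) mpoly" and r :: "nat \<Rightarrow> 3 \<Rightarrow> (2, 'k) mpoly"
    have vanish: "multiple x r = 0"
      if x: "x \<in> forms 1" and r: "\<And>q l. q < e \<Longrightarrow> r q l \<in> forms (int d - 1)"
        and x\<beta>: "\<And>q. q < e \<Longrightarrow> mconst (x ^ e) * \<beta> q = (\<Sum>l\<in>UNIV. mconst (r q l) * T l)" for x r
    proof (rule top_row_injective)
      have "lift (x ^ e) * row_sum n u \<in> forms (int d - 1)"
        using power_forms[OF x, of e] n
        by (intro mult_forms'[OF lift_forms row_sum_forms]) (auto simp: e_def)
      moreover have "lift (r q l) * (mconst (mvar l) * mconst (v q)) \<in> forms (int d - 1)" if "q < e" for q l
        using mconst_mult_forms[OF mconst_mult_forms[OF lift_forms[OF r[OF that]]]]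
        by (simp add: mult_ac)
      ultimately show "multiple x r \<in> forms (int d - 1)"
        unfolding multiple_def by (intro add_forms sum_forms) auto
      have "\<theta> (multiple x r) = mconst (x ^ e) * \<theta> (row_sum n u) + (\<Sum>q<e. (\<Sum>l\<in>UNIV. mconst (r q l) * T l) * \<rho> (v q))"
        by (simp add: multiple_def \<theta>.hom_add \<theta>.hom_mult \<theta>_sum \<theta>_lift \<theta>_mconst \<rho>_mvar sum_distrib_right mult.assoc)
      also have "\<dots> = mconst (x ^ e) * \<theta> (row_sum n u) + (\<Sum>q<e. mconst (x ^ e) * \<beta> q * \<rho> (v q))"
        by (simp add: x\<beta>)
      also have "\<dots> = mconst (x ^ e) * (\<theta> (row_sum n u) + (\<Sum>q<e. \<beta> q * \<rho> (v q)))"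
        by (simp add: distrib_left sum_distrib_left mult.assoc)
      finally show "\<theta> (multiple x r) = 0" by (simp add: zero)
    qed
    have "multiple (mvar 1) s = 0" "multiple (mvar 2) t = 0"
      by (rule vanish; use st x\<beta> y\<beta> in simp)+
    \<comment> \<open>Eliminating \<open>row_sum n u\<close> leaves the coboundaries \<open>x_2\<^sup>e s - x_1\<^sup>e t = h a\<close>.\<close>
    then have "0 = lift (mvar 2 ^ e) * multiple (mvar 1) s - lift (mvar 1 ^ e) * multiple (mvar 2) t"
      by simp
    also have "\<dots> = (\<Sum>q<e. \<Sum>l\<in>UNIV. lift (mvar 2 ^ e * s q l - mvar 1 ^ e * t q l) * (mconst (mvar l) * mconst (v q)))"
      by (simp add: multiple_def lift_diff lift.hom_mult algebra_simps sum_distrib_left flip: sum_subtractf)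
    also have "\<dots> = (\<Sum>q<e. \<Sum>l\<in>UNIV. (lift (a l) * mconst (mvar l)) * (lift (?h q) * mconst (v q)))"
    proof (intro sum.cong refl)
      fix q l assume "q \<in> {..<e}"
      then show "lift (mvar 2 ^ e * s q l - mvar 1 ^ e * t q l) * (mconst (mvar l) * mconst (v q))
          = (lift (a l) * mconst (mvar l)) * (lift (?h q) * mconst (v q))"
        using h[of q l] lift.hom_mult[of "a l" "?h q"] by (simp only: lessThan_iff mult_ac)
    qed
    also have "\<dots> = (\<Sum>l\<in>UNIV. lift (a l) * mconst (mvar l)) * (\<Sum>q<e. lift (?h q) * mconst (v q))"
      by (simp add: sum_product sum.swap[of _ "UNIV" "{..<e}"])
    also have "(\<Sum>q<e. lift (?h q) * mconst (v q)) = row_sum e v"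
      unfolding row_sum_def by (intro sum.cong refl) (simp add: lift_single mult.commute[of _ "mconst _"] mconst_mult_single)
    finally have "row_sum e v = 0" using relation_nonzero by simp
    then have v: "v q = 0" if "q < e" for q using that by (rule row_sum_eq_0)
    then have "\<theta> (row_sum n u) = 0" using zero by (simp add: \<rho>.hom_zero)
    then have "row_sum n u = 0"
      using low_row_injective[OF row_sum_forms, of n u] n by simp
    then show ?thesis using v row_sum_eq_0 by blast
  qed
  have spanning: "\<exists>u v. (\<forall>p. u p \<in> forms j) \<and> (\<forall>q. v q \<in> forms (j - 1)) \<and>
        w = \<theta> (row_sum n u) + (\<Sum>q<e. \<beta> q * \<rho> (v q))"
    if w: "w \<in> twisted weight (int n - 1)" "w \<in> forms j" for j w
  proof (cases "j < 0")
    case True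
    then have "w = 0" using w(2) by (simp add: forms_neg)
    then show ?thesis
      by (intro exI[of _ "\<lambda>_. 0"]) (simp add: row_sum_def \<theta>.hom_zero \<rho>.hom_zero)
  next
    case False
    then obtain k where j: "j = int k" by (metis nonneg_int_cases not_less)
    let ?J = "({..<n} \<times> monoms3 j) <+> ({..<e} \<times> monoms3 (j - 1))"
    define b where "b x = (case x of Inl (p, m) \<Rightarrow> mconst (single (monom2 p (n - 1 - p)) 1) * monom_eval T m
      | Inr (q, m) \<Rightarrow> \<beta> q * monom_eval T m)" for x
    define U where "U c p = (\<Sum>m\<in>monoms3 j. single m (c (Inl (p, m))))"
      for c :: "nat \<times> (3 \<Rightarrow>\<^sub>0 nat) + nat \<times> (3 \<Rightarrow>\<^sub>0 nat) \<Rightarrow> 'k" and p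
    define V where "V c q = (\<Sum>m\<in>monoms3 (j - 1). single m (c (Inr (q, m))))"
      for c :: "nat \<times> (3 \<Rightarrow>\<^sub>0 nat) + nat \<times> (3 \<Rightarrow>\<^sub>0 nat) \<Rightarrow> 'k" and q
    have eq: "(\<Sum>x\<in>?J. kscale (c x) (b x)) = \<theta> (row_sum n (U c)) + (\<Sum>q<e. \<beta> q * \<rho> (V c q))" for c
    proof -
      have "(\<Sum>x\<in>?J. kscale (c x) (b x)) = (\<Sum>p<n. \<Sum>m\<in>monoms3 j. kscale (c (Inl (p, m))) (b (Inl (p, m))))
          + (\<Sum>q<e. \<Sum>m\<in>monoms3 (j - 1). kscale (c (Inr (q, m))) (b (Inr (q, m))))"
        by (simp add: sum.Plus finite_monoms3_of sum.cartesian_product case_prod_unfold)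
      then show ?thesis
        by (simp add: \<theta>_row_sum U_def V_def \<rho>_sum_singles sum_distrib_left mult_ac b_def)
    qed
    have "(\<forall>c. (\<Sum>x\<in>?J. kscale (c x) (b x)) = 0 \<longrightarrow> (\<forall>x\<in>?J. c x = 0)) \<longleftrightarrow>
      (\<forall>w. w \<in> twisted weight (int n - 1) \<and> w \<in> forms (int k) \<longrightarrow> (\<exists>c. w = (\<Sum>x\<in>?J. kscale (c x) (b x))))"
    proof (rule square_family_in_bidegree)
      have "2 * int (card ?J) = int n * (2 * int (card (monoms3 j))) + int e * (2 * int (card (monoms3 (j - 1))))"
        by (simp add: card_Plus finite_monoms3_of card_cartesian_product algebra_simps)
      also have "\<dots> = int n * ((j + 1) * (j + 2)) + (int d - int n) * (j * (j + 1))"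
        using n by (simp add: card_monoms3_of j e_def)
      finally show "2 * int (card ?J) = (int k + 1) * (2 * (int n - 1 + 1) + int d * int k)"
        by (simp add: algebra_simps j)
    next
      fix x assume "x \<in> ?J"
      then consider (l) p m where "x = Inl (p, m)" "p < n" "int (mdegree m) = j"
        | (r) q m where "x = Inr (q, m)" "q < e" "int (mdegree m) = j - 1"
        by (auto simp: monoms3_def)
      then show "b x \<in> twisted weight (int n - 1) \<and> b x \<in> forms (int k)"
      proof cases
        case l
        then show ?thesis
          using mult_row[OF mconst_row[OF single_monom2_forms[OF l(2), of 1]] monom_eval_T_row[of m]]
            mconst_mult_forms[OF monom_eval_T_forms[of m]] by (simp add: b_def j)
      next
        case r
        then show ?thesis
          using mult_row[OF \<beta>(1)[OF r(2)] monom_eval_T_row[of m]]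
            mult_forms[OF \<beta>(2)[OF r(2)] monom_eval_T_forms[of m]] by (simp add: b_def j)
      qed
    qed (simp_all add: finite_monoms3_of)
    moreover have "\<forall>c. (\<Sum>x\<in>?J. kscale (c x) (b x)) = 0 \<longrightarrow> (\<forall>x\<in>?J. c x = 0)"
    proof (intro allI impI ballI)
      fix c x assume "(\<Sum>x\<in>?J. kscale (c x) (b x)) = 0" and x: "x \<in> ?J"
      then have zero: "(\<forall>p<n. U c p = 0) \<and> (\<forall>q<e. V c q = 0)"
        unfolding eq by (intro independent)
      from x consider (l) p m where "x = Inl (p, m)" "p < n" "m \<in> monoms3 j"
        | (r) q m where "x = Inr (q, m)" "q < e" "m \<in> monoms3 (j - 1)"
        by auto
      then show "c x = 0"
      proof cases
        case l
        then have "U c p = 0" using zero by simp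
        then show ?thesis
          using lookup_sum_monoms3[OF l(3), of "\<lambda>m. c (Inl (p, m))"] l(1) by (simp add: U_def)
      next
        case r
        then have "V c q = 0" using zero by simp
        then show ?thesis
          using lookup_sum_monoms3[OF r(3), of "\<lambda>m. c (Inr (q, m))"] r(1) by (simp add: V_def)
      qed
    qed
    ultimately obtain c where "w = (\<Sum>x\<in>?J. kscale (c x) (b x))"
      using w unfolding j by blast
    then show ?thesis
      unfolding eq by (intro exI[of _ "U c"] exI[of _ "V c"]) (simp add: U_def V_def sum_monoms3_forms)
  qed
  show thesis
    by (rule that[of \<beta>]) (use \<beta> independent spanning in \<open>auto simp: e_def\<close>)
qed

end

section \<open>Coordinates on the Rees algebra of a module\<close>

definition polys_in :: "'v set \<Rightarrow> ('v, 'r::comm_ring_1) mpoly set" where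
  "polys_in V = {p. \<forall>m\<in>keys p. keys m \<subseteq> V}"

lemma mpoly_ring_simps [simp]:
  "carrier (mpoly_ring V) = polys_in V"
  "p \<otimes>\<^bsub>mpoly_ring V\<^esub> q = p * q" "p \<oplus>\<^bsub>mpoly_ring V\<^esub> q = p + q"
  "\<one>\<^bsub>mpoly_ring V\<^esub> = 1" "\<zero>\<^bsub>mpoly_ring V\<^esub> = 0"
  by (simp_all add: mpoly_ring_def ring_of_type_algebra_def polys_in_def)

lemma mconst_polys_in [simp]: "mconst c \<in> polys_in V"
  by (auto simp: mconst_def polys_in_def)

lemma mvar_polys_in: "x \<in> V \<Longrightarrow> mvar x \<in> polys_in V"
  by (auto simp: mvar_def polys_in_def)

lemma add_polys_in: "p \<in> polys_in V \<Longrightarrow> q \<in> polys_in V \<Longrightarrow> p + q \<in> polys_in V"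
  using keys_add[of p q] unfolding polys_in_def by blast

lemma mult_polys_in: "p \<in> polys_in V \<Longrightarrow> q \<in> polys_in V \<Longrightarrow> p * q \<in> polys_in V"
proof -
  assume "p \<in> polys_in V" "q \<in> polys_in V"
  then have pq: "m \<in> keys p \<Longrightarrow> keys m \<subseteq> V"
    "m \<in> keys q \<Longrightarrow> keys m \<subseteq> V" for m by (auto simp: polys_in_def)
  have "keys m \<subseteq> V" if "m \<in> keys (p * q)" for m
  proof -
    obtain m1 m2 where "m = m1 + m2" "m1 \<in> keys p" "m2 \<in> keys q"
      using keys_mult[of p q] \<open>m \<in> _\<close> by blast
    then show ?thesis using keys_add[of m1 m2] pq by blast
  qed
  then show ?thesis unfolding polys_in_def by blast
qed

lemma zero_polys_in [simp]: "0 \<in> polys_in V"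
  and one_polys_in [simp]: "(1 :: ('v, 'r::comm_ring_1) mpoly) \<in> polys_in V"
  using mconst_polys_in[of 0 V] mconst_polys_in[of "1 :: 'r" V] by simp_all

lemma diff_polys_in: "p \<in> polys_in V \<Longrightarrow> q \<in> polys_in V \<Longrightarrow> p - q \<in> polys_in V"
  using add_polys_in[OF _ mult_polys_in[OF mconst_polys_in[of "- 1"]], of p V q]
  by (simp add: mconst_diff[of 0 1, simplified])

lemma ring_mpoly_ring: "ring (mpoly_ring V :: ('v, 'r::comm_ring_1) mpoly ring)"
proof -
  let ?R = "ring_of_type_algebra :: ('v, 'r) mpoly ring"
  interpret ring ?R by (rule ring_from_type_algebra)
  have minus: "\<ominus>\<^bsub>?R\<^esub> p = - p" for p :: "('v, 'r) mpoly"
    by (rule minus_equality) (simp_all add: ring_of_type_algebra_def)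
  have "subring (polys_in V) ?R"
  proof (rule subringI)
    fix p :: "('v, 'r) mpoly" assume p: "p \<in> polys_in V"
    show "\<ominus>\<^bsub>?R\<^esub> p \<in> polys_in V"
      using diff_polys_in[OF zero_polys_in p] unfolding minus by simp
  qed (simp_all add: ring_of_type_algebra_def add_polys_in mult_polys_in)
  from subring_is_ring[OF this] show ?thesis by (simp add: mpoly_ring_def polys_in_def)
qed

lemma a_minus_mpoly_ring:
  assumes "p \<in> polys_in V" "q \<in> polys_in V"
  shows "p \<ominus>\<^bsub>mpoly_ring V\<^esub> q = p - q"
proof -
  interpret ring "mpoly_ring V" by (rule ring_mpoly_ring)
  have "- q \<in> polys_in V" using diff_polys_in[OF zero_polys_in assms(2)] by simp
  then have "\<ominus>\<^bsub>mpoly_ring V\<^esub> q = - q"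
    by (intro minus_equality) (use assms in auto)
  then show ?thesis by (simp add: a_minus_def)
qed

lemma polys_in_induct [consumes 1, case_names mconst mvar add mult]:
  assumes p: "p \<in> polys_in V"
    and const: "\<And>c. P (mconst c)" and var: "\<And>x. x \<in> V \<Longrightarrow> P (mvar x)"
    and add: "\<And>p q. P p \<Longrightarrow> P q \<Longrightarrow> P (p + q)" and mult: "\<And>p q. P p \<Longrightarrow> P q \<Longrightarrow> P (p * q)"
  shows "P (p :: ('v, 'r::comm_ring_1) mpoly)"
proof -
  have zero: "P 0" and one: "P 1" using const[of 0] const[of 1] by simp_all
  have pow: "P (mvar x ^ n)" if "x \<in> V" for x n
    using that by (induction n) (auto intro: one mult var)
  have prod: "P (\<Prod>v\<in>K. mvar v ^ e v)" if "K \<subseteq> V" for K e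
    using that by (induction K rule: infinite_finite_induct) (auto intro: one mult pow)
  have single: "P (single m c)" if "keys m \<subseteq> V" for m c
  proof -
    have "P (mconst c * monom_eval mvar m)"
      unfolding monom_eval_def by (intro mult const prod that)
    then show ?thesis by (simp add: monom_eval_mvar mconst_mult_single)
  qed
  have "P (\<Sum>m\<in>K. single m (lookup p m))"
    if "K \<subseteq> keys p" "finite K" for K
    using that(2,1) by induction (use p in \<open>auto simp: polys_in_def intro!: zero add single\<close>)
  from this[of "keys p"] show ?thesis by (simp add: sum_single_lookup)
qed

lemma polys_in_UNIV [simp]: "p \<in> polys_in UNIV"
  by (simp add: polys_in_def)

lemma meval_polys_in:
  assumes "coefficient_hom f" "\<And>c. f c \<in> polys_in V" "\<And>v. v \<in> W \<Longrightarrow> g v \<in> polys_in V" "p \<in> polys_in W"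
  shows "meval f g p \<in> polys_in V"
proof -
  interpret coefficient_hom f by fact
  show ?thesis
    using assms(4) by (induction p rule: polys_in_induct)
      (simp_all add: meval_mconst meval_mvar meval_add meval_mult assms add_polys_in mult_polys_in)
qed

text \<open>A faithful linear map \<open>L\<close> from the module \<open>M\<close> to the linear forms in \<open>w_1, w_2\<close> whose image contains
  nonzero multiples \<open>h w_i\<close>. The denominator \<open>h\<close> is needed for \<open>E\<close>, which is smaller than its bidual.\<close>

locale rees_model =
  fixes M :: "('r::idom, 'm) module" and L :: "'m \<Rightarrow> (2, 'r) mpoly" and h :: 'r and e :: "2 \<Rightarrow> 'm"
  assumes add_closed: "x \<in> carrier M \<Longrightarrow> y \<in> carrier M \<Longrightarrow> x \<oplus>\<^bsub>M\<^esub> y \<in> carrier M"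
    and smult_closed: "x \<in> carrier M \<Longrightarrow> r \<odot>\<^bsub>M\<^esub> x \<in> carrier M"
    and L_add: "x \<in> carrier M \<Longrightarrow> y \<in> carrier M \<Longrightarrow> L (x \<oplus>\<^bsub>M\<^esub> y) = L x + L y"
    and L_smult: "x \<in> carrier M \<Longrightarrow> L (r \<odot>\<^bsub>M\<^esub> x) = mconst r * L x"
    and L_inj: "x \<in> carrier M \<Longrightarrow> y \<in> carrier M \<Longrightarrow> L x = L y \<Longrightarrow> x = y"
    and L_linear: "x \<in> carrier M \<Longrightarrow> \<exists>c. L x = (\<Sum>i\<in>UNIV. mconst (c i) * mvar i)"
    and h_nonzero: "h \<noteq> 0"
    and e_closed: "e i \<in> carrier M"
    and L_e: "L (e i) = mconst h * mvar i"
begin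

abbreviation "P \<equiv> polys_in (carrier M) :: ('m, 'r) mpoly set"

definition \<pi> :: "('m, 'r) mpoly \<Rightarrow> (2, 'r) mpoly" where
  "\<pi> = meval mconst L"

sublocale \<pi>: coefficient_hom \<pi>
  unfolding \<pi>_def by (rule mconst.coefficient_hom_meval)

lemma \<pi>_mconst [simp]: "\<pi> (mconst r) = mconst r"
  by (simp add: \<pi>_def mconst.meval_mconst)

lemma \<pi>_mvar [simp]: "\<pi> (mvar x) = L x"
  by (simp add: \<pi>_def mconst.meval_mvar)

lemma \<pi>_diff: "\<pi> (p - q) = \<pi> p - \<pi> q"
  by (simp add: \<pi>_def mconst.meval_diff)

definition relations :: "('m, 'r) mpoly set" where
  "relations = {mvar (x \<oplus>\<^bsub>M\<^esub> y) - (mvar x + mvar y) | x y. x \<in> carrier M \<and> y \<in> carrier M} \<union>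
      {mvar (r \<odot>\<^bsub>M\<^esub> x) - mconst r * mvar x | r x. x \<in> carrier M}"

lemma relations_subset: "relations \<subseteq> P"
proof -
  have "mvar (x \<oplus>\<^bsub>M\<^esub> y) - (mvar x + mvar y) \<in> P" if "x \<in> carrier M" "y \<in> carrier M" for x y
    using that by (intro diff_polys_in add_polys_in mvar_polys_in add_closed)
  moreover have "mvar (r \<odot>\<^bsub>M\<^esub> x) - mconst r * mvar x \<in> P" if "x \<in> carrier M" for x r
    using that by (intro diff_polys_in mult_polys_in mconst_polys_in mvar_polys_in smult_closed)
  ultimately show ?thesis unfolding relations_def by blast
qed

lemma sym_ideal_eq: "sym_ideal M = genideal (mpoly_ring (carrier M)) relations"
  by (simp add: sym_ideal_def relations_def)

lemma ideal_sym_ideal: "ideal (sym_ideal M) (mpoly_ring (carrier M))"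
  unfolding sym_ideal_eq by (rule ring.genideal_ideal[OF ring_mpoly_ring]) (use relations_subset in simp)

lemma sym_ideal_add: "p \<in> sym_ideal M \<Longrightarrow> q \<in> sym_ideal M \<Longrightarrow> p + q \<in> sym_ideal M"
  using additive_subgroup.a_closed[OF ideal.axioms(1)[OF ideal_sym_ideal], of p q] by simp

lemma sym_ideal_mult: "p \<in> P \<Longrightarrow> q \<in> sym_ideal M \<Longrightarrow> p * q \<in> sym_ideal M"
  using ideal.I_l_closed[OF ideal_sym_ideal, of q p] by simp

lemma relations_in_sym_ideal: "relations \<subseteq> sym_ideal M"
  unfolding sym_ideal_eq by (rule ring.genideal_self[OF ring_mpoly_ring]) (use relations_subset in simp)

lemma zero_sym_ideal: "0 \<in> sym_ideal M"
  using additive_subgroup.zero_closed[OF ideal.axioms(1)[OF ideal_sym_ideal]] by simp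

definition kernel_poly :: "('m, 'r) mpoly set" where
  "kernel_poly = {p \<in> P. \<pi> p = 0}"

lemma ideal_kernel_poly: "ideal kernel_poly (mpoly_ring (carrier M))"
proof -
  have "ring_hom_ring (mpoly_ring (carrier M)) ring_of_type_algebra \<pi>"
    by (intro ring_hom_ringI2 ring_hom_memI ring_mpoly_ring ring_from_type_algebra)
      (simp_all add: ring_of_type_algebra_def \<pi>.hom_mult \<pi>.hom_add \<pi>.hom_one)
  from ring_hom_ring.kernel_is_ideal[OF this] show ?thesis
    by (simp add: a_kernel_def' kernel_poly_def ring_of_type_algebra_def)
qed

lemma sym_ideal_le_kernel: "sym_ideal M \<subseteq> kernel_poly"
  unfolding sym_ideal_eq
proof (rule ring.genideal_minimal[OF ring_mpoly_ring ideal_kernel_poly])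
  show "relations \<subseteq> kernel_poly"
  proof
    fix p assume p: "p \<in> relations"
    then have "\<pi> p = 0"
      by (auto simp: relations_def \<pi>_diff \<pi>.hom_add \<pi>.hom_mult L_add L_smult)
    then show "p \<in> kernel_poly" using p relations_subset by (auto simp: kernel_poly_def)
  qed
qed

text \<open>Each generator times \<open>h\<close> is a linear combination of the two elements \<open>e\<close>, and the property is
  preserved by sums and products.\<close>

lemma reduce_to_two_variables:
  assumes "p \<in> P"
  shows "\<exists>N Q. mconst (h ^ N) * p - meval mconst (\<lambda>i. mvar (e i)) Q \<in> sym_ideal M"
proof -
  let ?E = "meval mconst (\<lambda>i. mvar (e i)) :: (2, 'r) mpoly \<Rightarrow> _"
  have E: "?E Q \<in> P" for Q by (rule meval_polys_in[OF coefficient_hom_mconst, where W = UNIV])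
      (simp_all add: mvar_polys_in e_closed)
  have "p \<in> P \<and> (\<exists>N Q. mconst (h ^ N) * p - ?E Q \<in> sym_ideal M)"
    using assms
  proof (induction p rule: polys_in_induct)
    case (mconst c)
    show ?case
      using zero_sym_ideal
      by (auto intro!: exI[of _ 0] exI[of _ "mconst c"] simp: mconst.meval_mconst)
  next
    case (mvar x)
    obtain c where c: "L x = (\<Sum>i\<in>UNIV. mconst (c i) * mvar i)" using L_linear[OF mvar] by blast
    let ?y = "c 1 \<odot>\<^bsub>M\<^esub> e 1" and ?z = "c 2 \<odot>\<^bsub>M\<^esub> e 2"
    have closed: "?y \<in> carrier M" "?z \<in> carrier M" by (intro smult_closed e_closed)+
    \<comment> \<open>Injectivity of \<open>L\<close> turns the coordinates of \<open>L x\<close> into an identity in the module.\<close>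
    have "h \<odot>\<^bsub>M\<^esub> x = ?y \<oplus>\<^bsub>M\<^esub> ?z"
    proof (rule L_inj)
      show "L (h \<odot>\<^bsub>M\<^esub> x) = L (?y \<oplus>\<^bsub>M\<^esub> ?z)"
        by (simp add: L_smult[OF mvar] L_add[OF closed] L_smult[OF e_closed] L_e c sum_2 algebra_simps)
    qed (use closed mvar in \<open>auto intro: smult_closed add_closed\<close>)
    moreover have "mvar (h \<odot>\<^bsub>M\<^esub> x) - mconst h * mvar x \<in> sym_ideal M"
      "mvar (?y \<oplus>\<^bsub>M\<^esub> ?z) - (mvar ?y + mvar ?z) \<in> sym_ideal M"
      "mvar ?y - mconst (c 1) * mvar (e 1) \<in> sym_ideal M" "mvar ?z - mconst (c 2) * mvar (e 2) \<in> sym_ideal M"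
      using relations_in_sym_ideal mvar closed e_closed unfolding relations_def by blast+
    ultimately have "(mvar ?y - mconst (c 1) * mvar (e 1)) + (mvar ?z - mconst (c 2) * mvar (e 2))
        + (mvar (?y \<oplus>\<^bsub>M\<^esub> ?z) - (mvar ?y + mvar ?z)) + mconst (- 1) * (mvar (?y \<oplus>\<^bsub>M\<^esub> ?z) - mconst h * mvar x) \<in> sym_ideal M"
      by (intro sym_ideal_add sym_ideal_mult mconst_polys_in) simp_all
    also have "(mvar ?y - mconst (c 1) * mvar (e 1)) + (mvar ?z - mconst (c 2) * mvar (e 2))
        + (mvar (?y \<oplus>\<^bsub>M\<^esub> ?z) - (mvar ?y + mvar ?z)) + mconst (- 1) * (mvar (?y \<oplus>\<^bsub>M\<^esub> ?z) - mconst h * mvar x)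
      = mconst (h ^ 1) * mvar x - ?E (mconst (c 1) * mvar 1 + mconst (c 2) * mvar 2)"
      by (simp add: mconst.meval_add mconst.meval_mult mconst.meval_mconst mconst.meval_mvar mconst_diff[of 0 1, simplified])
    finally show ?case using mvar_polys_in[OF mvar] by blast
  next
    case (add p q)
    then obtain N Q N' Q' where a: "mconst (h ^ N) * p - ?E Q \<in> sym_ideal M" "mconst (h ^ N') * q - ?E Q' \<in> sym_ideal M"
      by blast
    have "mconst (h ^ N') * (mconst (h ^ N) * p - ?E Q) + mconst (h ^ N) * (mconst (h ^ N') * q - ?E Q') \<in> sym_ideal M"
      by (intro sym_ideal_add sym_ideal_mult mconst_polys_in a)
    also have "mconst (h ^ N') * (mconst (h ^ N) * p - ?E Q) + mconst (h ^ N) * (mconst (h ^ N') * q - ?E Q')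
      = mconst (h ^ (N + N')) * (p + q) - ?E (mconst (h ^ N') * Q + mconst (h ^ N) * Q')"
      by (simp add: mconst.meval_add mconst.meval_mult mconst.meval_mconst power_add mconst_mult algebra_simps)
    finally show ?case using add add_polys_in by blast
  next
    case (mult p q)
    then obtain N Q N' Q' where a: "mconst (h ^ N) * p - ?E Q \<in> sym_ideal M" "mconst (h ^ N') * q - ?E Q' \<in> sym_ideal M"
      by blast
    have "(mconst (h ^ N) * p) * (mconst (h ^ N') * q - ?E Q') + ?E Q' * (mconst (h ^ N) * p - ?E Q) \<in> sym_ideal M"
      using mult by (intro sym_ideal_add sym_ideal_mult mult_polys_in mconst_polys_in E a) auto
    also have "(mconst (h ^ N) * p) * (mconst (h ^ N') * q - ?E Q') + ?E Q' * (mconst (h ^ N) * p - ?E Q)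
      = mconst (h ^ (N + N')) * (p * q) - ?E (Q * Q')"
      by (simp add: mconst.meval_mult power_add mconst_mult algebra_simps)
    finally show ?case using mult mult_polys_in by blast
  qed
  then show ?thesis by blast
qed

text \<open>A polynomial in the \<open>h w_i\<close> vanishes only if it is zero, since its coefficients are those of the
  polynomial in the \<open>w_i\<close> times powers of \<open>h\<close>.\<close>

lemma kernel_is_torsion:
  assumes "p \<in> P" "\<pi> p = 0"
  shows "\<exists>r. r \<noteq> 0 \<and> mconst r * p \<in> sym_ideal M"
proof -
  let ?E = "meval mconst (\<lambda>i. mvar (e i)) :: (2, 'r) mpoly \<Rightarrow> _"
  obtain N Q where NQ: "mconst (h ^ N) * p - ?E Q \<in> sym_ideal M"
    using reduce_to_two_variables[OF assms(1)] by blast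
  then have "\<pi> (mconst (h ^ N) * p - ?E Q) = 0"
    using sym_ideal_le_kernel by (auto simp: kernel_poly_def)
  then have "\<pi> (?E Q) = 0" by (simp add: \<pi>_diff \<pi>.hom_mult assms(2))
  moreover have "\<pi> (?E Q) = meval mconst (\<lambda>i. mconst h * mvar i) Q"
    using meval_comp[OF coefficient_hom_mconst \<pi>.coefficient_hom_axioms, of "\<lambda>i. mvar (e i)" Q] by (simp add: L_e)
  moreover have "lookup (meval mconst (\<lambda>i. mconst h * mvar i) Q) \<mu> = h ^ mdegree \<mu> * lookup Q \<mu>" for \<mu>
  proof (induction Q rule: poly_mapping_single_add_induct)
    case (2 m c)
    have "monom_eval (\<lambda>i. mconst h * mvar i) m = (mconst (h ^ mdegree m) * monom_eval mvar m :: (2, 'r) mpoly)"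
      by (simp add: monom_eval2 mdegree2 power_mult_distrib power_add mconst_mult mconst_power mult_ac)
    then show ?case by (auto simp: mconst.meval_single monom_eval_mvar lookup_single when_def)
  qed (simp_all add: mconst.meval_add lookup_add algebra_simps)
  ultimately have "h ^ mdegree \<mu> * lookup Q \<mu> = 0" for \<mu> by (metis lookup_zero)
  then have "Q = 0" by (intro poly_mapping_eqI) (simp add: h_nonzero)
  then have "mconst (h ^ N) * p \<in> sym_ideal M" using NQ by simp
  then show ?thesis using h_nonzero by (intro exI[of _ "h ^ N"]) simp
qed

lemma ring_sym_alg: "ring (sym_alg M)"
  unfolding sym_alg_def by (rule ideal.quotient_is_ring[OF ideal_sym_ideal])

lemma sym_class_hom: "sym_class M \<in> ring_hom (mpoly_ring (carrier M)) (sym_alg M)"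
  unfolding sym_alg_def using ideal.rcos_ring_hom[OF ideal_sym_ideal] by (simp add: sym_class_def[abs_def])

lemma carrier_sym_alg: "carrier (sym_alg M) = sym_class M ` P"
  by (auto simp: sym_alg_def FactRing_def A_RCOSETS_def' sym_class_def)

lemma sym_class_zero_iff: "p \<in> P \<Longrightarrow> sym_class M p = \<zero>\<^bsub>sym_alg M\<^esub> \<longleftrightarrow> p \<in> sym_ideal M"
proof -
  assume p: "p \<in> P"
  interpret ring "mpoly_ring (carrier M)" by (rule ring_mpoly_ring)
  have "sym_class M 0 = \<zero>\<^bsub>sym_alg M\<^esub>"
    using ring_hom_zero[OF sym_class_hom ring_mpoly_ring ring_sym_alg] by simp
  moreover have "p \<ominus>\<^bsub>mpoly_ring (carrier M)\<^esub> 0 \<in> sym_ideal M \<longleftrightarrow> sym_class M p = sym_class M 0"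
    using quotient_eq_iff_same_a_r_cos[OF ideal_sym_ideal, of p 0] p by (simp add: sym_class_def)
  moreover have "p \<ominus>\<^bsub>mpoly_ring (carrier M)\<^esub> 0 = p - 0"
    using p by (intro a_minus_mpoly_ring) auto
  ultimately show ?thesis by simp
qed

lemma sym_torsion_eq: "sym_torsion M = sym_class M ` kernel_poly"
proof (intro equalityI subsetI)
  fix A assume "A \<in> sym_torsion M"
  then obtain r where r: "\<forall>s. r * s = 0 \<longrightarrow> s = 0" "A \<in> carrier (sym_alg M)"
    "sym_class M (mconst r) \<otimes>\<^bsub>sym_alg M\<^esub> A = \<zero>\<^bsub>sym_alg M\<^esub>" by (auto simp: sym_torsion_def)
  then obtain p where p: "p \<in> P" "A = sym_class M p" by (auto simp: carrier_sym_alg)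
  have r0: "r \<noteq> 0" using r(1)[rule_format, of 1] by auto
  have "sym_class M (mconst r * p) = \<zero>\<^bsub>sym_alg M\<^esub>"
    using ring_hom_mult[OF sym_class_hom, of "mconst r" p] r(3) p by simp
  then have "mconst r * p \<in> sym_ideal M"
    using sym_class_zero_iff mult_polys_in[OF mconst_polys_in p(1)] by blast
  then have "mconst r * \<pi> p = 0" using sym_ideal_le_kernel by (auto simp: kernel_poly_def \<pi>.hom_mult)
  then show "A \<in> sym_class M ` kernel_poly" using p r0 by (auto simp: kernel_poly_def)
next
  fix A assume "A \<in> sym_class M ` kernel_poly"
  then obtain p where p: "p \<in> P" "\<pi> p = 0" "A = sym_class M p" by (auto simp: kernel_poly_def)
  then obtain r where r: "r \<noteq> 0" "mconst r * p \<in> sym_ideal M" using kernel_is_torsion by blast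
  then have "sym_class M (mconst r) \<otimes>\<^bsub>sym_alg M\<^esub> A = \<zero>\<^bsub>sym_alg M\<^esub>"
    using ring_hom_mult[OF sym_class_hom, of "mconst r" p] p
      sym_class_zero_iff[OF mult_polys_in[OF mconst_polys_in p(1)], of r] by simp
  then show "A \<in> sym_torsion M"
    using r(1) p by (auto simp: sym_torsion_def carrier_sym_alg intro!: exI[of _ r])
qed

lemma ideal_sym_torsion: "ideal (sym_torsion M) (sym_alg M)"
  unfolding sym_torsion_eq sym_alg_def
  using ring.ring_ideal_imp_quot_ideal[OF ring_mpoly_ring ideal_sym_ideal ideal_kernel_poly]
  by (simp add: sym_class_def[abs_def])

lemma ring_rees: "ring (rees M)"
  unfolding rees_def by (rule ideal.quotient_is_ring[OF ideal_sym_torsion])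

lemma rees_class_hom: "rees_class M \<in> ring_hom (mpoly_ring (carrier M)) (rees M)"
proof -
  have "(\<lambda>A. sym_torsion M +>\<^bsub>sym_alg M\<^esub> A) \<circ> sym_class M \<in> ring_hom (mpoly_ring (carrier M)) (rees M)"
    unfolding rees_def by (rule ring_hom_trans[OF sym_class_hom ideal.rcos_ring_hom[OF ideal_sym_torsion]])
  then show ?thesis by (simp add: rees_class_def[abs_def] comp_def)
qed

lemma rees_class_mult: "p \<in> P \<Longrightarrow> q \<in> P \<Longrightarrow> rees_class M (p * q) = rees_class M p \<otimes>\<^bsub>rees M\<^esub> rees_class M q"
  using ring_hom_mult[OF rees_class_hom, of p q] by simp

lemma rees_class_add: "p \<in> P \<Longrightarrow> q \<in> P \<Longrightarrow> rees_class M (p + q) = rees_class M p \<oplus>\<^bsub>rees M\<^esub> rees_class M q"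
  using ring_hom_add[OF rees_class_hom, of p q] by simp

lemma rees_class_zero: "rees_class M 0 = \<zero>\<^bsub>rees M\<^esub>"
  using ring_hom_zero[OF rees_class_hom ring_mpoly_ring ring_rees] by simp

lemma rees_class_one: "rees_class M 1 = \<one>\<^bsub>rees M\<^esub>"
  using ring_hom_one[OF rees_class_hom] by simp

lemma carrier_rees: "carrier (rees M) = rees_class M ` P"
proof -
  have "carrier (rees M) = (\<lambda>A. sym_torsion M +>\<^bsub>sym_alg M\<^esub> A) ` carrier (sym_alg M)"
    by (auto simp: rees_def FactRing_def A_RCOSETS_def')
  then show ?thesis by (simp add: carrier_sym_alg image_image rees_class_def)
qed

text \<open>Polynomials that agree in \<open>R[w_1, w_2]\<close> differ by torsion of the symmetric algebra, and conversely
  torsion dies there because \<open>R[w_1, w_2]\<close> is a domain.\<close>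

theorem rees_class_eq_iff:
  assumes "p \<in> P" "q \<in> P"
  shows "rees_class M p = rees_class M q \<longleftrightarrow> \<pi> p = \<pi> q"
proof -
  interpret S: ring "sym_alg M" by (rule ring_sym_alg)
  have hom: "ring_hom_ring (mpoly_ring (carrier M)) (sym_alg M) (sym_class M)"
    by (intro ring_hom_ringI2 ring_mpoly_ring ring_sym_alg sym_class_hom)
  have carr: "sym_class M p \<in> carrier (sym_alg M)" "sym_class M q \<in> carrier (sym_alg M)"
    using assms by (auto simp: carrier_sym_alg)
  have sub: "sym_class M (p - q) = sym_class M p \<ominus>\<^bsub>sym_alg M\<^esub> sym_class M q"
  proof -
    have "sym_class M p = sym_class M (p - q) \<oplus>\<^bsub>sym_alg M\<^esub> sym_class M q"
      using ring_hom_add[OF sym_class_hom, of "p - q" q] assms diff_polys_in[OF assms] by simp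
    moreover have "sym_class M (p - q) \<in> carrier (sym_alg M)"
      using diff_polys_in[OF assms] by (auto simp: carrier_sym_alg)
    ultimately show ?thesis
      using carr by (metis S.add.inv_solve_right' a_minus_def)
  qed
  have "rees_class M p = rees_class M q \<longleftrightarrow> sym_class M (p - q) \<in> sym_torsion M"
    using S.quotient_eq_iff_same_a_r_cos[OF ideal_sym_torsion carr] by (simp add: rees_class_def sub)
  also have "\<dots> \<longleftrightarrow> \<pi> p = \<pi> q"
  proof
    assume "sym_class M (p - q) \<in> sym_torsion M"
    then obtain k where k: "k \<in> kernel_poly" "sym_class M (p - q) = sym_class M k"
      by (auto simp: sym_torsion_eq)
    interpret ring "mpoly_ring (carrier M)" by (rule ring_mpoly_ring)
    have kP: "k \<in> P" using k(1) by (simp add: kernel_poly_def)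
    have "p - q \<ominus>\<^bsub>mpoly_ring (carrier M)\<^esub> k \<in> sym_ideal M"
      using quotient_eq_iff_same_a_r_cos[OF ideal_sym_ideal, of "p - q" k] k(2) kP diff_polys_in[OF assms]
      by (simp add: sym_class_def)
    then have "p - q - k \<in> sym_ideal M"
      using a_minus_mpoly_ring[OF diff_polys_in[OF assms] kP] by simp
    then have "\<pi> (p - q - k) = 0" using sym_ideal_le_kernel by (auto simp: kernel_poly_def)
    then show "\<pi> p = \<pi> q" using k(1) by (simp add: \<pi>_diff kernel_poly_def)
  next
    assume "\<pi> p = \<pi> q"
    then show "sym_class M (p - q) \<in> sym_torsion M"
      using diff_polys_in[OF assms] by (auto simp: sym_torsion_eq kernel_poly_def \<pi>_diff)
  qed
  finally show ?thesis .
qed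

text \<open>The embedding of the Rees algebra into \<open>R[w_1, w_2]\<close>.\<close>

definition model :: "('m, 'r) mpoly set set \<Rightarrow> (2, 'r) mpoly" where
  "model A = \<pi> (SOME p. p \<in> P \<and> rees_class M p = A)"

lemma model_rees_class: "p \<in> P \<Longrightarrow> model (rees_class M p) = \<pi> p"
proof -
  assume p: "p \<in> P"
  let ?q = "SOME q. q \<in> P \<and> rees_class M q = rees_class M p"
  have "?q \<in> P \<and> rees_class M ?q = rees_class M p"
    by (rule someI[of _ p]) (simp add: p)
  then have "\<pi> ?q = \<pi> p" using rees_class_eq_iff[of ?q p] p by blast
  then show ?thesis by (simp only: model_def)
qed

lemma carrier_reesE:
  assumes "A \<in> carrier (rees M)"
  obtains p where "p \<in> P" "A = rees_class M p"
  using assms unfolding carrier_rees by blast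

lemma model_inj:
  assumes "A \<in> carrier (rees M)" "B \<in> carrier (rees M)" "model A = model B"
  shows "A = B"
proof -
  obtain p q where pq: "p \<in> P" "A = rees_class M p" "q \<in> P" "B = rees_class M q"
    using assms(1,2) by (meson carrier_reesE)
  then have "\<pi> p = \<pi> q" using assms(3) by (simp only: model_rees_class)
  then show ?thesis using rees_class_eq_iff[OF pq(1,3)] pq(2,4) by blast
qed

lemma model_mult:
  assumes "A \<in> carrier (rees M)" "B \<in> carrier (rees M)"
  shows "model (A \<otimes>\<^bsub>rees M\<^esub> B) = model A * model B"
proof -
  obtain p q where pq: "p \<in> P" "A = rees_class M p" "q \<in> P" "B = rees_class M q"
    using assms by (meson carrier_reesE)
  then have "A \<otimes>\<^bsub>rees M\<^esub> B = rees_class M (p * q)" by (simp only: rees_class_mult)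
  then show ?thesis by (simp only: pq model_rees_class mult_polys_in \<pi>.hom_mult)
qed

lemma model_add:
  assumes "A \<in> carrier (rees M)" "B \<in> carrier (rees M)"
  shows "model (A \<oplus>\<^bsub>rees M\<^esub> B) = model A + model B"
proof -
  obtain p q where pq: "p \<in> P" "A = rees_class M p" "q \<in> P" "B = rees_class M q"
    using assms by (meson carrier_reesE)
  then have "A \<oplus>\<^bsub>rees M\<^esub> B = rees_class M (p + q)" by (simp only: rees_class_add)
  then show ?thesis by (simp only: pq model_rees_class add_polys_in \<pi>.hom_add)
qed

lemma model_zero: "model \<zero>\<^bsub>rees M\<^esub> = 0"
  using model_rees_class[OF zero_polys_in] by (simp add: rees_class_zero \<pi>.hom_zero)

lemma model_a_inv: "A \<in> carrier (rees M) \<Longrightarrow> model (\<ominus>\<^bsub>rees M\<^esub> A) = - model A"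
proof -
  interpret ring "rees M" by (rule ring_rees)
  assume A: "A \<in> carrier (rees M)"
  then have "model A + model (\<ominus>\<^bsub>rees M\<^esub> A) = 0"
    using model_add[of A "\<ominus>\<^bsub>rees M\<^esub> A"] by (simp add: r_neg model_zero)
  then show ?thesis by (simp add: eq_neg_iff_add_eq_0 add.commute)
qed

end

locale graded_rees_model = rees_model M L h e
  for M :: "((2, 'k::field) mpoly, 'm) module" and L h e +
  fixes G :: "int \<Rightarrow> 'm set"
  assumes G_subset: "G b \<subseteq> carrier M"
begin

lemma mvar_in_carrier: "x \<in> G b \<Longrightarrow> rees_class M (mvar x) \<in> carrier (rees M)"
  using G_subset by (auto simp: carrier_rees intro!: mvar_polys_in)

lemma model_mvar: "x \<in> G b \<Longrightarrow> model (rees_class M (mvar x)) = L x"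
  using G_subset model_rees_class[OF mvar_polys_in] by auto

lemma mconst_in_carrier: "rees_class M (mconst r) \<in> carrier (rees M)"
  by (auto simp: carrier_rees)

lemma model_mconst: "model (rees_class M (mconst r)) = mconst r"
  using model_rees_class[OF mconst_polys_in] by simp

lemma part_in_carrier: "A \<in> rees_part M G i j \<Longrightarrow> A \<in> carrier (rees M)"
proof -
  interpret R: ring "rees M" by (rule ring_rees)
  have "A \<in> carrier (rees M)" if "rees_bihomogeneous M G i j A" for i j A
    using that by induction (auto intro: mconst_in_carrier mvar_in_carrier)
  then show "A \<in> rees_part M G i j \<Longrightarrow> A \<in> carrier (rees M)" by (simp add: rees_part_def)
qed

text \<open>An upper bound for a bigraded piece: it suffices that the candidates are closed under the operations
  that generate the pieces.\<close>

lemma model_part_subset: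
  assumes zero: "\<And>i j. 0 \<in> B i j" and const: "\<And>i r. r \<in> forms i \<Longrightarrow> mconst r \<in> B i 0"
    and times: "\<And>i j b p x. p \<in> B i j \<Longrightarrow> x \<in> G b \<Longrightarrow> p * L x \<in> B (i + b) (j + 1)"
    and add: "\<And>i j p q. p \<in> B i j \<Longrightarrow> q \<in> B i j \<Longrightarrow> p + q \<in> B i j"
  shows "model ` rees_part M G i j \<subseteq> B i j"
proof -
  have "model A \<in> B i j" if "rees_bihomogeneous M G i j A" for i j A
    using that
  proof induction
    case (times_gen i j a x b)
    then show ?case
      using model_mult[of a "rees_class M (mvar x)"] part_in_carrier times mvar_in_carrier model_mvar
      by (simp add: rees_part_def)
  next
    case (add i j a b)
    then show ?case using model_add[of a b] part_in_carrier assms(4) by (simp add: rees_part_def)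
  qed (simp_all add: model_zero model_mconst zero const)
  then show ?thesis by (auto simp: rees_part_def)
qed

lemma zero_in_part: "0 \<in> model ` rees_part M G i j"
  using rees_bihomogeneous.zero[of M G i j] model_zero by (force simp: rees_part_def)

lemma mconst_in_part: "r \<in> forms i \<Longrightarrow> mconst r \<in> model ` rees_part M G i 0"
proof -
  assume "r \<in> forms i"
  then have "rees_class M (mconst r) \<in> rees_part M G i 0"
    by (simp add: rees_part_def rees_bihomogeneous.const)
  from imageI[OF this, of model] show ?thesis by (simp add: model_mconst)
qed

lemma add_in_part:
  assumes "p \<in> model ` rees_part M G i j" "q \<in> model ` rees_part M G i j"
  shows "p + q \<in> model ` rees_part M G i j"
proof -
  obtain A B where AB: "A \<in> rees_part M G i j" "p = model A" "B \<in> rees_part M G i j" "q = model B"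
    using assms by blast
  then have "A \<oplus>\<^bsub>rees M\<^esub> B \<in> rees_part M G i j"
    by (simp add: rees_part_def rees_bihomogeneous.add)
  then show ?thesis
    using model_add[OF part_in_carrier[OF AB(1)] part_in_carrier[OF AB(3)]] AB(2,4)
    by (metis imageI)
qed

lemma times_in_part:
  assumes "p \<in> model ` rees_part M G i j" "x \<in> G b"
  shows "p * L x \<in> model ` rees_part M G (i + b) (j + 1)"
proof -
  obtain A where A: "A \<in> rees_part M G i j" "p = model A" using assms by blast
  then have "A \<otimes>\<^bsub>rees M\<^esub> rees_class M (mvar x) \<in> rees_part M G (i + b) (j + 1)"
    using assms(2) by (simp add: rees_part_def rees_bihomogeneous.times_gen)
  then show ?thesis
    using model_mult[OF part_in_carrier[OF A(1)] mvar_in_carrier[OF assms(2)]] A(2) model_mvar[OF assms(2)]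
    by (metis imageI)
qed

text \<open>A lower bound for a bigraded piece: it contains the monomials in homogeneous module elements.\<close>

lemma times_prod_in_part:
  assumes "p \<in> model ` rees_part M G i j" "finite K" "\<And>v. v \<in> K \<Longrightarrow> x v \<in> G (b v)"
  shows "p * (\<Prod>v\<in>K. L (x v) ^ n v) \<in> model ` rees_part M G (i + (\<Sum>v\<in>K. int (n v) * b v)) (j + int (\<Sum>v\<in>K. n v))"
  using assms(2,3)
proof (induction K)
  case (insert v K)
  have "p * (\<Prod>v\<in>K. L (x v) ^ n v) * L (x v) ^ k
      \<in> model ` rees_part M G (i + (\<Sum>v\<in>K. int (n v) * b v) + int k * b v) (j + int (\<Sum>v\<in>K. n v) + int k)" for k
  proof (induction k)
    case 0
    then show ?case using insert by simp
  next
    case (Suc k)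
    then show ?case
      using times_in_part[OF Suc, of "x v" "b v"] insert.prems by (simp add: algebra_simps)
  qed
  from this[of "n v"] show ?case using insert.hyps by (simp add: algebra_simps)
qed (use assms(1) in simp)

lemma row_in_carrier: "A \<in> rees_row M G i \<Longrightarrow> A \<in> carrier (rees M)"
proof -
  interpret R: ring "rees M" by (rule ring_rees)
  assume "A \<in> rees_row M G i"
  then show ?thesis unfolding rees_row_def
  proof induction
    case (inv h)
    then have "h \<in> carrier (rees M)" using part_in_carrier by blast
    then show ?case using R.a_inv_closed[of h] by (simp add: a_inv_def)
  qed (auto intro: part_in_carrier)
qed

lemma part_subset_row: "rees_part M G i j \<subseteq> rees_row M G i"
  unfolding rees_row_def by (auto intro: generate.incl)

lemma add_in_row:
  assumes "p \<in> model ` rees_row M G i" "q \<in> model ` rees_row M G i"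
  shows "p + q \<in> model ` rees_row M G i"
proof -
  obtain A B where AB: "A \<in> rees_row M G i" "p = model A" "B \<in> rees_row M G i" "q = model B"
    using assms by blast
  then have "A \<oplus>\<^bsub>rees M\<^esub> B \<in> rees_row M G i"
    using generate.eng[of A "add_monoid (rees M)" _ B] by (simp add: rees_row_def)
  then show ?thesis
    using model_add[OF row_in_carrier[OF AB(1)] row_in_carrier[OF AB(3)]] AB(2,4)
    by (metis imageI)
qed

text \<open>The row is generated by its bigraded pieces, so it is any additive group that contains them and is
  spanned by them.\<close>

lemma model_row:
  assumes zero: "0 \<in> W" and add: "\<And>p q. p \<in> W \<Longrightarrow> q \<in> W \<Longrightarrow> p + q \<in> W" and uminus: "\<And>p. p \<in> W \<Longrightarrow> - p \<in> W"
    and part: "\<And>j. model ` rees_part M G i j \<subseteq> W"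
    and split: "\<And>w. w \<in> W \<Longrightarrow> \<exists>J f. w = (\<Sum>j\<le>J::nat. f j) \<and> (\<forall>j. f j \<in> model ` rees_part M G i (int j))"
  shows "model ` rees_row M G i = W"
proof (intro equalityI subsetI)
  interpret R: ring "rees M" by (rule ring_rees)
  fix w assume "w \<in> model ` rees_row M G i"
  then obtain A where A: "A \<in> rees_row M G i" "w = model A" by blast
  have "model A \<in> W" using A(1) unfolding rees_row_def
  proof induction
    case one
    then show ?case by (simp add: model_zero zero)
  next
    case (incl h)
    then show ?case using part by blast
  next
    case (inv h)
    then have "h \<in> carrier (rees M)" "model h \<in> W" using part_in_carrier part by blast+
    then show ?case using model_a_inv[of h] uminus by (simp add: a_inv_def)
  next
    case (eng h1 h2)
    then have "h1 \<in> carrier (rees M)" "h2 \<in> carrier (rees M)"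
      using row_in_carrier unfolding rees_row_def by blast+
    then show ?case using eng model_add[of h1 h2] add by simp
  qed
  then show "w \<in> W" using A(2) by simp
next
  fix w assume "w \<in> W"
  then obtain J f where f: "w = (\<Sum>j\<le>J::nat. f j)" "\<And>j. f j \<in> model ` rees_part M G i (int j)"
    using split by blast
  have "(\<Sum>j\<le>J. f j) \<in> model ` rees_row M G i" for J :: nat
  proof (induction J)
    case 0
    then show ?case using f(2)[of 0] part_subset_row by fastforce
  next
    case (Suc J)
    then show ?case using f(2)[of "Suc J"] part_subset_row add_in_row by fastforce
  qed
  then show "w \<in> model ` rees_row M G i" using f(1) by simp
qed

end

section \<open>Comparing the two Rees algebras\<close>

context graded_rees_model
begin

lemma part_iff: "A \<in> rees_part M G i j \<longleftrightarrow> A \<in> carrier (rees M) \<and> model A \<in> model ` rees_part M G i j"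
proof (intro iffI conjI)
  assume "A \<in> carrier (rees M) \<and> model A \<in> model ` rees_part M G i j"
  then obtain B where "B \<in> rees_part M G i j" "model A = model B" "A \<in> carrier (rees M)" by blast
  then show "A \<in> rees_part M G i j" using model_inj[of A B] part_in_carrier by blast
qed (use part_in_carrier in blast)+

lemma row_iff: "A \<in> rees_row M G i \<longleftrightarrow> A \<in> carrier (rees M) \<and> model A \<in> model ` rees_row M G i"
proof (intro iffI conjI)
  assume "A \<in> carrier (rees M) \<and> model A \<in> model ` rees_row M G i"
  then obtain B where "B \<in> rees_row M G i" "model A = model B" "A \<in> carrier (rees M)" by blast
  then show "A \<in> rees_row M G i" using model_inj[of A B] row_in_carrier by blast
qed (use row_in_carrier in blast)+

text \<open>A bijective parametrization \<open>\<Gamma>\<close> of the image of a row in \<open>R[w_1, w_2]\<close> that respects all structure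
  yields the isomorphism in the other direction, from the row to the space of coordinates. Since
  \<open>\<Phi>\<close> is determined by \<open>\<Gamma>\<close>, its values can be computed by exhibiting coordinates.\<close>

lemma graded_iso_from_coordinates:
  assumes inj: "inj_on \<Gamma> (carrier N)" and onto: "\<Gamma> ` carrier N = model ` rees_row M G i"
    and grading: "\<And>j. \<Gamma> ` H j = model ` rees_part M G i j" "\<And>j. H j \<subseteq> carrier N"
    and add: "\<And>x y. x \<in> carrier N \<Longrightarrow> y \<in> carrier N \<Longrightarrow> x \<oplus>\<^bsub>N\<^esub> y \<in> carrier N \<and> \<Gamma> (x \<oplus>\<^bsub>N\<^esub> y) = \<Gamma> x + \<Gamma> y"
    and smult: "\<And>u x. x \<in> carrier N \<Longrightarrow> u \<odot>\<^bsub>N\<^esub> x \<in> carrier N \<and> \<Gamma> (u \<odot>\<^bsub>N\<^esub> x) = model (act u) * \<Gamma> x"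
    and act: "\<And>u. act u \<in> carrier (rees M)"
  obtains \<Phi> where "graded_module_iso (rees_row_module M G i act) (rees_part M G i) N H \<Phi>"
    and "\<And>A x. A \<in> rees_row M G i \<Longrightarrow> x \<in> carrier N \<Longrightarrow> \<Gamma> x = model A \<Longrightarrow> \<Phi> A = x"
proof -
  interpret R: ring "rees M" by (rule ring_rees)
  define \<Phi> where "\<Phi> = (\<lambda>A\<in>rees_row M G i. inv_into (carrier N) \<Gamma> (model A))"
  have unique: "\<Phi> A = x" if "A \<in> rees_row M G i" "x \<in> carrier N" "\<Gamma> x = model A" for A x
    using that inv_into_f_f[OF inj, of x] by (simp add: \<Phi>_def)
  have \<Phi>: "\<Phi> A \<in> carrier N \<and> \<Gamma> (\<Phi> A) = model A" if A: "A \<in> rees_row M G i" for A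
  proof -
    have "model A \<in> \<Gamma> ` carrier N" unfolding onto using A by blast
    then obtain x where x: "x \<in> carrier N" "\<Gamma> x = model A" by force
    then show ?thesis using unique[OF A x] by simp
  qed
  have row_add: "A \<oplus>\<^bsub>rees M\<^esub> B \<in> rees_row M G i" if "A \<in> rees_row M G i" "B \<in> rees_row M G i" for A B
    using generate.eng[of A "add_monoid (rees M)" _ B] that by (simp add: rees_row_def)
  have row_act: "act u \<otimes>\<^bsub>rees M\<^esub> A \<in> rees_row M G i \<and> \<Phi> (act u \<otimes>\<^bsub>rees M\<^esub> A) = u \<odot>\<^bsub>N\<^esub> \<Phi> A"
    if A: "A \<in> rees_row M G i" for u A
  proof
    have eq: "\<Gamma> (u \<odot>\<^bsub>N\<^esub> \<Phi> A) = model (act u \<otimes>\<^bsub>rees M\<^esub> A)" and carr: "u \<odot>\<^bsub>N\<^esub> \<Phi> A \<in> carrier N"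
      using smult \<Phi>[OF A] model_mult[OF act row_in_carrier[OF A]] by auto
    have "model (act u \<otimes>\<^bsub>rees M\<^esub> A) \<in> model ` rees_row M G i"
      unfolding onto[symmetric] eq[symmetric] using carr by blast
    then show row: "act u \<otimes>\<^bsub>rees M\<^esub> A \<in> rees_row M G i"
      using row_iff act row_in_carrier[OF A] by blast
    show "\<Phi> (act u \<otimes>\<^bsub>rees M\<^esub> A) = u \<odot>\<^bsub>N\<^esub> \<Phi> A"
      using unique[OF row carr eq] .
  qed
  have "graded_module_iso (rees_row_module M G i act) (rees_part M G i) N H \<Phi>"
    unfolding graded_module_iso_def
  proof (intro conjI allI)
    show "\<Phi> \<in> module_homs (rees_row_module M G i act) N"
      unfolding module_homs_def rees_row_module_def
    proof (simp, intro conjI ballI allI)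
      show "\<Phi> \<in> rees_row M G i \<rightarrow>\<^sub>E carrier N" using \<Phi> by (auto simp: \<Phi>_def)
      fix A assume A: "A \<in> rees_row M G i"
      show "\<Phi> (act u \<otimes>\<^bsub>rees M\<^esub> A) = u \<odot>\<^bsub>N\<^esub> \<Phi> A" for u using row_act[OF A] by blast
      fix B assume B: "B \<in> rees_row M G i"
      show "\<Phi> (A \<oplus>\<^bsub>rees M\<^esub> B) = \<Phi> A \<oplus>\<^bsub>N\<^esub> \<Phi> B"
        by (rule unique[OF row_add[OF A B]])
          (use add \<Phi>[OF A] \<Phi>[OF B] model_add[OF row_in_carrier[OF A] row_in_carrier[OF B]] in auto)
    qed
    have "bij_betw \<Phi> (rees_row M G i) (carrier N)"
    proof (rule bij_betw_byWitness[where f' = "\<lambda>x. SOME A. A \<in> rees_row M G i \<and> model A = \<Gamma> x"])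
      have ex: "(SOME A. A \<in> rees_row M G i \<and> model A = \<Gamma> x) \<in> rees_row M G i \<and>
          model (SOME A. A \<in> rees_row M G i \<and> model A = \<Gamma> x) = \<Gamma> x" if "x \<in> carrier N" for x
      proof (rule someI_ex)
        have "\<Gamma> x \<in> model ` rees_row M G i" unfolding onto[symmetric] using that by blast
        then show "\<exists>A. A \<in> rees_row M G i \<and> model A = \<Gamma> x" by force
      qed
      show "\<forall>A\<in>rees_row M G i. (SOME B. B \<in> rees_row M G i \<and> model B = \<Gamma> (\<Phi> A)) = A"
      proof
        fix A assume A: "A \<in> rees_row M G i"
        show "(SOME B. B \<in> rees_row M G i \<and> model B = \<Gamma> (\<Phi> A)) = A"
          using ex[of "\<Phi> A"] \<Phi>[OF A] A by (intro model_inj) (auto dest: row_in_carrier)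
      qed
      show "\<forall>x\<in>carrier N. \<Phi> (SOME A. A \<in> rees_row M G i \<and> model A = \<Gamma> x) = x"
      proof
        fix x assume x: "x \<in> carrier N"
        show "\<Phi> (SOME A. A \<in> rees_row M G i \<and> model A = \<Gamma> x) = x"
          using ex[OF x] x by (intro unique) auto
      qed
      show "\<Phi> ` rees_row M G i \<subseteq> carrier N" using \<Phi> by blast
      show "(\<lambda>x. SOME A. A \<in> rees_row M G i \<and> model A = \<Gamma> x) ` carrier N \<subseteq> rees_row M G i"
        using ex by blast
    qed
    then show "bij_betw \<Phi> (carrier (rees_row_module M G i act)) (carrier N)"
      by (simp add: rees_row_module_def)
    fix j
    show "\<Phi> ` rees_part M G i j = H j"
    proof (intro equalityI subsetI)
      fix x assume "x \<in> \<Phi> ` rees_part M G i j"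
      then obtain A where A: "A \<in> rees_part M G i j" "x = \<Phi> A" by blast
      then have row: "A \<in> rees_row M G i" using part_subset_row by blast
      have "model A \<in> \<Gamma> ` H j" unfolding grading using A by blast
      then obtain y where "y \<in> H j" "model A = \<Gamma> y" by blast
      then show "x \<in> H j" using unique[OF row, of y] grading(2) A(2) by auto
    next
      fix x assume x: "x \<in> H j"
      then have "\<Gamma> x \<in> model ` rees_part M G i j" unfolding grading(1)[symmetric] by blast
      then obtain A where A: "A \<in> rees_part M G i j" "model A = \<Gamma> x" by force
      then have row: "A \<in> rees_row M G i" using part_subset_row by blast
      show "x \<in> \<Phi> ` rees_part M G i j"
        using unique[OF row, of x] A x grading(2) by force
    qed
  qed
  then show thesis using that unique by blast
qed

end

lemma uminus_twisted: "p \<in> twisted wt i \<Longrightarrow> - (p::('w,('v,'k::ab_group_add) mpoly) mpoly) \<in> twisted wt i"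
  by (auto simp: twisted_def intro: uminus_forms)

lemma single_sum: "single m (\<Sum>x\<in>B. f x) = (\<Sum>x\<in>B. single m (f x) :: 'a \<Rightarrow>\<^sub>0 'b::comm_monoid_add)"
  by (induction B rule: infinite_finite_induct) (simp_all add: single_add)

text \<open>Models of both Rees algebras in the same ring \<open>R[w_1, w_2]\<close>, compatible with the map \<open>\<tau>\<close> from \<open>E\<close> to
  \<open>F\<close>. The inclusion of Rees algebras thereby becomes the identity on \<open>R[w_1, w_2]\<close>.\<close>

locale blowup_pair = syzygy_basis a \<xi> d \<sigma> +
    F: graded_rees_model F LF 1 eF GF + E: graded_rees_model E LE hE eE GE
  for a :: "3 \<Rightarrow> (2, 'k::field) mpoly" and \<xi> d \<sigma>
    and F :: "((2, 'k) mpoly, 'f) module" and LF eF GF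
    and E :: "((2, 'k) mpoly, 'e) module" and LE hE eE GE +
  fixes \<tau> :: "'e \<Rightarrow> 'f" and gen :: "3 \<Rightarrow> 'e"
  assumes F_grading: "y \<in> GF b \<Longrightarrow> LF y \<in> twisted weight b \<and> LF y \<in> forms 1"
    and eF_grading: "eF i \<in> GF (- int (\<sigma> i))"
    and E_grading: "x \<in> GE b \<Longrightarrow> \<exists>v. (\<forall>l. v l \<in> forms b) \<and> LE x = (\<Sum>l\<in>UNIV. mconst (v l) * T l)"
    and gen_grading: "gen l \<in> GE 0"
    and LE_gen: "LE (gen l) = T l"
    and \<tau>_closed: "x \<in> carrier E \<Longrightarrow> \<tau> x \<in> carrier F"
    and LF_\<tau>: "LF (\<tau> x) = LE x"
begin

lemma model_part_F: "F.model ` rees_part F GF i j = {p. p \<in> twisted weight i \<and> p \<in> forms j}"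
proof (intro equalityI subsetI)
  have "F.model ` rees_part F GF i j \<subseteq> (\<lambda>i j. {p. p \<in> twisted weight i \<and> p \<in> forms j}) i j"
  proof (rule F.model_part_subset)
    fix i j b x and p :: "(2, (2, 'k) mpoly) mpoly"
    assume "p \<in> {p. p \<in> twisted weight i \<and> p \<in> forms j}" "x \<in> GF b"
    then show "p * LF x \<in> {p. p \<in> twisted weight (i + b) \<and> p \<in> forms (j + 1)}"
      using F_grading[of x b] mult_row[of p i "LF x" b] mult_forms[of p j "LF x" 1] by simp
  qed (auto intro: mconst_row add_twisted add_forms)
  then show "p \<in> {p. p \<in> twisted weight i \<and> p \<in> forms j}" if "p \<in> F.model ` rees_part F GF i j" for p
    using that by blast
next
  fix p :: "(2, (2, 'k) mpoly) mpoly"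
  assume "p \<in> {p. p \<in> twisted weight i \<and> p \<in> forms j}"
  then have "p \<in> twisted weight i" "p \<in> forms j" by auto
  then show "p \<in> F.model ` rees_part F GF i j"
  proof (induction p rule: twisted_form_induct)
    case (single \<mu> m c)
    have "mconst (single m c) \<in> F.model ` rees_part F GF (i + weight \<mu>) 0"
      by (rule F.mconst_in_part) (use single in \<open>auto intro: single_forms\<close>)
    from F.times_prod_in_part[OF this finite_class.finite_UNIV, of eF "\<lambda>v. - int (\<sigma> v)" "lookup \<mu>"]
    have "mconst (single m c) * (\<Prod>v\<in>UNIV. mvar v ^ lookup \<mu> v)
        \<in> F.model ` rees_part F GF i (int (mdegree \<mu>))"
      by (simp add: eF_grading F.L_e sum_2 weight_def mdegree2 add.commute)
    moreover have "(\<Prod>v\<in>UNIV. mvar v ^ lookup \<mu> v) = (single \<mu> 1 :: (2, (2, 'k) mpoly) mpoly)"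
      unfolding monom_eval_mvar[symmetric] by (rule monom_eval_superset[symmetric]) auto
    ultimately show ?case using single(1) by (simp add: mconst_mult_single)
  qed (auto intro: F.zero_in_part F.add_in_part)
qed

lemma model_row_F: "F.model ` rees_row F GF i = twisted weight i"
proof (rule F.model_row)
  fix w :: "(2, (2, 'k) mpoly) mpoly" assume w: "w \<in> twisted weight i"
  obtain J where "\<And>\<mu>. lookup w \<mu> \<noteq> 0 \<Longrightarrow> mdegree \<mu> \<le> J" using degree_bound_exists[of w] by blast
  then have "w = (\<Sum>j\<le>J. hom_component (int j) w)" by (rule sum_hom_components[symmetric])
  then show "\<exists>J f. w = (\<Sum>j\<le>J::nat. f j) \<and> (\<forall>j. f j \<in> F.model ` rees_part F GF i (int j))"
    using hom_component_twisted[OF w] by (intro exI[of _ J] exI[of _ "\<lambda>j. hom_component (int j) w"]) (simp add: model_part_F)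
qed (auto simp: model_part_F intro: add_twisted uminus_twisted)

lemma model_part_E: "E.model ` rees_part E GE i j = \<theta> ` {s. s \<in> forms i \<and> s \<in> twisted (\<lambda>_. 0) j}"
proof (intro equalityI subsetI)
  have "E.model ` rees_part E GE i j \<subseteq> (\<lambda>i j. \<theta> ` {s. s \<in> forms i \<and> s \<in> twisted (\<lambda>_. 0) j}) i j"
  proof (rule E.model_part_subset)
    fix i j
    show "0 \<in> \<theta> ` {s. s \<in> forms i \<and> s \<in> twisted (\<lambda>_. 0) j}"
      by (rule image_eqI[of _ _ 0]) (simp_all add: \<theta>.hom_zero)
  next
    fix i and r :: "(2, 'k) mpoly" assume "r \<in> forms i"
    then show "mconst r \<in> \<theta> ` {s. s \<in> forms i \<and> s \<in> twisted (\<lambda>_. 0) 0}"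
      by (intro image_eqI[of _ _ "lift r"]) (simp_all add: \<theta>_lift lift_forms lift_twisted)
  next
    fix i j b p x
    assume "p \<in> \<theta> ` {s. s \<in> forms i \<and> s \<in> twisted (\<lambda>_. 0) j}" and x: "x \<in> GE b"
    then obtain s where s: "s \<in> forms i" "s \<in> twisted (\<lambda>_. 0) j" "p = \<theta> s" by blast
    obtain v where v: "\<And>l. v l \<in> forms b" "LE x = (\<Sum>l\<in>UNIV. mconst (v l) * T l)"
      using E_grading[OF x] by blast
    let ?t = "\<Sum>l\<in>UNIV. mconst (mvar l) * lift (v l)"
    have "\<theta> (s * ?t) = p * LE x"
      by (simp add: \<theta>.hom_mult \<theta>_sum \<theta>_lift \<theta>_mconst \<rho>_mvar s(3) v(2) mult.commute)
    moreover have "s * ?t \<in> forms (i + b)"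
      by (intro mult_forms s sum_forms mconst_mult_forms lift_forms v)
    moreover have "?t \<in> twisted (\<lambda>_. 0) 1"
    proof (rule sum_twisted)
      fix l
      have "mconst (mvar l :: (3, 'k) mpoly) \<in> twisted (\<lambda>_. 0) 1"
        unfolding mconst_def by (rule single_twisted) simp
      from mult_twisted[OF _ this lift_twisted] show "mconst (mvar l) * lift (v l) \<in> twisted (\<lambda>_. 0) 1" by simp
    qed
    then have "s * ?t \<in> twisted (\<lambda>_. 0) (j + 1)"
      using mult_twisted[OF _ s(2)] by simp
    ultimately show "p * LE x \<in> \<theta> ` {s. s \<in> forms (i + b) \<and> s \<in> twisted (\<lambda>_. 0) (j + 1)}"
      by (intro image_eqI[of _ _ "s * ?t"]) auto
  next
    fix i j p q
    assume "p \<in> \<theta> ` {s. s \<in> forms i \<and> s \<in> twisted (\<lambda>_. 0) j}" "q \<in> \<theta> ` {s. s \<in> forms i \<and> s \<in> twisted (\<lambda>_. 0) j}"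
    then obtain s t where "s \<in> forms i" "s \<in> twisted (\<lambda>_. 0) j" "p = \<theta> s"
      "t \<in> forms i" "t \<in> twisted (\<lambda>_. 0) j" "q = \<theta> t" by blast
    then show "p + q \<in> \<theta> ` {s. s \<in> forms i \<and> s \<in> twisted (\<lambda>_. 0) j}"
      by (intro image_eqI[of _ _ "s + t"]) (auto simp: \<theta>.hom_add intro: add_forms add_twisted)
  qed
  then show "p \<in> \<theta> ` {s. s \<in> forms i \<and> s \<in> twisted (\<lambda>_. 0) j}" if "p \<in> E.model ` rees_part E GE i j" for p
    using that by blast
next
  fix p assume "p \<in> \<theta> ` {s. s \<in> forms i \<and> s \<in> twisted (\<lambda>_. 0) j}"
  then obtain s where s: "s \<in> twisted (\<lambda>_. 0) j" "s \<in> forms i" "p = \<theta> s" by blast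
  from s(1,2) have "\<theta> s \<in> E.model ` rees_part E GE i j"
  proof (induction s rule: twisted_form_induct)
    case (single m n c)
    have "mconst (single m c) \<in> E.model ` rees_part E GE i 0"
      by (rule E.mconst_in_part) (use single in \<open>auto intro: single_forms\<close>)
    from E.times_prod_in_part[OF this finite_class.finite_UNIV, of gen "\<lambda>_. 0" "lookup n"]
    have "mconst (single m c) * monom_eval T n \<in> E.model ` rees_part E GE i j"
      using single(2) by (simp add: gen_grading LE_gen monom_eval_superset[of UNIV] mdegree_superset[of UNIV])
    moreover have "\<theta> (single m (single n c)) = mconst (single m c) * monom_eval T n"
    proof -
      have "(mconst (single m c) :: (2, (2, 'k) mpoly) mpoly) = mconst (mconst c) * mconst (single m 1)"
        by (simp add: mconst_mult_single flip: mconst_mult)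
      then show ?thesis
        by (simp add: \<theta>_single \<rho>_def mconst_mconst.meval_single mult_ac)
    qed
    ultimately show ?case by simp
  qed (auto simp: \<theta>.hom_zero \<theta>.hom_add intro: E.zero_in_part E.add_in_part)
  then show "p \<in> E.model ` rees_part E GE i j" using s(3) by simp
qed

text \<open>The rows \<open>i \<ge> - 1\<close> are written with \<open>i = n - 1\<close>. To split an element into bigraded pieces, its finitely
  many coordinates over \<open>k[T_1, T_2, T_3]\<close> are split into forms up to a common degree.\<close>

lemma model_row_E: "E.model ` rees_row E GE (int n - 1) = \<theta> ` forms (int n - 1)"
proof (rule E.model_row)
  show "0 \<in> \<theta> ` forms (int n - 1)"
    by (rule image_eqI[of _ _ 0]) (simp_all add: \<theta>.hom_zero)
  show "p + q \<in> \<theta> ` forms (int n - 1)" if "p \<in> \<theta> ` forms (int n - 1)" "q \<in> \<theta> ` forms (int n - 1)" for p q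
  proof -
    obtain s t where "s \<in> forms (int n - 1)" "p = \<theta> s" "t \<in> forms (int n - 1)" "q = \<theta> t"
      using \<open>p \<in> _\<close> \<open>q \<in> _\<close> by blast
    then show ?thesis by (intro image_eqI[of _ _ "s + t"]) (auto simp: \<theta>.hom_add intro: add_forms)
  qed
  show "- p \<in> \<theta> ` forms (int n - 1)" if p: "p \<in> \<theta> ` forms (int n - 1)" for p
  proof -
    obtain s where "s \<in> forms (int n - 1)" "p = \<theta> s" using p by blast
    then show ?thesis
      using \<theta>_diff[of 0 s] by (intro image_eqI[of _ _ "- s"]) (auto simp: \<theta>.hom_zero intro: uminus_forms)
  qed
  show "E.model ` rees_part E GE (int n - 1) j \<subseteq> \<theta> ` forms (int n - 1)" for j
    unfolding model_part_E by blast
next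
  fix w assume "w \<in> \<theta> ` forms (int n - 1)"
  then obtain s where s: "s \<in> forms (int n - 1)" "w = \<theta> s" by blast
  define u where "u p = lookup s (monom2 p (n - 1 - p))" for p
  have "\<exists>J. \<forall>m. lookup (u p) m \<noteq> 0 \<longrightarrow> mdegree m \<le> J" for p
    by (rule degree_bound_exists)
  then obtain J where J: "\<And>p m. lookup (u p) m \<noteq> 0 \<Longrightarrow> mdegree m \<le> J p" by metis
  have u: "u p = (\<Sum>j\<le>(\<Sum>p<n. J p). hom_component (int j) (u p))" if "p < n" for p
  proof (rule sum_hom_components[symmetric])
    fix m assume "lookup (u p) m \<noteq> 0"
    then have "mdegree m \<le> J p" by (rule J)
    also have "\<dots> \<le> (\<Sum>p<n. J p)" by (rule member_le_sum) (use that in auto)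
    finally show "mdegree m \<le> (\<Sum>p<n. J p)" .
  qed
  have "row_sum n u = (\<Sum>p<n. single (monom2 p (n - 1 - p)) (\<Sum>j\<le>(\<Sum>p<n. J p). hom_component (int j) (u p)))"
    unfolding row_sum_def by (rule sum.cong) (simp_all flip: u)
  also have "\<dots> = (\<Sum>j\<le>(\<Sum>p<n. J p). row_sum n (\<lambda>p. hom_component (int j) (u p)))"
    unfolding row_sum_def single_sum by (rule sum.swap)
  finally have eq: "row_sum n u = (\<Sum>j\<le>(\<Sum>p<n. J p). row_sum n (\<lambda>p. hom_component (int j) (u p)))" .
  have "row_sum n u = s" unfolding u_def by (rule form_is_row_sum[OF s(1)])
  then have "w = \<theta> (row_sum n u)" using s(2) by simp
  then have "w = (\<Sum>j\<le>(\<Sum>p<n. J p). \<theta> (row_sum n (\<lambda>p. hom_component (int j) (u p))))"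
    unfolding eq \<theta>_sum .
  moreover have "\<theta> (row_sum n (\<lambda>p. hom_component (int j) (u p))) \<in> E.model ` rees_part E GE (int n - 1) (int j)" for j
    unfolding model_part_E by (intro imageI CollectI conjI row_sum_forms row_sum_twisted hom_component_forms)
  ultimately show "\<exists>J f. w = (\<Sum>j\<le>J::nat. f j) \<and> (\<forall>j. f j \<in> E.model ` rees_part E GE (int n - 1) (int j))"
    by (intro exI[of _ "\<Sum>p<n. J p"] exI[of _ "\<lambda>j. \<theta> (row_sum n (\<lambda>p. hom_component (int j) (u p)))"]) simp
qed

subsection \<open>The inclusion and the presentation\<close>

lemma \<pi>_\<tau>: "F.\<pi> (meval mconst (\<lambda>x. mvar (\<tau> x)) p) = E.\<pi> p"
  using meval_comp[OF coefficient_hom_mconst F.\<pi>.coefficient_hom_axioms, of "\<lambda>x. mvar (\<tau> x)" p]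
  by (simp add: LF_\<tau> E.\<pi>_def)

lemma \<tau>_polys_in: "p \<in> E.P \<Longrightarrow> meval mconst (\<lambda>x. mvar (\<tau> x)) p \<in> F.P"
  by (rule meval_polys_in[OF coefficient_hom_mconst, where W = "carrier E"])
    (auto intro: mvar_polys_in \<tau>_closed)

abbreviation \<iota> where "\<iota> \<equiv> rees_map E F \<tau>"

text \<open>The value does not depend on the representing polynomial because it is determined by its image in
  \<open>R[w_1, w_2]\<close>.\<close>

lemma \<iota>_rees_class:
  assumes p: "p \<in> E.P"
  shows "\<iota> (rees_class E p) = rees_class F (meval mconst (\<lambda>x. mvar (\<tau> x)) p)"
proof -
  have "rees_class F (meval mconst (\<lambda>x. mvar (\<tau> x)) q) = rees_class F (meval mconst (\<lambda>x. mvar (\<tau> x)) p)"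
    if "q \<in> E.P" "rees_class E q = rees_class E p" for q
    using E.rees_class_eq_iff[OF that(1) p] that(2)
      F.rees_class_eq_iff[OF \<tau>_polys_in[OF that(1)] \<tau>_polys_in[OF p]] by (simp add: \<pi>_\<tau>)
  then have "(\<lambda>p. rees_class F (meval mconst (\<lambda>x. mvar (\<tau> x)) p)) `
      {q \<in> E.P. rees_class E q = rees_class E p} = {rees_class F (meval mconst (\<lambda>x. mvar (\<tau> x)) p)}"
    using p by blast
  then show ?thesis unfolding rees_map_def mpoly_ring_simps by (simp only: the_elem_eq)
qed

lemma \<iota>_closed: "A \<in> carrier (rees E) \<Longrightarrow> \<iota> A \<in> carrier (rees F)"
  by (erule E.carrier_reesE) (auto simp: \<iota>_rees_class F.carrier_rees intro: \<tau>_polys_in)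

lemma model_\<iota>: "A \<in> carrier (rees E) \<Longrightarrow> F.model (\<iota> A) = E.model A"
  by (erule E.carrier_reesE)
    (simp add: \<iota>_rees_class F.model_rees_class E.model_rees_class \<tau>_polys_in \<pi>_\<tau>)

definition presentation_poly :: "(3, 'k) mpoly \<Rightarrow> ('e, (2, 'k) mpoly) mpoly" where
  "presentation_poly = meval (\<lambda>c. mconst (mconst c)) (\<lambda>l. mvar (gen l))"

definition presentation :: "(3, 'k) mpoly \<Rightarrow> ('e, (2, 'k) mpoly) mpoly set set" where
  "presentation u = rees_class E (presentation_poly u)"

lemma gen_closed: "gen l \<in> carrier E"
  using gen_grading E.G_subset by blast

lemma presentation_poly_in: "presentation_poly u \<in> E.P"
  unfolding presentation_poly_def
  by (rule meval_polys_in[OF coefficient_hom_mconst_mconst, where W = UNIV])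
    (auto intro: mvar_polys_in gen_closed)

lemma presentation_closed: "presentation u \<in> carrier (rees E)"
  unfolding presentation_def E.carrier_rees by (rule imageI) (rule presentation_poly_in)

lemma model_presentation: "E.model (presentation u) = \<rho> u"
  unfolding presentation_def E.model_rees_class[OF presentation_poly_in]
  using meval_comp[OF coefficient_hom_mconst_mconst E.\<pi>.coefficient_hom_axioms, of "\<lambda>l. mvar (gen l)" u]
  by (simp add: presentation_poly_def \<rho>_def LE_gen)

lemma \<rho>_inj:
  assumes "\<rho> u = \<rho> v"
  shows "u = v"
proof -
  have "\<theta> (mconst (u - v)) = 0"
    unfolding \<theta>_mconst using assms \<rho>.hom_add[of "u - v" v] by simp
  then have "mconst (u - v) = (0 :: (2, (3, 'k) mpoly) mpoly)"
    using d_pos by (intro low_row_injective[OF mconst_forms]) auto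
  then show ?thesis by simp
qed

lemma form_degree_0: "(s :: (2, (3, 'k) mpoly) mpoly) \<in> forms 0 \<Longrightarrow> s = mconst (lookup s 0)"
proof -
  assume s: "s \<in> forms 0"
  have "monom2 0 0 = 0" by (rule monom2_eqI) simp_all
  then show ?thesis using form_is_row_sum[of s 1] s by (simp add: row_sum_def mconst_def)
qed

lemma model_row_E_0: "E.model ` rees_row E GE 0 = range \<rho>"
proof -
  have "E.model ` rees_row E GE 0 = \<theta> ` forms 0" using model_row_E[of 1] by simp
  also have "\<dots> = range \<rho>"
  proof (intro equalityI subsetI)
    fix w assume "w \<in> \<theta> ` forms 0"
    then obtain s where "s \<in> forms 0" "w = \<theta> s" by blast
    then have "w = \<rho> (lookup s 0)"
      using form_degree_0[of s] \<theta>_mconst[of "lookup s 0"] by simp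
    then show "w \<in> range \<rho>" by (rule range_eqI)
  next
    fix w assume "w \<in> range \<rho>"
    then obtain u where "w = \<theta> (mconst u)" unfolding \<theta>_mconst by blast
    then show "w \<in> \<theta> ` forms 0" by (rule image_eqI) simp
  qed
  finally show ?thesis .
qed

theorem presentation_iso:
  "presentation \<in> ring_iso ring_of_type_algebra ((rees E)\<lparr>carrier := rees_row E GE 0\<rparr>)"
  unfolding ring_iso_def
proof (intro CollectI conjI ring_hom_memI)
  have in_row: "presentation u \<in> rees_row E GE 0" for u
    unfolding E.row_iff[of "presentation u"] model_presentation model_row_E_0 using presentation_closed by blast
  then show "presentation u \<in> carrier ((rees E)\<lparr>carrier := rees_row E GE 0\<rparr>)" for u by simp
  show "presentation (u \<otimes>\<^bsub>ring_of_type_algebra\<^esub> v) = presentation u \<otimes>\<^bsub>(rees E)\<lparr>carrier := rees_row E GE 0\<rparr>\<^esub> presentation v" for u v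
    by (simp add: presentation_def ring_of_type_algebra_def presentation_poly_in presentation_poly_def
        mconst_mconst.meval_mult E.rees_class_mult presentation_poly_in[unfolded presentation_poly_def])
  show "presentation (u \<oplus>\<^bsub>ring_of_type_algebra\<^esub> v) = presentation u \<oplus>\<^bsub>(rees E)\<lparr>carrier := rees_row E GE 0\<rparr>\<^esub> presentation v" for u v
    by (simp add: presentation_def ring_of_type_algebra_def presentation_poly_in presentation_poly_def
        mconst_mconst.meval_add E.rees_class_add presentation_poly_in[unfolded presentation_poly_def])
  show "presentation \<one>\<^bsub>ring_of_type_algebra\<^esub> = \<one>\<^bsub>(rees E)\<lparr>carrier := rees_row E GE 0\<rparr>\<^esub>"
    by (simp add: presentation_def ring_of_type_algebra_def presentation_poly_def mconst_mconst.meval_1 E.rees_class_one)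
  have "bij_betw presentation UNIV (rees_row E GE 0)"
  proof (rule bij_betw_imageI)
    show "inj presentation"
    proof (rule injI)
      fix u v assume "presentation u = presentation v"
      then have "\<rho> u = \<rho> v" by (simp flip: model_presentation)
      then show "u = v" by (rule \<rho>_inj)
    qed
    show "range presentation = rees_row E GE 0"
    proof (intro equalityI subsetI)
      fix A assume A: "A \<in> rees_row E GE 0"
      then have "E.model A \<in> range \<rho>" using model_row_E_0 by blast
      then obtain u where "E.model A = E.model (presentation u)" unfolding model_presentation by blast
      then show "A \<in> range presentation"
        using E.model_inj[OF E.row_in_carrier[OF A] presentation_closed] by blast
    qed (use in_row in blast)
  qed
  then show "bij_betw presentation (carrier ring_of_type_algebra) (carrier ((rees E)\<lparr>carrier := rees_row E GE 0\<rparr>))"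
    by (simp add: ring_of_type_algebra_def)
qed

theorem presentation_grading: "presentation ` forms j = rees_part E GE 0 j"
proof (intro equalityI subsetI)
  fix A assume "A \<in> presentation ` forms j"
  then obtain u where u: "u \<in> forms j" "A = presentation u" by blast
  have "mconst u \<in> twisted (\<lambda>_. 0) j"
    unfolding mconst_def by (rule single_twisted) (simp add: u(1))
  then have "\<rho> u \<in> \<theta> ` {s. s \<in> forms 0 \<and> s \<in> twisted (\<lambda>_. 0) j}"
    by (intro image_eqI[of _ _ "mconst u"]) (simp_all add: \<theta>_mconst)
  then show "A \<in> rees_part E GE 0 j"
    using E.part_iff[of "presentation u" 0 j] presentation_closed
    unfolding model_presentation model_part_E u(2) by blast
next
  fix A assume A: "A \<in> rees_part E GE 0 j"
  then have "E.model A \<in> \<theta> ` {s. s \<in> forms 0 \<and> s \<in> twisted (\<lambda>_. 0) j}"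
    unfolding model_part_E[symmetric] by blast
  then obtain s where s: "s \<in> forms 0" "s \<in> twisted (\<lambda>_. 0) j" "E.model A = \<theta> s" by blast
  let ?u = "lookup s 0"
  have "E.model A = E.model (presentation ?u)"
    unfolding s(3) model_presentation \<theta>_mconst[symmetric] using form_degree_0[OF s(1)] by simp
  then have "A = presentation ?u"
    using E.model_inj[OF E.part_in_carrier[OF A] presentation_closed] by blast
  moreover have "?u \<in> forms j" using s(2) by (simp add: twisted_def)
  ultimately show "A \<in> presentation ` forms j" by blast
qed

subsection \<open>Freeness of the rows\<close>

lemma row_sum_add: "row_sum n (\<lambda>p. u p + v p) = row_sum n u + row_sum n v"
  by (simp add: row_sum_def single_add sum.distrib)

lemma row_sum_sum: "row_sum n (\<lambda>p. \<Sum>j\<in>B. u j p) = (\<Sum>j\<in>B. row_sum n (u j))"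
  unfolding row_sum_def single_sum by (rule sum.swap)

lemma row_sum_smult: "row_sum n (\<lambda>p. r * u p) = mconst r * row_sum n u"
  by (simp add: row_sum_def mconst_mult_single sum_distrib_left)

lemma row_sum_cong: "(\<And>p. p < n \<Longrightarrow> u p = v p) \<Longrightarrow> row_sum n u = row_sum n v"
  by (simp add: row_sum_def)

text \<open>The coordinates on the larger row come from \<open>row_basis\<close>. On the smaller row only the monomials are
  used, so under the inclusion the second group of coordinates vanishes.\<close>

theorem rows_free:
  assumes n: "n \<le> d"
  shows "\<exists>\<Psi> \<Theta>.
      graded_module_iso (rees_row_module F GF (int n - 1) (\<lambda>u. \<iota> (presentation u))) (rees_part F GF (int n - 1))
        (module_sum (free_module n) (free_module (d - n)))
        (sum_grading (free_grading n) (shift (-1) (free_grading (d - n)))) \<Psi>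
    \<and> graded_module_iso (rees_row_module E GE (int n - 1) presentation) (rees_part E GE (int n - 1))
        (free_module n) (free_grading n) \<Theta>
    \<and> (\<forall>A\<in>rees_row E GE (int n - 1).
         \<iota> A \<in> rees_row F GF (int n - 1) \<and> \<Psi> (\<iota> A) = (\<Theta> A, \<zero>\<^bsub>free_module (d - n)\<^esub>))"
proof (rule row_basis[OF n])
  let ?i = "int n - 1"
  fix \<beta>
  assume \<beta>: "\<And>q. q < d - n \<Longrightarrow> \<beta> q \<in> twisted weight ?i \<and> \<beta> q \<in> forms 1"
    and indep: "\<And>u v. \<theta> (row_sum n u) + (\<Sum>q<d - n. \<beta> q * \<rho> (v q)) = 0 \<Longrightarrow> (\<forall>p<n. u p = 0) \<and> (\<forall>q<d - n. v q = 0)"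
    and span: "\<And>j w. w \<in> twisted weight ?i \<Longrightarrow> w \<in> forms j \<Longrightarrow>
      \<exists>u v. (\<forall>p. u p \<in> forms j) \<and> (\<forall>q. v q \<in> forms (j - 1)) \<and>
        w = \<theta> (row_sum n u) + (\<Sum>q<d - n. \<beta> q * \<rho> (v q))"
  define B where "B v = (\<Sum>q<d - n. \<beta> q * \<rho> (v q))" for v
  have B_add: "B (\<lambda>q. v q + v' q) = B v + B v'" for v v'
    by (simp add: B_def \<rho>.hom_add distrib_left sum.distrib)
  have B_smult: "B (\<lambda>q. r * v q) = \<rho> r * B v" for r v
    by (simp add: B_def \<rho>.hom_mult sum_distrib_left mult_ac)
  have B_cong: "B v = B v'" if "\<And>q. q < d - n \<Longrightarrow> v q = v' q" for v v'
    using that by (simp add: B_def)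
  have B_sum: "B (\<lambda>q. \<Sum>j\<in>K. v j q) = (\<Sum>j\<in>K. B (v j))" if "finite K" for K :: "nat set" and v
    using that by induction (simp_all add: B_add, simp add: B_def \<rho>.hom_zero)
  have B_row: "B v \<in> twisted weight ?i" for v
    unfolding B_def by (intro sum_twisted mult_row'[OF _ \<rho>_row]) (use \<beta> in auto)
  have B_forms: "B v \<in> forms j" if "\<And>q. q < d - n \<Longrightarrow> v q \<in> forms (j - 1)" for v j
    unfolding B_def by (intro sum_forms mult_forms'[OF _ \<rho>_forms]) (use \<beta> that in auto)
  have A_row: "\<theta> (row_sum n u) \<in> twisted weight ?i" for u
    by (rule \<theta>_row[OF row_sum_forms])
  have A_forms: "\<theta> (row_sum n u) \<in> forms j" if "\<And>p. p < n \<Longrightarrow> u p \<in> forms j" for u j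
    by (rule \<theta>_forms[OF row_sum_twisted]) (rule that)
  \<comment> \<open>Coordinates are functions restricted to \<open>{..<n}\<close> and \<open>{..<d - n}\<close>, but the map itself ignores all other arguments.\<close>
  define \<Gamma> where "\<Gamma> = (\<lambda>(u, v). \<theta> (row_sum n u) + B v)"
  let ?N = "module_sum (free_module n) (free_module (d - n)) :: ((3, 'k) mpoly, _) module"
  let ?H = "sum_grading (free_grading n) (shift (-1) (free_grading (d - n)))"
  have N: "carrier ?N = ({..<n} \<rightarrow>\<^sub>E UNIV) \<times> ({..<d - n} \<rightarrow>\<^sub>E UNIV)"
    by (simp add: module_sum_def free_module_def)
  have H: "?H j = ({..<n} \<rightarrow>\<^sub>E forms j) \<times> ({..<d - n} \<rightarrow>\<^sub>E forms (j - 1))" for j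
    by (simp add: sum_grading_def free_grading_def shift_def)
  have \<Gamma>_restrict: "\<Gamma> (restrict u {..<n}, restrict v {..<d - n}) = \<theta> (row_sum n u) + B v" for u v
    unfolding \<Gamma>_def prod.case by (intro arg_cong2[where f = "(+)"] arg_cong[where f = \<theta>] row_sum_cong B_cong) auto
  have row_iso_F: "\<exists>\<Psi>. graded_module_iso (rees_row_module F GF ?i (\<lambda>u. \<iota> (presentation u))) (rees_part F GF ?i) ?N ?H \<Psi>
      \<and> (\<forall>A x. A \<in> rees_row F GF ?i \<longrightarrow> x \<in> carrier ?N \<longrightarrow> \<Gamma> x = F.model A \<longrightarrow> \<Psi> A = x)"
  proof (rule F.graded_iso_from_coordinates[of \<Gamma> ?N ?i ?H "\<lambda>u. \<iota> (presentation u)"])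
    show "inj_on \<Gamma> (carrier ?N)"
    proof (rule inj_onI)
      fix x y assume xy: "x \<in> carrier ?N" "y \<in> carrier ?N" "\<Gamma> x = \<Gamma> y"
      obtain u v u' v' where uv: "x = (u, v)" "y = (u', v')" by (metis surj_pair)
      have "\<theta> (row_sum n u) = \<theta> (row_sum n (\<lambda>p. u p - u' p)) + \<theta> (row_sum n u')"
        unfolding \<theta>.hom_add[symmetric] row_sum_add[symmetric] by simp
      moreover have "B v = B (\<lambda>q. v q - v' q) + B v'"
        unfolding B_add[symmetric] by simp
      ultimately have "\<theta> (row_sum n (\<lambda>p. u p - u' p)) + B (\<lambda>q. v q - v' q) = 0"
        using xy(3) by (simp add: \<Gamma>_def uv algebra_simps)
      then have eq: "(\<forall>p<n. u p - u' p = 0) \<and> (\<forall>q<d - n. v q - v' q = 0)"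
        unfolding B_def by (rule indep)
      have mem: "u \<in> {..<n} \<rightarrow>\<^sub>E UNIV" "u' \<in> {..<n} \<rightarrow>\<^sub>E UNIV"
        "v \<in> {..<d - n} \<rightarrow>\<^sub>E UNIV" "v' \<in> {..<d - n} \<rightarrow>\<^sub>E UNIV"
        using xy(1,2) unfolding N uv by blast+
      have "u = u'" by (rule PiE_ext[OF mem(1,2)]) (use eq in simp)
      moreover have "v = v'" by (rule PiE_ext[OF mem(3,4)]) (use eq in simp)
      ultimately show "x = y" by (simp add: uv)
    qed
    show grade: "\<Gamma> ` ?H j = F.model ` rees_part F GF ?i j" for j
    proof (intro equalityI subsetI)
      fix w assume "w \<in> \<Gamma> ` ?H j"
      then obtain u v where uv: "u \<in> {..<n} \<rightarrow>\<^sub>E forms j" "v \<in> {..<d - n} \<rightarrow>\<^sub>E forms (j - 1)"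
        "w = \<theta> (row_sum n u) + B v" unfolding H \<Gamma>_def by auto
      then show "w \<in> F.model ` rees_part F GF ?i j"
        unfolding model_part_F using A_row B_row A_forms[of u j] B_forms[of v j]
        by (auto simp: PiE_mem intro: add_twisted add_forms)
    next
      fix w assume "w \<in> F.model ` rees_part F GF ?i j"
      then have "w \<in> twisted weight ?i" "w \<in> forms j" by (auto simp: model_part_F)
      then obtain u v where uv: "\<And>p. u p \<in> forms j" "\<And>q. v q \<in> forms (j - 1)" "w = \<theta> (row_sum n u) + B v"
        using span unfolding B_def by blast
      then show "w \<in> \<Gamma> ` ?H j"
        unfolding H by (intro image_eqI[where x = "(restrict u {..<n}, restrict v {..<d - n})"])
          (auto simp: \<Gamma>_restrict)
    qed
    show "\<Gamma> ` carrier ?N = F.model ` rees_row F GF ?i"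
      unfolding model_row_F
    proof (intro equalityI subsetI)
      fix w assume "w \<in> \<Gamma> ` carrier ?N"
      then show "w \<in> twisted weight ?i"
        unfolding \<Gamma>_def by (auto intro: add_twisted A_row B_row)
    next
      fix w :: "(2, (2, 'k) mpoly) mpoly" assume w: "w \<in> twisted weight ?i"
      have "\<exists>u v. hom_component (int j) w = \<theta> (row_sum n u) + B v" for j
        using span[OF hom_component_twisted[OF w] hom_component_forms] unfolding B_def by blast
      then obtain u v where uv: "\<And>j. hom_component (int j) w = \<theta> (row_sum n (u j)) + B (v j)" by metis
      obtain J where "\<And>\<mu>. lookup w \<mu> \<noteq> 0 \<Longrightarrow> mdegree \<mu> \<le> J" using degree_bound_exists[of w] by blast
      then have "w = (\<Sum>j\<le>J. hom_component (int j) w)" by (rule sum_hom_components[symmetric])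
      also have "\<dots> = \<theta> (row_sum n (\<lambda>p. \<Sum>j\<le>J. u j p)) + B (\<lambda>q. \<Sum>j\<le>J. v j q)"
        by (simp add: uv sum.distrib row_sum_sum \<theta>_sum B_sum)
      finally show "w \<in> \<Gamma> ` carrier ?N"
        unfolding N \<Gamma>_restrict[symmetric] by (rule image_eqI) auto
    qed
    show "?H j \<subseteq> carrier ?N" for j unfolding H N by (auto simp: PiE_iff)
    show "x \<oplus>\<^bsub>?N\<^esub> y \<in> carrier ?N \<and> \<Gamma> (x \<oplus>\<^bsub>?N\<^esub> y) = \<Gamma> x + \<Gamma> y"
      if "x \<in> carrier ?N" "y \<in> carrier ?N" for x y
    proof -
      obtain u v u' v' where uv: "x = (u, v)" "y = (u', v')" by (metis surj_pair)
      have "x \<oplus>\<^bsub>?N\<^esub> y = (restrict (\<lambda>p. u p + u' p) {..<n}, restrict (\<lambda>q. v q + v' q) {..<d - n})"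
        by (simp add: uv module_sum_def free_module_def)
      then show ?thesis
        unfolding N by (simp add: \<Gamma>_restrict row_sum_add \<theta>.hom_add B_add) (simp add: \<Gamma>_def uv)
    qed
    show "r \<odot>\<^bsub>?N\<^esub> x \<in> carrier ?N \<and> \<Gamma> (r \<odot>\<^bsub>?N\<^esub> x) = F.model (\<iota> (presentation r)) * \<Gamma> x"
      if "x \<in> carrier ?N" for r x
    proof -
      obtain u v where uv: "x = (u, v)" by (metis surj_pair)
      have "r \<odot>\<^bsub>?N\<^esub> x = (restrict (\<lambda>p. r * u p) {..<n}, restrict (\<lambda>q. r * v q) {..<d - n})"
        by (simp add: uv module_sum_def free_module_def)
      then show ?thesis
        unfolding N by (simp add: \<Gamma>_restrict row_sum_smult \<theta>.hom_mult \<theta>_mconst B_smult model_\<iota> presentation_closed model_presentation)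
          (simp add: \<Gamma>_def uv distrib_left)
    qed
    show "\<iota> (presentation r) \<in> carrier (rees F)" for r by (rule \<iota>_closed[OF presentation_closed])
  qed blast
  let ?\<Delta> = "\<lambda>u. \<theta> (row_sum n u)"
  let ?N' = "free_module n :: ((3, 'k) mpoly, _) module"
  have N': "carrier ?N' = {..<n} \<rightarrow>\<^sub>E UNIV" by (simp add: free_module_def)
  have \<Delta>_restrict: "?\<Delta> (restrict u {..<n}) = ?\<Delta> u" for u
    by (intro arg_cong[where f = \<theta>] row_sum_cong) auto
  have row_iso_E: "\<exists>\<Theta>. graded_module_iso (rees_row_module E GE ?i presentation) (rees_part E GE ?i) ?N' (free_grading n) \<Theta>
      \<and> (\<forall>A x. A \<in> rees_row E GE ?i \<longrightarrow> x \<in> carrier ?N' \<longrightarrow> ?\<Delta> x = E.model A \<longrightarrow> \<Theta> A = x)"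
  proof (rule E.graded_iso_from_coordinates[of ?\<Delta> ?N' ?i "free_grading n" presentation])
    show "inj_on ?\<Delta> (carrier ?N')"
    proof (rule inj_onI)
      fix u v assume uv: "u \<in> carrier ?N'" "v \<in> carrier ?N'" "?\<Delta> u = ?\<Delta> v"
      have "?\<Delta> u = ?\<Delta> (\<lambda>p. u p - v p) + ?\<Delta> v"
        unfolding \<theta>.hom_add[symmetric] row_sum_add[symmetric] by simp
      then have "?\<Delta> (\<lambda>p. u p - v p) + (\<Sum>q<d - n. \<beta> q * \<rho> ((\<lambda>_. 0) q)) = 0"
        using uv(3) by (simp add: \<rho>.hom_zero)
      then have eq: "(\<forall>p<n. u p - v p = 0) \<and> (\<forall>q<d - n. (\<lambda>_. 0 :: (3, 'k) mpoly) q = 0)" by (rule indep)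
      have mem: "u \<in> {..<n} \<rightarrow>\<^sub>E UNIV" "v \<in> {..<n} \<rightarrow>\<^sub>E UNIV"
        using uv(1,2) unfolding N' by blast+
      show "u = v" by (rule PiE_ext[OF mem]) (use eq in simp)
    qed
    show "?\<Delta> ` carrier ?N' = E.model ` rees_row E GE ?i"
      unfolding model_row_E
    proof (intro equalityI subsetI)
      fix w assume "w \<in> \<theta> ` forms ?i"
      then obtain s where s: "s \<in> forms ?i" "w = \<theta> s" by blast
      let ?u = "restrict (\<lambda>p. lookup s (monom2 p (n - 1 - p))) {..<n}"
      have "w = ?\<Delta> ?u" unfolding \<Delta>_restrict s(2) by (simp only: form_is_row_sum[OF s(1)])
      moreover have "?u \<in> carrier ?N'" by (simp add: N')
      ultimately show "w \<in> ?\<Delta> ` carrier ?N'" by blast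
    qed (use row_sum_forms in blast)
    show "?\<Delta> ` free_grading n j = E.model ` rees_part E GE ?i j" for j
      unfolding model_part_E free_grading_def
    proof (intro equalityI subsetI)
      fix w assume "w \<in> ?\<Delta> ` ({..<n} \<rightarrow>\<^sub>E forms j)"
      then obtain u where u: "u \<in> {..<n} \<rightarrow>\<^sub>E forms j" "w = ?\<Delta> u" by blast
      then have "row_sum n u \<in> twisted (\<lambda>_. 0) j" by (intro row_sum_twisted) (auto simp: PiE_mem)
      then show "w \<in> \<theta> ` {s. s \<in> forms ?i \<and> s \<in> twisted (\<lambda>_. 0) j}"
        using row_sum_forms u(2) by blast
    next
      fix w assume "w \<in> \<theta> ` {s. s \<in> forms ?i \<and> s \<in> twisted (\<lambda>_. 0) j}"
      then obtain s where s: "s \<in> forms ?i" "s \<in> twisted (\<lambda>_. 0) j" "w = \<theta> s" by blast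
      let ?u = "restrict (\<lambda>p. lookup s (monom2 p (n - 1 - p))) {..<n}"
      have "w = ?\<Delta> ?u" unfolding \<Delta>_restrict s(3) by (simp only: form_is_row_sum[OF s(1)])
      moreover have "?u \<in> {..<n} \<rightarrow>\<^sub>E forms j" using s(2) by (auto simp: twisted_def)
      ultimately show "w \<in> ?\<Delta> ` ({..<n} \<rightarrow>\<^sub>E forms j)" by blast
    qed
    show "free_grading n j \<subseteq> carrier ?N'" for j unfolding N' free_grading_def by (auto simp: PiE_iff)
    show "u \<oplus>\<^bsub>?N'\<^esub> v \<in> carrier ?N' \<and> ?\<Delta> (u \<oplus>\<^bsub>?N'\<^esub> v) = ?\<Delta> u + ?\<Delta> v" for u v
      using \<Delta>_restrict[of "\<lambda>p. u p + v p"] by (simp add: free_module_def row_sum_add \<theta>.hom_add)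
    show "r \<odot>\<^bsub>?N'\<^esub> u \<in> carrier ?N' \<and> ?\<Delta> (r \<odot>\<^bsub>?N'\<^esub> u) = E.model (presentation r) * ?\<Delta> u" for r u
      using \<Delta>_restrict[of "\<lambda>p. r * u p"]
      by (simp add: free_module_def row_sum_smult \<theta>.hom_mult \<theta>_mconst model_presentation)
    show "presentation r \<in> carrier (rees E)" for r by (rule presentation_closed)
  qed blast
  from row_iso_F obtain \<Psi> where \<Psi>: "graded_module_iso (rees_row_module F GF ?i (\<lambda>u. \<iota> (presentation u))) (rees_part F GF ?i) ?N ?H \<Psi>"
    "\<And>A x. A \<in> rees_row F GF ?i \<Longrightarrow> x \<in> carrier ?N \<Longrightarrow> \<Gamma> x = F.model A \<Longrightarrow> \<Psi> A = x" by blast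
  from row_iso_E obtain \<Theta> where \<Theta>: "graded_module_iso (rees_row_module E GE ?i presentation) (rees_part E GE ?i) ?N' (free_grading n) \<Theta>"
    "\<And>A x. A \<in> rees_row E GE ?i \<Longrightarrow> x \<in> carrier ?N' \<Longrightarrow> ?\<Delta> x = E.model A \<Longrightarrow> \<Theta> A = x" by blast
  have "\<iota> A \<in> rees_row F GF ?i \<and> \<Psi> (\<iota> A) = (\<Theta> A, \<zero>\<^bsub>free_module (d - n)\<^esub>)" if A: "A \<in> rees_row E GE ?i" for A
  proof
    have carr: "A \<in> carrier (rees E)" by (rule E.row_in_carrier[OF A])
    have "E.model A \<in> \<theta> ` forms ?i" using A model_row_E by blast
    then obtain s where s: "s \<in> forms ?i" "E.model A = \<theta> s" by blast
    let ?u = "restrict (\<lambda>p. lookup s (monom2 p (n - 1 - p))) {..<n}"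
    have u: "?\<Delta> ?u = E.model A" unfolding \<Delta>_restrict s(2) by (simp only: form_is_row_sum[OF s(1)])
    have "F.model (\<iota> A) \<in> F.model ` rees_row F GF ?i"
      unfolding model_row_F model_\<iota>[OF carr] s(2) by (rule \<theta>_row[OF s(1)])
    then show row: "\<iota> A \<in> rees_row F GF ?i"
      using F.row_iff \<iota>_closed[OF carr] by blast
    have \<Theta>A: "\<Theta> A = ?u" by (rule \<Theta>(2)[OF A _ u]) (simp add: N')
    have "\<Psi> (\<iota> A) = (?u, restrict (\<lambda>_. 0) {..<d - n})"
    proof (rule \<Psi>(2)[OF row])
      have "B (restrict (\<lambda>_. 0) {..<d - n}) = 0" by (simp add: B_def \<rho>.hom_zero)
      then show "\<Gamma> (?u, restrict (\<lambda>_. 0) {..<d - n}) = F.model (\<iota> A)"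
        unfolding \<Gamma>_def prod.case model_\<iota>[OF carr] u by simp
    qed (simp add: N)
    then show "\<Psi> (\<iota> A) = (\<Theta> A, \<zero>\<^bsub>free_module (d - n)\<^esub>)"
      by (simp add: \<Theta>A free_module_def)
  qed
  with \<Psi>(1) \<Theta>(1) show ?thesis by blast
qed

end

section \<open>The cokernel of a column and its bidual\<close>

definition coker_class :: "'r::comm_ring_1 ^ 'n \<Rightarrow> 'r ^ 'n \<Rightarrow> ('r ^ 'n) set" where
  "coker_class c v = range (\<lambda>r. r *s c) +>\<^bsub>vec_module\<^esub> v"

lemma coker_class_eq: "coker_class c v = {r *s c + v | r. True}"
  by (auto simp: coker_class_def a_r_coset_def r_coset_def vec_module_def)

lemma coker_class_eq_iff: "coker_class c v = coker_class c w \<longleftrightarrow> (\<exists>r. v = w + r *s c)"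
proof
  assume "coker_class c v = coker_class c w"
  moreover have "v \<in> coker_class c v" unfolding coker_class_eq by (intro CollectI exI[of _ 0]) simp
  ultimately have "v \<in> coker_class c w" by simp
  then show "\<exists>r. v = w + r *s c" unfolding coker_class_eq by (auto simp: add.commute)
next
  assume "\<exists>r. v = w + r *s c"
  then obtain r where r: "v = w + r *s c" by blast
  show "coker_class c v = coker_class c w" unfolding coker_class_eq
  proof (intro equalityI subsetI)
    fix x assume "x \<in> {s *s c + v | s. True}"
    then obtain s where "x = s *s c + v" by blast
    then have "x = (s + r) *s c + w" by (simp add: r vec_eq_iff algebra_simps)
    then show "x \<in> {s *s c + w | s. True}" by blast
  next
    fix x assume "x \<in> {s *s c + w | s. True}"
    then obtain s where "x = s *s c + w" by blast
    then have "x = (s - r) *s c + v" by (simp add: r vec_eq_iff algebra_simps)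
    then show "x \<in> {s *s c + v | s. True}" by blast
  qed
qed

lemma coker_gen_eq: "coker_gen c l = coker_class c (axis l 1)"
  by (simp add: coker_gen_def coker_class_def)

lemma carrier_coker: "carrier (coker_module c) = range (coker_class c)"
  by (auto simp: coker_module_def quot_module_def A_RCOSETS_def' coker_class_def vec_module_def)

lemma coker_add: "coker_class c v \<oplus>\<^bsub>coker_module c\<^esub> coker_class c w = coker_class c (v + w)"
proof -
  have "coker_class c v \<oplus>\<^bsub>coker_module c\<^esub> coker_class c w = {x + y | x y. x \<in> coker_class c v \<and> y \<in> coker_class c w}"
    by (auto simp: coker_module_def quot_module_def set_add_def' vec_module_def)
  also have "\<dots> = coker_class c (v + w)"
  proof (intro equalityI subsetI)
    fix z assume "z \<in> {x + y | x y. x \<in> coker_class c v \<and> y \<in> coker_class c w}"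
    then obtain r s where "z = (r *s c + v) + (s *s c + w)" by (auto simp: coker_class_eq)
    then have "z = (r + s) *s c + (v + w)" by (simp add: vec_eq_iff algebra_simps)
    then show "z \<in> coker_class c (v + w)" unfolding coker_class_eq by blast
  next
    fix z assume "z \<in> coker_class c (v + w)"
    then obtain r where "z = (r *s c + v) + (0 *s c + w)" by (auto simp: coker_class_eq add.assoc)
    then show "z \<in> {x + y | x y. x \<in> coker_class c v \<and> y \<in> coker_class c w}"
      unfolding coker_class_eq by blast
  qed
  finally show ?thesis .
qed

lemma coker_smult: "r \<odot>\<^bsub>coker_module c\<^esub> coker_class c v = coker_class c (r *s v)"
proof -
  have "r \<odot>\<^bsub>coker_module c\<^esub> coker_class c v = (\<Union>x\<in>coker_class c v. coker_class c (r *s x))"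
    by (simp add: coker_module_def quot_module_def vec_module_def coker_class_def)
  moreover have "coker_class c (r *s x) = coker_class c (r *s v)" if x: "x \<in> coker_class c v" for x
  proof -
    obtain s where s: "x = s *s c + v" using x by (auto simp: coker_class_eq)
    show ?thesis unfolding coker_class_eq_iff
      by (rule exI[of _ "r * s"]) (simp add: s vec_eq_iff algebra_simps)
  qed
  moreover have "v \<in> coker_class c v" unfolding coker_class_eq by (intro CollectI exI[of _ 0]) simp
  ultimately show ?thesis by blast
qed

text \<open>The part of the module axioms on which the constructions of duals and Rees algebras rely.\<close>

definition closed_operations :: "('r, 'm) module \<Rightarrow> bool" where
  "closed_operations M \<longleftrightarrow> (\<forall>x\<in>carrier M. \<forall>y\<in>carrier M. x \<oplus>\<^bsub>M\<^esub> y \<in> carrier M) \<and>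
     (\<forall>r. \<forall>x\<in>carrier M. r \<odot>\<^bsub>M\<^esub> x \<in> carrier M)"

lemma closed_operationsD:
  assumes "closed_operations M"
  shows "x \<in> carrier M \<Longrightarrow> y \<in> carrier M \<Longrightarrow> x \<oplus>\<^bsub>M\<^esub> y \<in> carrier M"
    and "x \<in> carrier M \<Longrightarrow> r \<odot>\<^bsub>M\<^esub> x \<in> carrier M"
  using assms by (auto simp: closed_operations_def)

lemma coker_closed: "closed_operations (coker_module c)"
  by (auto simp: closed_operations_def carrier_coker coker_add coker_smult)

lemma coker_grading_eq:
  fixes c :: "('v, 'k::comm_ring_1) mpoly ^ 'n"
  shows "coker_grading c j = coker_class c ` {v. \<forall>l. v $ l \<in> forms j}"
  by (simp add: coker_grading_def quot_grading_def coker_class_def)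

subsection \<open>Duals\<close>

lemma dual_carrierD:
  assumes "f \<in> carrier (dual M)"
  shows "x \<in> carrier M \<Longrightarrow> y \<in> carrier M \<Longrightarrow> f (x \<oplus>\<^bsub>M\<^esub> y) = f x + f y"
    and "x \<in> carrier M \<Longrightarrow> f (r \<odot>\<^bsub>M\<^esub> x) = r * f x"
    and "f \<in> extensional (carrier M)"
  using assms by (auto simp: dual_def module_homs_def regular_module_def PiE_def)

lemma dual_carrierI:
  assumes "f \<in> extensional (carrier M)"
    and "\<And>x y. x \<in> carrier M \<Longrightarrow> y \<in> carrier M \<Longrightarrow> f (x \<oplus>\<^bsub>M\<^esub> y) = f x + f y"
    and "\<And>r x. x \<in> carrier M \<Longrightarrow> f (r \<odot>\<^bsub>M\<^esub> x) = r * f x"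
  shows "f \<in> carrier (dual M)"
  using assms by (auto simp: dual_def module_homs_def regular_module_def PiE_def)

lemma dual_ops [simp]:
  "f \<oplus>\<^bsub>dual M\<^esub> g = (\<lambda>x\<in>carrier M. f x + g x)" "r \<odot>\<^bsub>dual M\<^esub> f = (\<lambda>x\<in>carrier M. r * f x)"
  by (simp_all add: dual_def)

lemma dual_closed:
  assumes M: "closed_operations M"
  shows "closed_operations (dual M)"
proof -
  have "f \<oplus>\<^bsub>dual M\<^esub> g \<in> carrier (dual M)" if "f \<in> carrier (dual M)" "g \<in> carrier (dual M)" for f g
    by (rule dual_carrierI) (simp_all add: closed_operationsD[OF M] dual_carrierD[OF that(1)] dual_carrierD[OF that(2)] algebra_simps)
  moreover have "r \<odot>\<^bsub>dual M\<^esub> f \<in> carrier (dual M)" if "f \<in> carrier (dual M)" for r f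
    by (rule dual_carrierI) (simp_all add: closed_operationsD[OF M] dual_carrierD[OF that] algebra_simps)
  ultimately show ?thesis by (simp add: closed_operations_def del: dual_ops)
qed

lemma to_bidual_closed:
  assumes M: "closed_operations M" and x: "x \<in> carrier M"
  shows "to_bidual M x \<in> carrier (dual (dual M))"
proof (rule dual_carrierI)
  show "to_bidual M x \<in> extensional (carrier (dual M))" by (simp add: to_bidual_def)
next
  fix f g assume "f \<in> carrier (dual M)" "g \<in> carrier (dual M)"
  then show "to_bidual M x (f \<oplus>\<^bsub>dual M\<^esub> g) = to_bidual M x f + to_bidual M x g"
    using closed_operationsD(1)[OF dual_closed[OF M], of f g] x by (simp add: to_bidual_def)
next
  fix r f assume "f \<in> carrier (dual M)"
  then show "to_bidual M x (r \<odot>\<^bsub>dual M\<^esub> f) = r * to_bidual M x f"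
    using closed_operationsD(2)[OF dual_closed[OF M], of f r] x by (simp add: to_bidual_def)
qed

lemma to_bidual_add:
  "x \<in> carrier M \<Longrightarrow> y \<in> carrier M \<Longrightarrow> to_bidual M (x \<oplus>\<^bsub>M\<^esub> y) = to_bidual M x \<oplus>\<^bsub>dual (dual M)\<^esub> to_bidual M y"
  by (auto simp: to_bidual_def restrict_def fun_eq_iff dual_carrierD(1))

lemma to_bidual_smult:
  "x \<in> carrier M \<Longrightarrow> to_bidual M (r \<odot>\<^bsub>M\<^esub> x) = r \<odot>\<^bsub>dual (dual M)\<^esub> to_bidual M x"
  by (auto simp: to_bidual_def restrict_def fun_eq_iff dual_carrierD(2))

lemma to_bidual_graded:
  assumes "to_bidual M x \<in> carrier (dual (dual M))" "x \<in> G b"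
  shows "to_bidual M x \<in> dual_grading (dual M) (dual_grading M G) b"
proof -
  have "to_bidual M x f \<in> forms (i + b)" if "f \<in> dual_grading M G i" for f i
    using that assms(2) by (auto simp: dual_grading_def to_bidual_def add.commute)
  then show ?thesis using assms(1) unfolding dual_grading_def[of "dual M"] by blast
qed

text \<open>The scalar product with \<open>u\<close> is taken on an arbitrary representative; it descends to the cokernel
  when \<open>u\<close> is orthogonal to the column.\<close>

definition coker_functional :: "'r::comm_ring_1 ^ 'n \<Rightarrow> ('n \<Rightarrow> 'r) \<Rightarrow> ('r ^ 'n) set \<Rightarrow> 'r" where
  "coker_functional c u = (\<lambda>x\<in>carrier (coker_module c). \<Sum>l\<in>UNIV. (SOME v. coker_class c v = x) $ l * u l)"

lemma coker_functional_class:
  fixes c :: "'r::comm_ring_1 ^ 'n"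
  assumes "(\<Sum>l\<in>UNIV. c $ l * u l) = 0"
  shows "coker_functional c u (coker_class c v) = (\<Sum>l\<in>UNIV. v $ l * u l)"
proof -
  let ?w = "SOME w. coker_class c w = coker_class c v"
  have "coker_class c ?w = coker_class c v" by (rule someI[of _ v]) simp
  then obtain r where "?w = v + r *s c" by (auto simp: coker_class_eq_iff)
  then have "(\<Sum>l\<in>UNIV. ?w $ l * u l) = (\<Sum>l\<in>UNIV. v $ l * u l) + r * (\<Sum>l\<in>UNIV. c $ l * u l)"
    by (simp add: distrib_right sum.distrib sum_distrib_left mult.assoc)
  then show ?thesis using assms by (simp add: coker_functional_def carrier_coker)
qed

lemma coker_functional_dual:
  fixes c :: "'r::comm_ring_1 ^ 'n"
  assumes "(\<Sum>l\<in>UNIV. c $ l * u l) = 0"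
  shows "coker_functional c u \<in> carrier (dual (coker_module c))"
proof (rule dual_carrierI)
  show "coker_functional c u \<in> extensional (carrier (coker_module c))" by (simp add: coker_functional_def)
  show "coker_functional c u (x \<oplus>\<^bsub>coker_module c\<^esub> y) = coker_functional c u x + coker_functional c u y"
    if "x \<in> carrier (coker_module c)" "y \<in> carrier (coker_module c)" for x y
    using that by (auto simp: carrier_coker coker_add coker_functional_class[OF assms] distrib_right sum.distrib)
  show "coker_functional c u (r \<odot>\<^bsub>coker_module c\<^esub> x) = r * coker_functional c u x"
    if "x \<in> carrier (coker_module c)" for r x
    using that by (auto simp: carrier_coker coker_smult coker_functional_class[OF assms] sum_distrib_left mult.assoc)
qed

subsection \<open>A basis of the syzygies of three forms\<close>

text \<open>The Hilbert-Burch theorem for a generating pair of syzygies. The cross product \<open>\<eta>\<close> of the rows is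
  parallel to \<open>a\<close>, hence \<open>\<eta> = \<mu> a\<close> by torsion-freeness. Conversely, the Koszul syzygies are combinations of
  the rows, and the cross product of two of them is \<open>a_r a\<close>; therefore \<open>a_r a = \<delta>_r \<eta>\<close>, where \<open>\<delta>_r\<close> is the
  determinant of the coefficients. So \<open>a_r = \<mu> \<delta>_r\<close>, and torsion-freeness again makes \<open>a\<close> a multiple of
  \<open>\<eta>\<close>. Comparing degrees in both directions gives the first claim. For the second claim, \<open>\<eta> l\<close> is the
  triple product of the rows with a basis vector.\<close>

lemma syzygy_basis_degrees:
  fixes a :: "3 \<Rightarrow> ('v::linorder, 'k::field) mpoly" and \<xi> :: "2 \<Rightarrow> 3 \<Rightarrow> ('v, 'k) mpoly"
  assumes a: "\<And>l. a l \<in> forms (int d)" "\<exists>l. a l \<noteq> 0"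
    and \<xi>: "\<And>i l. \<xi> i l \<in> forms (int (\<sigma> i))"
    and orth: "\<And>i. (\<Sum>l\<in>UNIV. a l * \<xi> i l) = 0"
    and torsionfree: "\<And>h r v. h \<noteq> 0 \<Longrightarrow> (\<And>l. h * v l = r * a l) \<Longrightarrow> \<exists>z. \<forall>l. v l = z * a l"
    and generate: "\<And>u. (\<Sum>l\<in>UNIV. a l * u l) = 0 \<Longrightarrow> \<exists>b. \<forall>l. u l = (\<Sum>i\<in>UNIV. b i * \<xi> i l)"
  shows "\<sigma> 1 + \<sigma> 2 = d"
    and "\<exists>h v. h \<noteq> 0 \<and> (\<forall>i j. (\<Sum>l\<in>UNIV. v i l * \<xi> j l) = (if i = j then h else 0))"
proof -
  define \<eta> where "\<eta> = (\<lambda>l::3. if l = 1 then \<xi> 1 2 * \<xi> 2 3 - \<xi> 1 3 * \<xi> 2 2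
      else if l = 2 then \<xi> 1 3 * \<xi> 2 1 - \<xi> 1 1 * \<xi> 2 3 else \<xi> 1 1 * \<xi> 2 2 - \<xi> 1 2 * \<xi> 2 1)"
  have \<eta>: "\<eta> 1 = \<xi> 1 2 * \<xi> 2 3 - \<xi> 1 3 * \<xi> 2 2" "\<eta> 2 = \<xi> 1 3 * \<xi> 2 1 - \<xi> 1 1 * \<xi> 2 3"
    "\<eta> 3 = \<xi> 1 1 * \<xi> 2 2 - \<xi> 1 2 * \<xi> 2 1"
    by (simp_all add: \<eta>_def)
  have o: "a 1 * \<xi> i 1 + a 2 * \<xi> i 2 + a 3 * \<xi> i 3 = 0" for i
    using orth[of i] by (simp add: sum_3)
  have par: "a 1 * \<eta> 2 = a 2 * \<eta> 1" "a 1 * \<eta> 3 = a 3 * \<eta> 1" "a 2 * \<eta> 3 = a 3 * \<eta> 2"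
  proof -
    have "a 1 * \<eta> 2 - a 2 * \<eta> 1 = \<xi> 1 3 * (a 1 * \<xi> 2 1 + a 2 * \<xi> 2 2 + a 3 * \<xi> 2 3) - \<xi> 2 3 * (a 1 * \<xi> 1 1 + a 2 * \<xi> 1 2 + a 3 * \<xi> 1 3)"
      "a 3 * \<eta> 1 - a 1 * \<eta> 3 = \<xi> 1 2 * (a 1 * \<xi> 2 1 + a 2 * \<xi> 2 2 + a 3 * \<xi> 2 3) - \<xi> 2 2 * (a 1 * \<xi> 1 1 + a 2 * \<xi> 1 2 + a 3 * \<xi> 1 3)"
      "a 2 * \<eta> 3 - a 3 * \<eta> 2 = \<xi> 1 1 * (a 1 * \<xi> 2 1 + a 2 * \<xi> 2 2 + a 3 * \<xi> 2 3) - \<xi> 2 1 * (a 1 * \<xi> 1 1 + a 2 * \<xi> 1 2 + a 3 * \<xi> 1 3)"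
      unfolding \<eta> by (simp_all add: algebra_simps)
    then show "a 1 * \<eta> 2 = a 2 * \<eta> 1" "a 1 * \<eta> 3 = a 3 * \<eta> 1" "a 2 * \<eta> 3 = a 3 * \<eta> 2"
      by (simp_all add: o)
  qed
  obtain m where m: "a m \<noteq> 0" using a(2) by blast
  have "a m * \<eta> l = \<eta> m * a l" for l
  proof -
    have "\<forall>m. \<forall>l. a m * \<eta> l = \<eta> m * a l"
      unfolding forall_3 using par by (simp add: mult.commute)
    then show ?thesis by blast
  qed
  then obtain \<mu> where \<mu>: "\<And>l. \<eta> l = \<mu> * a l" using torsionfree[OF m] by blast
  have gen: "\<exists>b :: 2 \<Rightarrow> _. x = b 1 * \<xi> 1 1 + b 2 * \<xi> 2 1 \<and> y = b 1 * \<xi> 1 2 + b 2 * \<xi> 2 2 \<and> z = b 1 * \<xi> 1 3 + b 2 * \<xi> 2 3"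
    if xyz: "a 1 * x + a 2 * y + a 3 * z = 0" for x y z
  proof -
    define u where "u = (\<lambda>l::3. if l = 1 then x else if l = 2 then y else z)"
    have u: "u 1 = x" "u 2 = y" "u 3 = z" by (simp_all add: u_def)
    have "(\<Sum>l\<in>UNIV. a l * u l) = 0" using xyz by (simp add: sum_3 u)
    then obtain b where b: "\<forall>l. u l = (\<Sum>i\<in>UNIV. b i * \<xi> i l)" using generate by blast
    show ?thesis
      using b[rule_format, of 1] b[rule_format, of 2] b[rule_format, of 3]
      unfolding u sum_2 by (intro exI[of _ b]) simp
  qed
  \<comment> \<open>The three Koszul syzygies \<open>(0, a_3, - a_2)\<close>, \<open>(- a_3, 0, a_1)\<close> and \<open>(a_2, - a_1, 0)\<close>.\<close>
  have "a 1 * 0 + a 2 * a 3 + a 3 * - a 2 = 0" "a 1 * - a 3 + a 2 * 0 + a 3 * a 1 = 0" "a 1 * a 2 + a 2 * - a 1 + a 3 * 0 = 0"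
    by (simp_all add: mult.commute)
  from this[THEN gen] obtain b1 b2 b3 :: "2 \<Rightarrow> ('v, 'k) mpoly" where
    b1: "0 = b1 1 * \<xi> 1 1 + b1 2 * \<xi> 2 1" "a 3 = b1 1 * \<xi> 1 2 + b1 2 * \<xi> 2 2" "- a 2 = b1 1 * \<xi> 1 3 + b1 2 * \<xi> 2 3"
    and b2: "- a 3 = b2 1 * \<xi> 1 1 + b2 2 * \<xi> 2 1" "0 = b2 1 * \<xi> 1 2 + b2 2 * \<xi> 2 2" "a 1 = b2 1 * \<xi> 1 3 + b2 2 * \<xi> 2 3"
    and b3: "a 2 = b3 1 * \<xi> 1 1 + b3 2 * \<xi> 2 1" "- a 1 = b3 1 * \<xi> 1 2 + b3 2 * \<xi> 2 2" "0 = b3 1 * \<xi> 1 3 + b3 2 * \<xi> 2 3"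
    by blast
  define \<delta> where "\<delta> = (\<lambda>l::3. if l = 1 then b2 1 * b3 2 - b2 2 * b3 1
     else if l = 2 then b3 1 * b1 2 - b3 2 * b1 1 else b1 1 * b2 2 - b1 2 * b2 1)"
  have mixed: "a 1 * a l = \<delta> 1 * \<eta> l \<and> a 2 * a l = \<delta> 2 * \<eta> l \<and> a 3 * a l = \<delta> 3 * \<eta> l" for l
  proof -
    have d: "\<delta> 1 = b2 1 * b3 2 - b2 2 * b3 1" "\<delta> 2 = b3 1 * b1 2 - b3 2 * b1 1" "\<delta> 3 = b1 1 * b2 2 - b1 2 * b2 1"
      by (simp_all add: \<delta>_def)
    have cross: "(p * s - q * r) * (x * y' - x' * y) = (p * x + q * y) * (r * x' + s * y') - (p * x' + q * y') * (r * x + s * y)"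
      for p q r s x x' y y' :: "('v, 'k) mpoly"
      by (simp add: algebra_simps)
    have "a 1 * a 1 = \<delta> 1 * \<eta> 1" "a 1 * a 2 = \<delta> 1 * \<eta> 2" "a 1 * a 3 = \<delta> 1 * \<eta> 3"
      unfolding \<eta> d cross b2[symmetric] b3[symmetric] by (simp_all add: mult.commute)
    moreover have "a 2 * a 1 = \<delta> 2 * \<eta> 1" "a 2 * a 2 = \<delta> 2 * \<eta> 2" "a 2 * a 3 = \<delta> 2 * \<eta> 3"
      unfolding \<eta> d cross b1[symmetric] b3[symmetric] by (simp_all add: mult.commute)
    moreover have "a 3 * a 1 = \<delta> 3 * \<eta> 1" "a 3 * a 2 = \<delta> 3 * \<eta> 2" "a 3 * a 3 = \<delta> 3 * \<eta> 3"
      unfolding \<eta> d cross b1[symmetric] b2[symmetric] by (simp_all add: mult.commute)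
    ultimately show ?thesis using forall_3[of "\<lambda>l. a 1 * a l = \<delta> 1 * \<eta> l \<and> a 2 * a l = \<delta> 2 * \<eta> l \<and> a 3 * a l = \<delta> 3 * \<eta> l"]
      by blast
  qed
  have all3: "a r * a l = \<delta> r * \<eta> l" for r l
    using mixed[of l] forall_3[of "\<lambda>r. a r * a l = \<delta> r * \<eta> l"] by blast
  have "a r * a m = (\<mu> * \<delta> r) * a m" for r
    unfolding all3[of r m] \<mu>[of m] by (simp only: mult_ac)
  then have \<delta>: "\<mu> * \<delta> r = 1 * a r" for r using m by simp
  have "\<mu> \<noteq> 0" using \<delta>[of m] m by auto
  then obtain z where "\<And>l. \<delta> l = z * a l" using torsionfree \<delta> by blast
  then have "a m = z * \<eta> m" using \<delta>[of m] \<mu>[of m] by (simp add: mult_ac)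
  have \<eta>_forms: "\<eta> l \<in> forms (int (\<sigma> 1 + \<sigma> 2))" for l
    using exhaust_3[of l] by (elim disjE) (simp_all add: \<eta> diff_forms mult_forms'[OF \<xi> \<xi>])
  have "\<eta> m \<noteq> 0" using \<open>\<mu> \<noteq> 0\<close> \<mu>[of m] m by simp
  show "\<sigma> 1 + \<sigma> 2 = d"
  proof (rule antisym)
    have am: "\<eta> m * z = a m" using \<open>a m = z * \<eta> m\<close> by (simp only: mult.commute)
    have "a m = hom_component (int d) (\<eta> m * z)"
      unfolding am by (simp add: hom_component_of_form[OF a(1)])
    also have "\<dots> = \<eta> m * hom_component (int d - int (\<sigma> 1 + \<sigma> 2)) z"
      by (rule hom_component_mult_form[OF \<eta>_forms])
    finally have "a m = \<eta> m * hom_component (int d - int (\<sigma> 1 + \<sigma> 2)) z" .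
    then show "\<sigma> 1 + \<sigma> 2 \<le> d" using m hom_component_neg[of "int d - int (\<sigma> 1 + \<sigma> 2)" z] by fastforce
    have \<eta>m: "a m * \<mu> = \<eta> m" using \<mu>[of m] by (simp only: mult.commute)
    have "\<eta> m = hom_component (int (\<sigma> 1 + \<sigma> 2)) (a m * \<mu>)"
      unfolding \<eta>m by (simp add: hom_component_of_form[OF \<eta>_forms])
    also have "\<dots> = a m * hom_component (int (\<sigma> 1 + \<sigma> 2) - int d) \<mu>"
      by (rule hom_component_mult_form[OF a(1)])
    finally have "\<eta> m = a m * hom_component (int (\<sigma> 1 + \<sigma> 2) - int d) \<mu>" .
    then show "d \<le> \<sigma> 1 + \<sigma> 2"
      using \<open>\<eta> m \<noteq> 0\<close> hom_component_neg[of "int (\<sigma> 1 + \<sigma> 2) - int d" \<mu>] by fastforce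
  qed
  have two: "(\<Sum>l\<in>UNIV. v i l * \<xi> j l) = (if i = j then h else 0)"
    if "v 1 1 * \<xi> 1 1 + v 1 2 * \<xi> 1 2 + v 1 3 * \<xi> 1 3 = h" "v 1 1 * \<xi> 2 1 + v 1 2 * \<xi> 2 2 + v 1 3 * \<xi> 2 3 = 0"
      "v 2 1 * \<xi> 1 1 + v 2 2 * \<xi> 1 2 + v 2 3 * \<xi> 1 3 = 0" "v 2 1 * \<xi> 2 1 + v 2 2 * \<xi> 2 2 + v 2 3 * \<xi> 2 3 = h"
    for v :: "2 \<Rightarrow> 3 \<Rightarrow> ('v, 'k) mpoly" and h i j
    using that exhaust_2[of i] exhaust_2[of j] by (elim disjE) (simp_all add: sum_3)
  consider "m = 1" | "m = 2" | "m = 3" using exhaust_3[of m] by blast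
  then show "\<exists>h v. h \<noteq> 0 \<and> (\<forall>i j. (\<Sum>l\<in>UNIV. v i l * \<xi> j l) = (if i = j then h else 0))"
  proof cases
    case 1
    let ?v = "\<lambda>(i::2) (l::3). if i = 1 then (if l = 1 then 0 else if l = 2 then \<xi> 2 3 else - \<xi> 2 2)
      else (if l = 1 then 0 else if l = 2 then - \<xi> 1 3 else \<xi> 1 2)"
    have "\<eta> 1 \<noteq> 0" using \<open>\<eta> m \<noteq> 0\<close> 1 by simp
    moreover have "\<forall>i j. (\<Sum>l\<in>UNIV. ?v i l * \<xi> j l) = (if i = j then \<eta> 1 else 0)"
      by (intro allI two) (simp_all add: \<eta> algebra_simps)
    ultimately show ?thesis by (intro exI[of _ "\<eta> 1"] exI[of _ ?v] conjI)
  next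
    case 2
    let ?v = "\<lambda>(i::2) (l::3). if i = 1 then (if l = 1 then - \<xi> 2 3 else if l = 2 then 0 else \<xi> 2 1)
      else (if l = 1 then \<xi> 1 3 else if l = 2 then 0 else - \<xi> 1 1)"
    have "\<eta> 2 \<noteq> 0" using \<open>\<eta> m \<noteq> 0\<close> 2 by simp
    moreover have "\<forall>i j. (\<Sum>l\<in>UNIV. ?v i l * \<xi> j l) = (if i = j then \<eta> 2 else 0)"
      by (intro allI two) (simp_all add: \<eta> algebra_simps)
    ultimately show ?thesis by (intro exI[of _ "\<eta> 2"] exI[of _ ?v] conjI)
  next
    case 3
    let ?v = "\<lambda>(i::2) (l::3). if i = 1 then (if l = 1 then \<xi> 2 2 else if l = 2 then - \<xi> 2 1 else 0)
      else (if l = 1 then - \<xi> 1 2 else if l = 2 then \<xi> 1 1 else 0)"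
    have "\<eta> 3 \<noteq> 0" using \<open>\<eta> m \<noteq> 0\<close> 3 by simp
    moreover have "\<forall>i j. (\<Sum>l\<in>UNIV. ?v i l * \<xi> j l) = (if i = j then \<eta> 3 else 0)"
      by (intro allI two) (simp_all add: \<eta> algebra_simps)
    ultimately show ?thesis by (intro exI[of _ "\<eta> 3"] exI[of _ ?v] conjI)
  qed
qed

section \<open>Coordinates on the bidual\<close>

text \<open>The second part says that the cokernel of the column is torsion-free. If \<open>h v\<close> is a multiple of the
  column, then \<open>v\<close> is a syzygy of \<open>f\<close> and hence \<open>v = \<phi> z\<close>; injectivity of \<open>\<phi>\<close> kills the second entry of
  \<open>z\<close>.\<close>

lemma column_nonzero_torsionfree:
  fixes \<phi> :: "(2, 'k::field) mpoly ^ 2 ^ 3" and f :: "(2, 'k) mpoly ^ 3"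
  assumes inj: "inj ((*v) \<phi>)"
    and exact: "range ((*v) \<phi>) = {v. (\<Sum>l\<in>UNIV. v $ l * f $ l) = 0}"
  shows "\<exists>l. column 1 \<phi> $ l \<noteq> 0"
    and "h \<noteq> 0 \<Longrightarrow> (\<And>l. h * v l = r * column 1 \<phi> $ l) \<Longrightarrow> \<exists>z. \<forall>l. v l = z * column 1 \<phi> $ l"
proof -
  have mv: "(\<phi> *v z) $ l = \<phi> $ l $ 1 * z $ 1 + \<phi> $ l $ 2 * z $ 2" for z l
    by (simp add: matrix_vector_mult_def sum_2)
  have col: "column 1 \<phi> $ l = (\<phi> *v axis 1 1) $ l" for l
    by (simp add: mv column_def axis_def)
  show "\<exists>l. column 1 \<phi> $ l \<noteq> 0"
  proof (rule ccontr)
    assume "\<nexists>l. column 1 \<phi> $ l \<noteq> 0"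
    then have "\<phi> *v axis 1 1 = \<phi> *v 0" by (simp add: vec_eq_iff col)
    then have "axis 1 1 = (0 :: (2, 'k) mpoly ^ 2)" by (rule injD[OF inj])
    then have "(axis 1 1 :: (2, 'k) mpoly ^ 2) $ 1 = 0" by simp
    then show False by (simp add: axis_def)
  qed
  assume h: "h \<noteq> 0" and v: "\<And>l. h * v l = r * column 1 \<phi> $ l"
  have "\<phi> *v axis 1 1 \<in> {v. (\<Sum>l\<in>UNIV. v $ l * f $ l) = 0}" unfolding exact[symmetric] by blast
  then have cf: "(\<Sum>l\<in>UNIV. column 1 \<phi> $ l * f $ l) = 0" by (simp add: col)
  have "h * (\<Sum>l\<in>UNIV. v l * f $ l) = (\<Sum>l\<in>UNIV. (h * v l) * f $ l)"
    by (simp add: sum_distrib_left mult.assoc)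
  also have "\<dots> = r * (\<Sum>l\<in>UNIV. column 1 \<phi> $ l * f $ l)"
    unfolding v by (simp add: sum_distrib_left mult.assoc)
  finally have "(\<Sum>l\<in>UNIV. v l * f $ l) = 0" using h cf by simp
  then have "(\<chi> l. v l) \<in> range ((*v) \<phi>)" unfolding exact by simp
  then obtain z where z: "(\<chi> l. v l) = \<phi> *v z" by blast
  then have vz: "v l = \<phi> $ l $ 1 * z $ 1 + \<phi> $ l $ 2 * z $ 2" for l
    by (metis mv vec_lambda_beta)
  have "\<phi> *v (h *s z) = \<phi> *v (r *s axis 1 1)"
  proof (rule vec_eq_iff[THEN iffD2], rule allI)
    fix l
    have "(\<phi> *v (h *s z)) $ l = h * v l" by (simp add: mv vz algebra_simps)
    also have "\<dots> = (\<phi> *v (r *s axis 1 1)) $ l" by (simp add: v mv column_def axis_def)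
    finally show "(\<phi> *v (h *s z)) $ l = (\<phi> *v (r *s axis 1 1)) $ l" .
  qed
  then have "h *s z = r *s axis 1 1" by (rule injD[OF inj])
  from arg_cong[OF this, of "\<lambda>v :: (2, 'k) mpoly ^ 2. v $ 2"] have "z $ 2 = 0" using h by (simp add: axis_def)
  then show "\<exists>z. \<forall>l. v l = z * column 1 \<phi> $ l"
    by (intro exI[of _ "z $ 1"]) (simp add: vz column_def mult.commute)
qed

lemma linear_on_basis:
  fixes \<omega> :: "'r::comm_ring_1 ^ 'n \<Rightarrow> 'r"
  assumes add: "\<And>v w. \<omega> (v + w) = \<omega> v + \<omega> w" and smult: "\<And>r v. \<omega> (r *s v) = r * \<omega> v"
  shows "\<omega> v = (\<Sum>l\<in>UNIV. v $ l * \<omega> (axis l 1))"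
proof -
  have zero: "\<omega> 0 = 0" using add[of 0 0] by simp
  have "\<omega> (\<Sum>l\<in>B. v $ l *s axis l 1) = (\<Sum>l\<in>B. v $ l * \<omega> (axis l 1))" for B
    by (induction B rule: infinite_finite_induct) (simp_all add: add smult zero)
  then show ?thesis using basis_expansion[of v] by metis
qed

text \<open>Test with the Koszul syzygy that has the two entries \<open>a m\<close> and \<open>- a l\<close>.\<close>

lemma orthogonal_to_koszul:
  fixes a v :: "3 \<Rightarrow> 'r::idom"
  assumes "\<And>u. (\<Sum>l\<in>UNIV. a l * u l) = 0 \<Longrightarrow> (\<Sum>l\<in>UNIV. v l * u l) = 0"
  shows "a m * v l = v m * a l"
proof (cases "m = l")
  case False
  let ?u = "\<lambda>k. if k = l then a m else if k = m then - a l else 0"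
  have sum: "(\<Sum>k\<in>UNIV. b k * ?u k) = b l * a m - b m * a l" for b :: "3 \<Rightarrow> 'r"
  proof -
    have "(\<Sum>k\<in>UNIV. b k * ?u k) = (\<Sum>k\<in>{l, m}. b k * ?u k)"
      by (rule sum.mono_neutral_right) auto
    then show ?thesis using False by simp
  qed
  have "(\<Sum>k\<in>UNIV. a k * ?u k) = 0" unfolding sum by (simp add: mult.commute)
  then have "(\<Sum>k\<in>UNIV. v k * ?u k) = 0" by (rule assms)
  then show ?thesis unfolding sum by (simp add: mult.commute)
qed (simp add: mult.commute)

text \<open>The torsion-free cokernel of a column together with a graded isomorphism from its bidual to a free
  module of rank two.\<close>

locale rank_two_bidual =
  fixes c :: "(2, 'k::field) mpoly ^ 3" and d :: nat and \<sigma> :: "2 \<Rightarrow> nat"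
    and \<psi> :: "(((((2, 'k) mpoly ^ 3) set \<Rightarrow> (2, 'k) mpoly) \<Rightarrow> (2, 'k) mpoly) \<Rightarrow> (2, 'k) mpoly ^ 2)"
  assumes d: "0 < d" and c_forms: "c $ l \<in> forms (int d)" and c_nonzero: "\<exists>l. c $ l \<noteq> 0"
    and torsionfree: "h \<noteq> 0 \<Longrightarrow> (\<And>l. h * v l = r * c $ l) \<Longrightarrow> \<exists>z. \<forall>l. v l = z * c $ l"
    and \<psi>: "graded_module_iso (dual (dual (coker_module c)))
      (dual_grading (dual (coker_module c)) (dual_grading (coker_module c) (coker_grading c))) vec_module
      (\<lambda>j. {v. \<forall>i. v $ i \<in> forms (int (\<sigma> i) + j)}) \<psi>"
begin

abbreviation "E \<equiv> coker_module c"
abbreviation "GE \<equiv> coker_grading c"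
abbreviation "F \<equiv> dual (dual E)"
abbreviation "GF \<equiv> dual_grading (dual E) (dual_grading E GE)"
abbreviation "\<tau> \<equiv> to_bidual E"

lemmas E_closed = closed_operationsD[OF coker_closed[of c]]
lemmas F_closed = closed_operationsD[OF dual_closed[OF dual_closed[OF coker_closed[of c]]]]
lemmas \<tau>_closed = to_bidual_closed[OF coker_closed[of c]]

lemma coker_class_closed: "coker_class c v \<in> carrier E"
  by (auto simp: carrier_coker)

lemma \<psi>_add: "g \<in> carrier F \<Longrightarrow> g' \<in> carrier F \<Longrightarrow> \<psi> (g \<oplus>\<^bsub>F\<^esub> g') = \<psi> g + \<psi> g'"
  using \<psi> unfolding graded_module_iso_def module_homs_def vec_module_def by simp

lemma \<psi>_smult: "g \<in> carrier F \<Longrightarrow> \<psi> (r \<odot>\<^bsub>F\<^esub> g) = r *s \<psi> g"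
  using \<psi> unfolding graded_module_iso_def module_homs_def vec_module_def by simp

lemma \<psi>_bij: "bij_betw \<psi> (carrier F) UNIV"
  using \<psi> by (simp add: graded_module_iso_def vec_module_def)

lemma \<psi>_inj: "g \<in> carrier F \<Longrightarrow> g' \<in> carrier F \<Longrightarrow> \<psi> g = \<psi> g' \<Longrightarrow> g = g'"
  using \<psi>_bij by (auto simp: bij_betw_def dest: inj_onD)

lemma \<psi>_image: "\<psi> ` GF j = {v. \<forall>i. v $ i \<in> forms (int (\<sigma> i) + j)}"
  using \<psi> by (simp add: graded_module_iso_def)

lemma GF_subset: "GF j \<subseteq> carrier F"
  by (auto simp: dual_grading_def[of "dual E"])

definition \<omega> :: "2 \<Rightarrow> (2, 'k) mpoly ^ 3 \<Rightarrow> (2, 'k) mpoly" where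
  "\<omega> i v = \<psi> (\<tau> (coker_class c v)) $ i"

definition \<xi> :: "2 \<Rightarrow> 3 \<Rightarrow> (2, 'k) mpoly" where
  "\<xi> i l = \<omega> i (axis l 1)"

lemma \<omega>_eq: "\<omega> i v = (\<Sum>l\<in>UNIV. v $ l * \<xi> i l)"
  unfolding \<xi>_def
proof (rule linear_on_basis)
  show "\<omega> i (v + w) = \<omega> i v + \<omega> i w" for v w
    unfolding \<omega>_def coker_add[symmetric] to_bidual_add[OF coker_class_closed coker_class_closed]
      \<psi>_add[OF \<tau>_closed[OF coker_class_closed] \<tau>_closed[OF coker_class_closed]] by simp
  show "\<omega> i (r *s v) = r * \<omega> i v" for r v
    unfolding \<omega>_def coker_smult[symmetric] to_bidual_smult[OF coker_class_closed]
      \<psi>_smult[OF \<tau>_closed[OF coker_class_closed]] by simp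
qed

lemma \<xi>_forms: "\<xi> i l \<in> forms (int (\<sigma> i))"
proof -
  have "coker_class c (axis l 1) \<in> GE 0"
    unfolding coker_grading_eq by (intro imageI) (simp add: axis_def)
  then have "\<tau> (coker_class c (axis l 1)) \<in> GF 0"
    by (rule to_bidual_graded[OF \<tau>_closed[OF coker_class_closed]])
  then have "\<psi> (\<tau> (coker_class c (axis l 1))) \<in> {v. \<forall>i. v $ i \<in> forms (int (\<sigma> i) + 0)}"
    unfolding \<psi>_image[symmetric] by (rule imageI)
  then show ?thesis by (simp add: \<xi>_def \<omega>_def)
qed

lemma \<xi>_orthogonal: "(\<Sum>l\<in>UNIV. c $ l * \<xi> i l) = 0"
proof -
  have "coker_class c c = coker_class c (0 *s c)"
    unfolding coker_class_eq_iff by (rule exI[of _ 1]) (simp add: vec_eq_iff)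
  then have "\<omega> i c = \<omega> i (0 *s c)" by (simp add: \<omega>_def)
  then show ?thesis by (simp add: \<omega>_eq)
qed

text \<open>The map to the bidual is injective because the Koszul functionals separate the elements
  of the torsion-free module \<open>E\<close>.\<close>

lemma \<xi>_kernel:
  assumes "\<And>i. (\<Sum>l\<in>UNIV. v l * \<xi> i l) = 0"
  shows "\<exists>r. \<forall>l. v l = r * c $ l"
proof -
  define w where "w = (\<chi> l. v l)"
  have "\<psi> (\<tau> (coker_class c w)) = \<psi> (\<tau> (coker_class c 0))"
    unfolding vec_eq_iff \<omega>_def[symmetric] \<omega>_eq using assms by (simp add: w_def)
  then have \<tau>_eq: "\<tau> (coker_class c w) = \<tau> (coker_class c 0)"
    by (rule \<psi>_inj[OF \<tau>_closed[OF coker_class_closed] \<tau>_closed[OF coker_class_closed]])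
  have koszul: "c $ m * v l = v m * c $ l" for m l
  proof (rule orthogonal_to_koszul)
    fix u :: "3 \<Rightarrow> (2, 'k) mpoly" assume u: "(\<Sum>l\<in>UNIV. c $ l * u l) = 0"
    have "\<tau> (coker_class c w) (coker_functional c u) = \<tau> (coker_class c 0) (coker_functional c u)"
      by (simp only: \<tau>_eq)
    then show "(\<Sum>l\<in>UNIV. v l * u l) = 0"
      by (simp add: to_bidual_def coker_functional_dual[OF u] coker_functional_class[OF u] w_def)
  qed
  obtain m where "c $ m \<noteq> 0" using c_nonzero by blast
  then show ?thesis using torsionfree[of "c $ m" v "v m"] koszul by blast
qed

definition basisF :: "2 \<Rightarrow> ((((2, 'k) mpoly ^ 3) set \<Rightarrow> (2, 'k) mpoly) \<Rightarrow> (2, 'k) mpoly)" where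
  "basisF i = inv_into (carrier F) \<psi> (axis i 1)"

lemma basisF_closed: "basisF i \<in> carrier F" and \<psi>_basisF: "\<psi> (basisF i) = axis i 1"
  using \<psi>_bij by (simp_all add: basisF_def bij_betw_def inv_into_into f_inv_into_f)

lemma basisF_graded: "basisF i \<in> GF (- int (\<sigma> i))"
proof -
  have "axis i 1 \<in> \<psi> ` GF (- int (\<sigma> i))" unfolding \<psi>_image by (simp add: axis_def)
  then obtain g where g: "g \<in> GF (- int (\<sigma> i))" "\<psi> g = axis i 1" by force
  then have "g = basisF i" using \<psi>_inj[of g "basisF i"] GF_subset basisF_closed \<psi>_basisF by auto
  then show ?thesis using g(1) by simp
qed

text \<open>Evaluation at a syzygy, read as a functional on \<open>F\<close>, expresses it through the rows of \<open>\<xi>\<close>.\<close>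

lemma \<xi>_generate:
  assumes u: "(\<Sum>l\<in>UNIV. c $ l * u l) = 0"
  shows "\<exists>y. \<forall>l. u l = (\<Sum>i\<in>UNIV. y i * \<xi> i l)"
proof -
  let ?f = "coker_functional c u"
  have f: "?f \<in> carrier (dual E)" by (rule coker_functional_dual[OF u])
  have "u l = basisF 1 ?f * \<xi> 1 l + basisF 2 ?f * \<xi> 2 l" for l
  proof -
    let ?x = "coker_class c (axis l 1)"
    have closed: "\<xi> i l \<odot>\<^bsub>F\<^esub> basisF i \<in> carrier F" for i by (rule F_closed(2)[OF basisF_closed])
    have "\<psi> (\<tau> ?x) = \<psi> ((\<xi> 1 l \<odot>\<^bsub>F\<^esub> basisF 1) \<oplus>\<^bsub>F\<^esub> (\<xi> 2 l \<odot>\<^bsub>F\<^esub> basisF 2))"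
      unfolding \<psi>_add[OF closed closed] \<psi>_smult[OF basisF_closed] \<psi>_basisF
      by (simp add: vec_eq_iff forall_2 \<xi>_def \<omega>_def axis_def)
    then have "\<tau> ?x = (\<xi> 1 l \<odot>\<^bsub>F\<^esub> basisF 1) \<oplus>\<^bsub>F\<^esub> (\<xi> 2 l \<odot>\<^bsub>F\<^esub> basisF 2)"
      by (rule \<psi>_inj[OF \<tau>_closed[OF coker_class_closed] F_closed(1)[OF closed closed]])
    then have "\<tau> ?x ?f = ((\<xi> 1 l \<odot>\<^bsub>F\<^esub> basisF 1) \<oplus>\<^bsub>F\<^esub> (\<xi> 2 l \<odot>\<^bsub>F\<^esub> basisF 2)) ?f" by simp
    moreover have "\<tau> ?x ?f = u l"
    proof -
      have "(\<Sum>k\<in>UNIV. (axis l 1 :: (2, 'k) mpoly ^ 3) $ k * u k) = (\<Sum>k\<in>UNIV. if k = l then u l else 0)"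
        by (rule sum.cong) (auto simp: axis_def)
      then show ?thesis using f by (simp add: to_bidual_def coker_functional_class[OF u])
    qed
    ultimately show ?thesis using f by (simp add: mult.commute)
  qed
  then show ?thesis unfolding sum_2 by (intro exI[of _ "\<lambda>i. basisF i ?f"] allI)
qed

lemma sum_degrees: "\<sigma> 1 + \<sigma> 2 = d"
  by (rule syzygy_basis_degrees(1)[where a = "\<lambda>l. c $ l" and \<xi> = \<xi>, OF c_forms c_nonzero \<xi>_forms \<xi>_orthogonal torsionfree \<xi>_generate])

lemma scaled_basis: "\<exists>h v. h \<noteq> 0 \<and> (\<forall>i j. (\<Sum>l\<in>UNIV. v i l * \<xi> j l) = (if i = j then h else 0))"
  by (rule syzygy_basis_degrees(2)[where a = "\<lambda>l. c $ l" and \<xi> = \<xi>, OF c_forms c_nonzero \<xi>_forms \<xi>_orthogonal torsionfree \<xi>_generate])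

sublocale syzygy_basis "\<lambda>l. c $ l" \<xi> d \<sigma>
  by unfold_locales (use d c_forms c_nonzero \<xi>_forms sum_degrees \<xi>_orthogonal \<xi>_kernel in auto)

text \<open>The coordinates on \<open>F\<close> given by \<open>\<psi>\<close>, written as linear forms in \<open>w_1, w_2\<close>.\<close>

definition LF :: "((((2, 'k) mpoly ^ 3) set \<Rightarrow> (2, 'k) mpoly) \<Rightarrow> (2, 'k) mpoly) \<Rightarrow> (2, (2, 'k) mpoly) mpoly" where
  "LF g = (\<Sum>i\<in>UNIV. mconst (\<psi> g $ i) * mvar i)"

definition LE :: "((2, 'k) mpoly ^ 3) set \<Rightarrow> (2, (2, 'k) mpoly) mpoly" where
  "LE x = LF (\<tau> x)"

lemma LE_class: "LE (coker_class c v) = (\<Sum>l\<in>UNIV. mconst (v $ l) * T l)"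
  unfolding LE_def LF_def \<omega>_def[symmetric] \<omega>_eq sum_T_eq ..

lemma sum_axis: "(\<Sum>j\<in>UNIV. mconst ((axis i h :: (2, 'k) mpoly ^ 2) $ j) * mvar j) = (mconst h * mvar i :: (2, (2, 'k) mpoly) mpoly)"
proof -
  have "(\<Sum>j\<in>UNIV. mconst ((axis i h :: (2, 'k) mpoly ^ 2) $ j) * mvar j)
      = (\<Sum>j\<in>UNIV. if j = i then mconst h * mvar i else (0 :: (2, (2, 'k) mpoly) mpoly))"
    by (rule sum.cong) (auto simp: axis_def)
  then show ?thesis by simp
qed

lemma model_F: "graded_rees_model F LF 1 basisF GF"
proof
  fix g g' and r :: "(2, 'k) mpoly" assume g: "g \<in> carrier F"
  show "r \<odot>\<^bsub>F\<^esub> g \<in> carrier F" by (rule F_closed(2)[OF g])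
  show "LF (r \<odot>\<^bsub>F\<^esub> g) = mconst r * LF g"
    by (simp add: LF_def \<psi>_smult[OF g] mconst_mult sum_distrib_left mult.assoc del: dual_ops)
  show "\<exists>y. LF g = (\<Sum>i\<in>UNIV. mconst (y i) * mvar i)" unfolding LF_def by (rule exI) (rule refl)
  assume g': "g' \<in> carrier F"
  show "g \<oplus>\<^bsub>F\<^esub> g' \<in> carrier F" by (rule F_closed(1)[OF g g'])
  show "LF (g \<oplus>\<^bsub>F\<^esub> g') = LF g + LF g'"
    by (simp add: LF_def \<psi>_add[OF g g'] mconst_add distrib_right sum.distrib del: dual_ops)
  assume "LF g = LF g'"
  then have "(\<Sum>i\<in>UNIV. mconst (\<psi> g $ i - \<psi> g' $ i) * mvar i) = (0 :: (2, (2, 'k) mpoly) mpoly)"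
    by (simp add: LF_def mconst_diff left_diff_distrib sum_subtractf)
  then have "\<psi> g $ i - \<psi> g' $ i = 0" for i by (rule mvar_combination_eq_0)
  then have "\<psi> g = \<psi> g'" by (simp add: vec_eq_iff)
  then show "g = g'" by (rule \<psi>_inj[OF g g'])
next
  show "(1 :: (2, 'k) mpoly) \<noteq> 0" by simp
  show "basisF i \<in> carrier F" for i by (rule basisF_closed)
  show "LF (basisF i) = mconst 1 * mvar i" for i unfolding LF_def \<psi>_basisF by (rule sum_axis)
  show "GF j \<subseteq> carrier F" for j by (rule GF_subset)
qed

text \<open>The basis of \<open>F\<close> need not lie in \<open>E\<close>, but by \<open>scaled_basis\<close> a common nonzero multiple does.\<close>

lemma model_E: "\<exists>h e. graded_rees_model E LE h e GE"
proof -
  obtain h v where hv: "h \<noteq> 0" "\<And>i j. (\<Sum>l\<in>UNIV. v i l * \<xi> j l) = (if i = j then h else 0)"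
    using scaled_basis by blast
  interpret F: graded_rees_model F LF 1 basisF GF by (rule model_F)
  have "graded_rees_model E LE h (\<lambda>i. coker_class c (\<chi> l. v i l)) GE"
  proof
    fix x y and r :: "(2, 'k) mpoly" assume x: "x \<in> carrier E"
    show "r \<odot>\<^bsub>E\<^esub> x \<in> carrier E" by (rule E_closed(2)[OF x])
    show "LE (r \<odot>\<^bsub>E\<^esub> x) = mconst r * LE x"
      unfolding LE_def to_bidual_smult[OF x] by (rule F.L_smult[OF \<tau>_closed[OF x]])
    show "\<exists>y. LE x = (\<Sum>i\<in>UNIV. mconst (y i) * mvar i)"
      unfolding LE_def by (rule F.L_linear[OF \<tau>_closed[OF x]])
    assume y: "y \<in> carrier E"
    show "x \<oplus>\<^bsub>E\<^esub> y \<in> carrier E" by (rule E_closed(1)[OF x y])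
    show "LE (x \<oplus>\<^bsub>E\<^esub> y) = LE x + LE y"
      unfolding LE_def to_bidual_add[OF x y] by (rule F.L_add[OF \<tau>_closed[OF x] \<tau>_closed[OF y]])
    assume eq: "LE x = LE y"
    obtain p q where pq: "x = coker_class c p" "y = coker_class c q"
      using x y by (auto simp: carrier_coker)
    have "(\<Sum>l\<in>UNIV. mconst (p $ l - q $ l) * T l) = 0"
      using eq unfolding pq LE_class by (simp add: mconst_diff left_diff_distrib sum_subtractf)
    then obtain s where "\<And>l. p $ l - q $ l = s * c $ l" by (rule linear_relation) blast
    then have "p = q + s *s c" by (simp add: vec_eq_iff algebra_simps)
    then show "x = y" unfolding pq coker_class_eq_iff by blast
  next
    show "h \<noteq> 0" by (rule hv(1))
    show "coker_class c (\<chi> l. v i l) \<in> carrier E" for i by (rule coker_class_closed)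
    show "LE (coker_class c (\<chi> l. v i l)) = mconst h * mvar i" for i
    proof -
      have "LE (coker_class c (\<chi> l. v i l)) = (\<Sum>j\<in>UNIV. mconst ((axis i h :: (2, 'k) mpoly ^ 2) $ j) * mvar j)"
        unfolding LE_class vec_lambda_beta sum_T_eq hv(2) by (rule sum.cong) (auto simp: axis_def)
      then show ?thesis by (simp only: sum_axis)
    qed
    show "GE j \<subseteq> carrier E" for j by (auto simp: coker_grading_eq carrier_coker)
  qed
  then show ?thesis by blast
qed

lemma blowup_pair: "\<exists>h e. blowup_pair (\<lambda>l. c $ l) \<xi> d \<sigma> F LF basisF GF E LE h e GE \<tau> (coker_gen c)"
proof -
  obtain h e where "graded_rees_model E LE h e GE" using model_E by blast
  then interpret E: graded_rees_model E LE h e GE .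
  interpret F: graded_rees_model F LF 1 basisF GF by (rule model_F)
  have "blowup_pair (\<lambda>l. c $ l) \<xi> d \<sigma> F LF basisF GF E LE h e GE \<tau> (coker_gen c)"
  proof
    fix g j assume "g \<in> GF j"
    then have "\<psi> g \<in> \<psi> ` GF j" by (rule imageI)
    then have \<psi>g: "\<psi> g $ i \<in> forms (int (\<sigma> i) + j)" for i unfolding \<psi>_image by blast
    show "LF g \<in> twisted weight j \<and> LF g \<in> forms 1"
    proof
      show "LF g \<in> twisted weight j" unfolding LF_def
        by (intro sum_twisted) (rule mult_row'[OF mconst_row[OF \<psi>g] mvar_row], simp)
      show "LF g \<in> forms 1" unfolding LF_def by (intro sum_forms mconst_mult_forms mvar_forms)
    qed
  next
    show "basisF i \<in> GF (- int (\<sigma> i))" for i by (rule basisF_graded)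
    show "\<exists>v. (\<forall>l. v l \<in> forms j) \<and> LE x = (\<Sum>l\<in>UNIV. mconst (v l) * T l)" if x: "x \<in> GE j" for x j
    proof -
      obtain v :: "(2, 'k) mpoly ^ 3" where "\<And>l. v $ l \<in> forms j" "x = coker_class c v"
        using x by (auto simp: coker_grading_eq)
      then show ?thesis using LE_class by (intro exI[of _ "\<lambda>l. v $ l"]) simp
    qed
    show "coker_gen c l \<in> GE 0" for l
      unfolding coker_gen_eq coker_grading_eq by (intro imageI) (simp add: axis_def)
    show "LE (coker_gen c l) = T l" for l
    proof -
      have "(\<Sum>k\<in>UNIV. mconst ((axis l 1 :: (2, 'k) mpoly ^ 3) $ k) * T k) = (\<Sum>k\<in>UNIV. if k = l then T l else 0)"
        by (rule sum.cong) (auto simp: axis_def)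
      then show ?thesis by (simp add: coker_gen_eq LE_class)
    qed
    show "\<tau> x \<in> carrier F" if "x \<in> carrier E" for x by (rule \<tau>_closed[OF that])
    show "LF (\<tau> x) = LE x" for x by (simp add: LE_def)
  qed
  then show ?thesis by blast
qed

end

theorem proposition4p7:
  fixes I :: "(2, 'k::field) mpoly set"
    and f :: "(2, 'k) mpoly ^ 3"
    and \<phi> :: "(2, 'k) mpoly ^ 2 ^ 3"
    and d d1 d2 \<sigma>1 \<sigma>2 :: nat
    and \<psi> :: "(((((2, 'k) mpoly ^ 3) set \<Rightarrow> (2, 'k) mpoly) \<Rightarrow> (2, 'k) mpoly)
             \<Rightarrow> (2, 'k) mpoly ^ 2)"
  defines "E \<equiv> coker_module (column 1 \<phi>)"
    and "GE \<equiv> coker_grading (column 1 \<phi>)"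
  defines "F \<equiv> dual (dual E)"
    and "GF \<equiv> dual_grading (dual E) (dual_grading E GE)"
  defines "\<iota> \<equiv> rees_map E F (to_bidual E)"
    and "T \<equiv> coker_rees_eval (column 1 \<phi>) :: (3, 'k) mpoly \<Rightarrow> _"
  assumes ideal_I: "ideal I ring_of_type_algebra"
    and height_I: "ideal_height ring_of_type_algebra I = 2"
    and forms_f: "\<forall>l. f $ l \<in> forms (int d)"
    and three_f: "card (range (($) f)) = 3"
    and min_gens: "minimally_generates ring_of_type_algebra (range (($) f)) I"
    and d1_pos: "1 \<le> d1" and d1_le_d2: "d1 \<le> d2"
    and forms_col1: "\<forall>l. \<phi> $ l $ 1 \<in> forms (int d1)" and forms_col2: "\<forall>l. \<phi> $ l $ 2 \<in> forms (int d2)"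
    and phi_inj: "inj ((*v) \<phi>)"
    and phi_exact: "range ((*v) \<phi>) = {v. (\<Sum>l\<in>UNIV. v $ l * f $ l) = 0}"
    and sigma_le: "\<sigma>2 \<le> \<sigma>1"
    and psi_iso: "graded_module_iso F GF vec_module
           (\<lambda>j. {v. v $ 1 \<in> shift (int \<sigma>1) forms j \<and> v $ 2 \<in> shift (int \<sigma>2) forms j}) \<psi>"
  shows "T \<in> ring_iso ring_of_type_algebra ((rees E)\<lparr>carrier := rees_row E GE 0\<rparr>)
    \<and> (\<forall>j. T ` forms j = rees_part E GE 0 j)
    \<and> (\<forall>i::int. -1 \<le> i \<and> i \<le> int d1 - 1 \<longrightarrow>
        (\<exists>\<Psi> \<Theta>.
          graded_module_iso
            (rees_row_module F GF i (\<lambda>u. \<iota> (T u))) (rees_part F GF i)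
            (module_sum (free_module (nat (i + 1))) (free_module (nat (int d1 - i - 1))))
            (sum_grading (free_grading (nat (i + 1)))
              (shift (-1) (free_grading (nat (int d1 - i - 1))))) \<Psi>
          \<and> graded_module_iso
            (rees_row_module E GE i T) (rees_part E GE i)
            (free_module (nat (i + 1))) (free_grading (nat (i + 1))) \<Theta>
          \<and> (\<forall>a\<in>rees_row E GE i.
               \<iota> a \<in> rees_row F GF i \<and>
               \<Psi> (\<iota> a) = (\<Theta> a, \<zero>\<^bsub>free_module (nat (int d1 - i - 1))\<^esub>))))"
proof -
  define \<sigma> where "\<sigma> = (\<lambda>i::2. if i = 1 then \<sigma>1 else \<sigma>2)"
  have grading: "(\<lambda>j. {v :: (2, 'k) mpoly ^ 2. v $ 1 \<in> shift (int \<sigma>1) forms j \<and> v $ 2 \<in> shift (int \<sigma>2) forms j})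
      = (\<lambda>j. {v. \<forall>i. v $ i \<in> forms (int (\<sigma> i) + j)})"
    by (simp add: \<sigma>_def forall_2 shift_def)
  interpret Q: rank_two_bidual "column 1 \<phi>" d1 \<sigma> \<psi>
  proof
    show "column 1 \<phi> $ l \<in> forms (int d1)" for l using forms_col1 by (simp add: column_def)
    show "\<exists>l. column 1 \<phi> $ l \<noteq> 0" by (rule column_nonzero_torsionfree(1)[OF phi_inj phi_exact])
    show "\<exists>z. \<forall>l. v l = z * column 1 \<phi> $ l" if "h \<noteq> 0" "\<And>l. h * v l = r * column 1 \<phi> $ l" for h r v
      by (rule column_nonzero_torsionfree(2)[OF phi_inj phi_exact that])
  qed (use d1_pos psi_iso in \<open>simp_all add: E_def GE_def F_def GF_def grading\<close>)
  obtain h e where "blowup_pair (\<lambda>l. column 1 \<phi> $ l) Q.\<xi> d1 \<sigma> F Q.LF Q.basisF GF E Q.LE h e GE (to_bidual E) (coker_gen (column 1 \<phi>))"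
    using Q.blowup_pair unfolding E_def GE_def F_def GF_def by blast
  then interpret B: blowup_pair "\<lambda>l. column 1 \<phi> $ l" Q.\<xi> d1 \<sigma> F Q.LF Q.basisF GF E Q.LE h e GE "to_bidual E" "coker_gen (column 1 \<phi>)" .
  have T: "B.presentation = T"
  proof
    fix u show "B.presentation u = T u"
      unfolding B.presentation_def B.presentation_poly_def by (simp add: T_def E_def coker_rees_eval_def)
  qed
  have rows: "\<exists>\<Psi> \<Theta>.
          graded_module_iso
            (rees_row_module F GF i (\<lambda>u. \<iota> (T u))) (rees_part F GF i)
            (module_sum (free_module (nat (i + 1))) (free_module (nat (int d1 - i - 1))))
            (sum_grading (free_grading (nat (i + 1)))
              (shift (-1) (free_grading (nat (int d1 - i - 1))))) \<Psi>
          \<and> graded_module_iso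
            (rees_row_module E GE i T) (rees_part E GE i)
            (free_module (nat (i + 1))) (free_grading (nat (i + 1))) \<Theta>
          \<and> (\<forall>a\<in>rees_row E GE i.
               \<iota> a \<in> rees_row F GF i \<and>
               \<Psi> (\<iota> a) = (\<Theta> a, \<zero>\<^bsub>free_module (nat (int d1 - i - 1))\<^esub>))"
    if i: "- 1 \<le> i \<and> i \<le> int d1 - 1" for i
  proof -
    have "nat (i + 1) \<le> d1" "int (nat (i + 1)) - 1 = i" "d1 - nat (i + 1) = nat (int d1 - i - 1)"
      using i by auto
    then show ?thesis
      using B.rows_free[of "nat (i + 1)"] unfolding T \<iota>_def by simp
  qed
  show ?thesis
    using B.presentation_iso B.presentation_grading rows unfolding T by blast
qed

end
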